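(* Let $\alpha>1$ and $p>0$. (1) Assume that $\mathrm{Tr}\,G_{\alpha,p}$ is jointly convex. Then $\max\bigl\{1/2,\frac{\alpha-1}{\alpha}\bigr\}\le p\le1$. (2) For $\alpha=2$, $\mathrm{Tr}\,G_{2,p}$ is jointly convex if and only if $1/2\le p\le1$. (3) For $p=1$, $\mathrm{Tr}\,G_{\alpha,1}$ is jointly convex if and only if $1<\alpha\le2$. (4) If $1<\alpha\le2$ and $0<p\le1$, then for any $n\in\mathbb{N}$ and any fixed $B\in\mathbb{M}_n^+$, the function $A\mapsto\mathrm{Tr}\,G_{\alpha,p}(A,B)$ is convex on $\{A\in\mathbb{M}_n^+:s(A)\ge s(B)\}$.
   Context: Notation: $\mathbb{M}_n^+$ (resp. $\mathbb{M}_n^{++}$) is the set of $n\times n$ complex positive semidefinite (resp. positive definite) matrices; $s(A)$ is the support projection of $A\ge0$. $A^{-1}$ denotes the generalized inverse (inverse on the support of $A$, zero on the kernel), and $A^r:=(A^{-1})^{-r}$ for $r<0$. For $\alpha>1$, $p>0$ and $A,B\ge0$ with $s(A)\ge s(B)$, $A\#_\alpha B:=A^{1/2}(A^{-1/2}BA^{-1/2})^{\alpha}A^{1/2}$ and $G_{\alpha,p}(A,B):=(A^p\#_\alpha B^p)^{1/p}$. "$\mathrm{Tr}\,G_{\alpha,p}$ is jointly convex" means that $(A,B)\mapsto\mathrm{Tr}\,G_{\alpha,p}(A,B)$ is jointly convex on $\{(A,B)\in\mathbb{M}_n^+\times\mathbb{M}_n^+:s(A)\ge s(B)\}$ for every $n\in\mathbb{N}$;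 equivalently, on $\mathbb{M}_n^{++}\times\mathbb{M}_n^{++}$ for every $n\in\mathbb{N}$. *)

theory Defs
  imports "HOL-Analysis.Analysis" "Jordan_Normal_Form.Schur_Decomposition"
begin

definition psd_mats :: "nat \<Rightarrow> complex mat set" where
  "psd_mats n = {A \<in> carrier_mat n n. mat_adjoint A = A \<and>
     (\<forall>x \<in> carrier_vec n. 0 \<le> Re ((A *\<^sub>v x) \<bullet>c x))}"

definition loewner_le :: "nat \<Rightarrow> complex mat \<Rightarrow> complex mat \<Rightarrow> bool" where
  "loewner_le n A B \<longleftrightarrow> A \<in> carrier_mat n n \<and> B \<in> carrier_mat n n \<and> B - A \<in> psd_mats n"

definition mat_trace :: "complex mat \<Rightarrow> complex" where
  "mat_trace A = (\<Sum>i<dim_row A. A $$ (i, i))"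

definition mat_range :: "complex mat \<Rightarrow> complex vec set" where
  "mat_range A = (\<lambda>x. A *\<^sub>v x) ` carrier_vec (dim_col A)"

text \<open>The support projection of a Hermitian matrix: the orthogonal projection onto its range,
  i.e. onto the orthogonal complement of its kernel.\<close>

definition supp_proj :: "complex mat \<Rightarrow> complex mat" where
  "supp_proj A = (THE P. P \<in> carrier_mat (dim_row A) (dim_row A) \<and>
     mat_adjoint P = P \<and> P * P = P \<and> mat_range P = mat_range A)"

text \<open>Functional calculus \<open>f(A) = U diag(f(d\<^sub>0), \<dots>) U\<^sup>*\<close> for a Hermitian matrix
  \<open>A = U diag(d\<^sub>0, \<dots>) U\<^sup>*\<close>. The result does not depend on the diagonalization, and
  one exists by the spectral theorem; on non-Hermitian arguments the value is meaningless.\<close>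

definition mat_fun :: "(real \<Rightarrow> real) \<Rightarrow> complex mat \<Rightarrow> complex mat" where
  "mat_fun f A = (THE M. \<exists>U d. let n = dim_row A in
     U \<in> carrier_mat n n \<and> U * mat_adjoint U = 1\<^sub>m n \<and> mat_adjoint U * U = 1\<^sub>m n \<and>
     A = U * mat_diag n (\<lambda>i. complex_of_real (d i)) * mat_adjoint U \<and>
     M = U * mat_diag n (\<lambda>i. complex_of_real (f (d i))) * mat_adjoint U)"

text \<open>Since \<^term>\<open>inverse (0::real) = 0\<close>, this is the inverse on the support and zero on
  the kernel.\<close>

definition gen_inverse :: "complex mat \<Rightarrow> complex mat" where
  "gen_inverse A = mat_fun inverse A"

text \<open>Powers of positive semidefinite matrices. Since \<^term>\<open>0 powr r = (0::real)\<close> for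
  every \<open>r\<close>, the power vanishes on the kernel; in particular the exponent \<open>0\<close> gives the
  support projection.\<close>

definition mat_powr :: "complex mat \<Rightarrow> real \<Rightarrow> complex mat" where
  "mat_powr A r = (if r < 0 then mat_fun (\<lambda>t. t powr (- r)) (gen_inverse A)
                   else mat_fun (\<lambda>t. t powr r) A)"

definition geo_mean :: "real \<Rightarrow> complex mat \<Rightarrow> complex mat \<Rightarrow> complex mat" where
  "geo_mean \<alpha> A B = mat_powr A (1/2) *
     mat_powr (mat_powr A (- (1/2)) * B * mat_powr A (- (1/2))) \<alpha> * mat_powr A (1/2)"

definition G_mean :: "real \<Rightarrow> real \<Rightarrow> complex mat \<Rightarrow> complex mat \<Rightarrow> complex mat" where
  "G_mean \<alpha> p A B = mat_powr (geo_mean \<alpha> (mat_powr A p) (mat_powr B p)) (1/p)"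

text \<open>\<^term>\<open>G_mean \<alpha> p A B\<close> is positive semidefinite for admissible arguments, so taking the
  real part of its trace loses nothing.\<close>

definition Tr_G :: "real \<Rightarrow> real \<Rightarrow> complex mat \<Rightarrow> complex mat \<Rightarrow> real" where
  "Tr_G \<alpha> p A B = Re (mat_trace (G_mean \<alpha> p A B))"

definition G_domain :: "nat \<Rightarrow> (complex mat \<times> complex mat) set" where
  "G_domain n = {(A, B). A \<in> psd_mats n \<and> B \<in> psd_mats n \<and>
     loewner_le n (supp_proj B) (supp_proj A)}"

definition convex_comb :: "real \<Rightarrow> complex mat \<Rightarrow> complex mat \<Rightarrow> complex mat" where
  "convex_comb t X Y = complex_of_real t \<cdot>\<^sub>m X + complex_of_real (1 - t) \<cdot>\<^sub>m Y"

text \<open>The type of matrices of arbitrary dimension is not a real vector space, so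
  \<^const>\<open>convex_on\<close> does not apply to it. The sets on which convexity is required below,
  \<^term>\<open>G_domain n\<close> and its sections, are themselves convex.\<close>

definition Tr_G_jointly_convex :: "real \<Rightarrow> real \<Rightarrow> bool" where
  "Tr_G_jointly_convex \<alpha> p \<longleftrightarrow> (\<forall>n\<ge>1. \<forall>A\<^sub>1 B\<^sub>1 A\<^sub>2 B\<^sub>2. \<forall>t\<in>{0..1}.
     (A\<^sub>1, B\<^sub>1) \<in> G_domain n \<longrightarrow> (A\<^sub>2, B\<^sub>2) \<in> G_domain n \<longrightarrow>
     Tr_G \<alpha> p (convex_comb t A\<^sub>1 A\<^sub>2) (convex_comb t B\<^sub>1 B\<^sub>2)
       \<le> t * Tr_G \<alpha> p A\<^sub>1 B\<^sub>1 + (1 - t) * Tr_G \<alpha> p A\<^sub>2 B\<^sub>2)"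

definition mat_convex_on :: "complex mat set \<Rightarrow> (complex mat \<Rightarrow> real) \<Rightarrow> bool" where
  "mat_convex_on S f \<longleftrightarrow> (\<forall>X\<in>S. \<forall>Y\<in>S. \<forall>t\<in>{0..1}.
     f (convex_comb t X Y) \<le> t * f X + (1 - t) * f Y)"

end

theory Submission
  imports Defs "HOL-Real_Asymp.Real_Asymp"
begin

text \<open>Sufficiency rests on variational formulas. For a suitable congruence
  \<open>A = V V\<^sup>*\<close>, \<open>B = V diag(e) V\<^sup>*\<close> one has \<open>A #\<^sub>\<alpha> B = V diag(e\<^sup>\<alpha>) V\<^sup>*\<close>, and writing \<open>e\<^sup>\<alpha>\<close> with
  \<open>1 < \<alpha> < 2\<close> as an integral of \<open>e\<^sup>2 / (e + s)\<close> exhibits the mean as an integral of suprema of functions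
  that are affine in \<open>(A, B)\<close>: it is jointly operator convex and decreasing in \<open>A\<close>. Together with the
  operator concavity of \<open>A\<^sup>p\<close> and Jensen's inequality for \<open>Tr X\<^sup>1\<^sup>/\<^sup>p\<close> this yields (4) and one half of (3).
  The same device, applied to the coefficients of \<open>K\<close> in eigenbases of \<open>A\<close> and \<open>Y\<close>, proves Lieb's concavity
  and Ando's convexity of \<open>Tr K\<^sup>* A\<^sup>q K Y\<^sup>1\<^sup>-\<^sup>q\<close>. Variational formulas of Young type turn
  these into the concavity of \<open>Tr (Z\<^sup>* A\<^sup>p Z)\<^sup>1\<^sup>/\<^sup>p\<close> and the convexity of \<open>Tr (Z\<^sup>* B\<^sup>2\<^sup>p Z)\<^sup>1\<^sup>/\<^sup>2\<^sup>p\<close>, and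
  \<open>Tr G\<^sub>2\<^sub>,\<^sub>p(A, B)\<close> is the maximum over \<open>Z\<close> of twice the latter minus the former.

  Necessity uses \<open>2 \<times> 2\<close> matrices. By homogeneity joint convexity makes \<open>Tr G\<close> decreasing in \<open>A\<close>. For a
  projection \<open>B\<close> of rank one this would make \<open>A \<mapsto> A\<^sup>-\<^sup>p\<close> operator decreasing, which fails for
  \<open>p > 1\<close>; for \<open>p = 1\<close> and \<open>B\<close> close to such a projection it would make \<open>X \<mapsto> X\<^sup>1\<^sup>-\<^sup>\<alpha>\<close> operator decreasing,
  which fails for \<open>\<alpha> > 2\<close>. The lower bounds on \<open>p\<close> come from fixed \<open>A = diag(1, N)\<close>, \<open>N \<rightarrow> \<infinity>\<close>, and pairs
  \<open>B\<^sub>\<plusminus>\<close> that are reflections of each other, so that their mean is diagonal.\<close>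

section \<open>Adjoints and the spectral theorem\<close>

text \<open>Supports are the recurring obstacle: \<open>A\<close> may be singular, and then
  \<open>A^(-1/2) A^(1/2)\<close> is only a projection. The sufficiency part makes no density
  argument. With \<open>inverse 0 = 0\<close> and \<open>0 powr r = 0\<close> the variational
  formulas hold on the whole domain, and s(A) \<ge> s(B) is used as the identity
  \<open>B * mat_powr A 0 = B\<close>, which absorbs the projection. Only where a matrix
  \<open>Y\<close> carries a negative exponent must it be positive definite, and there a small shift
  of its eigenvalues is paid for. The extremal matrix in an integral of suprema changes with
  \<open>s\<close>. Therefore inequalities are proved at each fixed \<open>s\<close>, where the
  extremal matrix of the convex combination competes for both end points, and only then integrated.
  Operator inequalities appear as inequalities between traces of \<open>W* X W\<close> for all
  square \<open>W\<close>; a \<open>W\<close> with a single nonzero column plays the role of a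
  vector.\<close>

lemma adj_carrier [simp]: "A \<in> carrier_mat n m \<Longrightarrow> mat_adjoint A \<in> carrier_mat m n"
  by (auto simp: mat_adjoint_def)

lemma dim_adj [simp]: "dim_row (mat_adjoint A) = dim_col A" "dim_col (mat_adjoint A) = dim_row A"
  by (auto simp: mat_adjoint_def)

lemma adj_index [simp]:
  "i < dim_col A \<Longrightarrow> j < dim_row A \<Longrightarrow> mat_adjoint A $$ (i, j) = cnj (A $$ (j, i))"
  by (simp add: mat_adjoint_def mat_of_rows_index)

lemma adj_adj [simp]: "mat_adjoint (mat_adjoint A) = (A :: complex mat)"
  by (rule eq_matI) auto

lemma adj_mult:
  "A \<in> carrier_mat n m \<Longrightarrow> B \<in> carrier_mat m k \<Longrightarrow>
    mat_adjoint (A * B) = mat_adjoint B * mat_adjoint (A :: complex mat)"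
  by (rule eq_matI) (auto simp: scalar_prod_def mult.commute intro!: sum.cong)

lemma adj_one [simp]: "mat_adjoint (1\<^sub>m n) = (1\<^sub>m n :: complex mat)"
  by (rule eq_matI) auto

definition unitary_mat :: "nat \<Rightarrow> complex mat \<Rightarrow> bool" where
  "unitary_mat n U \<longleftrightarrow>
    U \<in> carrier_mat n n \<and> U * mat_adjoint U = 1\<^sub>m n \<and> mat_adjoint U * U = 1\<^sub>m n"

abbreviation real_diag :: "nat \<Rightarrow> (nat \<Rightarrow> real) \<Rightarrow> complex mat" where
  "real_diag n d \<equiv> mat_diag n (\<lambda>i. complex_of_real (d i))"

definition spectral_dec :: "nat \<Rightarrow> complex mat \<Rightarrow> (nat \<Rightarrow> real) \<Rightarrow> complex mat \<Rightarrow> bool" where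
  "spectral_dec n U d A \<longleftrightarrow> unitary_mat n U \<and> A = U * real_diag n d * mat_adjoint U"

lemma unitary_matI:
  assumes "U \<in> carrier_mat n n" "mat_adjoint U * U = 1\<^sub>m n"
  shows "unitary_mat n U"
  using assms mat_mult_left_right_inverse[of "mat_adjoint U" n U] by (auto simp: unitary_mat_def)

lemma unitary_mat_mult:
  assumes "unitary_mat n U" "unitary_mat n V"
  shows "unitary_mat n (U * V)"
proof (rule unitary_matI)
  have c: "U \<in> carrier_mat n n" "V \<in> carrier_mat n n" using assms by (auto simp: unitary_mat_def)
  then show "U * V \<in> carrier_mat n n" by auto
  have "mat_adjoint (U * V) * (U * V) = mat_adjoint V * ((mat_adjoint U * U) * V)"
    using c by (simp add: adj_mult assoc_mult_mat[of _ n n _ n _ n])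
  also have "\<dots> = 1\<^sub>m n" using assms c by (simp add: unitary_mat_def)
  finally show "mat_adjoint (U * V) * (U * V) = 1\<^sub>m n" .
qed

text \<open>An eigenvector, completed to a basis, survives Gram-Schmidt as its first vector. The
  orthogonal vectors come unnormalised; \<open>q i\<close> is the squared norm of the
  \<open>i\<close>-th one.\<close>

lemma unitary_with_eigenvector:
  assumes A: "A \<in> carrier_mat n n" and n: "n > 0"
  obtains W e where "unitary_mat n W" "A *\<^sub>v col W 0 = e \<cdot>\<^sub>v col W 0"
proof -
  have "degree (char_poly A) = n" using degree_monic_char_poly[OF A] by simp
  then have "\<not> constant (poly (char_poly A))" using n constant_degree[of "char_poly A"] by simp
  then obtain e where "poly (char_poly A) e = 0" using fundamental_theorem_of_algebra by blast
  then have "eigenvalue A e" using eigenvalue_root_char_poly[OF A] by simp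
  then obtain v where v: "v \<in> carrier_vec n" "v \<noteq> 0\<^sub>v n" "A *\<^sub>v v = e \<cdot>\<^sub>v v"
    using A unfolding eigenvalue_def eigenvector_def by auto
  interpret cof_vec_space n "TYPE(complex)" .
  define b where "b = basis_completion v"
  define ws where "ws = gram_schmidt n b"
  note bc = basis_completion[OF v(1,2), folded b_def]
  obtain vs where bv: "b = v # vs" using bc(6,7) n by (cases b) auto
  have ws: "set ws \<subseteq> carrier_vec n" "corthogonal ws" "length ws = n"
    using gram_schmidt_result[OF bc(2,4,5) refl, folded ws_def] bc(6) by auto
  have hd: "hd ws = v" using gram_schmidt_hd[OF v(1), of vs, folded bv] ws_def by simp
  have wc: "ws ! i \<in> carrier_vec n" if "i < n" for i using that ws by auto
  define q where "q i = Re (ws ! i \<bullet>c ws ! i)" for i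
  have q: "ws ! i \<bullet>c ws ! i = of_real (q i)" "q i > 0" if "i < n" for i
  proof -
    have "ws ! i \<bullet>c ws ! i = (\<Sum>k<n. ws ! i $ k * cnj (ws ! i $ k))"
      using wc[OF that] by (simp add: scalar_prod_def atLeast0LessThan)
    also have "\<dots> = of_real (\<Sum>k<n. (cmod (ws ! i $ k))\<^sup>2)"
      by (simp only: of_real_sum complex_norm_square)
    finally have e: "ws ! i \<bullet>c ws ! i = of_real (\<Sum>k<n. (cmod (ws ! i $ k))\<^sup>2)" .
    then show *: "ws ! i \<bullet>c ws ! i = of_real (q i)" by (simp add: q_def)
    have "ws ! i \<bullet>c ws ! i \<noteq> 0" using ws that by (auto simp: corthogonal_def)
    then have "q i \<noteq> 0" using * by auto
    moreover have "q i \<ge> 0" unfolding q_def e by (simp add: sum_nonneg)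
    ultimately show "q i > 0" by simp
  qed
  define W where "W = Matrix.mat n n (\<lambda>(k, i). ws ! i $ k / of_real (sqrt (q i)))"
  have W: "W \<in> carrier_mat n n" by (simp add: W_def)
  have "mat_adjoint W * W = 1\<^sub>m n"
  proof (rule eq_matI)
    fix i j assume "i < dim_row (1\<^sub>m n :: complex mat)" "j < dim_col (1\<^sub>m n :: complex mat)"
    then have ij: "i < n" "j < n" by auto
    have "(mat_adjoint W * W) $$ (i, j) = (\<Sum>k<n. cnj (W $$ (k, i)) * W $$ (k, j))"
      using W ij by (auto simp: scalar_prod_def atLeast0LessThan)
    also have "\<dots> = (\<Sum>k<n. (ws ! j $ k * cnj (ws ! i $ k)) / (of_real (sqrt (q i)) * of_real (sqrt (q j))))"
      using ij by (intro sum.cong refl) (simp add: W_def)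
    also have "\<dots> = (ws ! j \<bullet>c ws ! i) / (of_real (sqrt (q i)) * of_real (sqrt (q j)))"
      using wc[OF ij(1)] wc[OF ij(2)] by (simp add: scalar_prod_def atLeast0LessThan sum_divide_distrib)
    also have "\<dots> = (1\<^sub>m n) $$ (i, j)"
    proof (cases "i = j")
      case True
      have "(of_real (sqrt (q i)) * of_real (sqrt (q i)) :: complex) = of_real (q i)"
        using q(2)[OF ij(1)] by (simp flip: of_real_mult)
      then show ?thesis using True ij q[OF ij(1)] by simp
    next
      case False
      then have "ws ! j \<bullet>c ws ! i = 0" using ws ij by (auto simp: corthogonal_def)
      then show ?thesis using False ij by simp
    qed
    finally show "(mat_adjoint W * W) $$ (i, j) = (1\<^sub>m n) $$ (i, j)" .
  qed (use W in auto)
  then have "unitary_mat n W" by (intro unitary_matI W)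
  moreover have "A *\<^sub>v col W 0 = e \<cdot>\<^sub>v col W 0"
  proof -
    have "ws ! 0 = v" using hd ws n by (metis hd_conv_nth length_greater_0_conv)
    then have "col W 0 = (1 / of_real (sqrt (q 0))) \<cdot>\<^sub>v v"
      using n v(1) by (intro eq_vecI) (auto simp: W_def)
    then show ?thesis using v A by (simp add: mult_mat_vec smult_smult_assoc mult.commute)
  qed
  ultimately show ?thesis by (rule that)
qed

text \<open>Deflation: after conjugation by \<open>W\<close>, column 0 is \<open>e\<close> times the
  first unit vector; hermiticity clears row 0 as well and makes \<open>e\<close> real. The induction
  continues with the lower right block.\<close>

lemma hermitian_spectral:
  "A \<in> carrier_mat n n \<Longrightarrow> mat_adjoint A = A \<Longrightarrow> \<exists>U d. spectral_dec n U d A"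
proof (induction n arbitrary: A)
  case 0
  have "spectral_dec 0 (1\<^sub>m 0) (\<lambda>_. 0) A"
    using 0 unfolding spectral_dec_def unitary_mat_def by auto
  then show ?case by blast
next
  case (Suc m)
  let ?n = "Suc m"
  note A = Suc.prems(1)
  obtain W e where W: "unitary_mat ?n W" and We: "A *\<^sub>v col W 0 = e \<cdot>\<^sub>v col W 0"
    using unitary_with_eigenvector[OF A] by auto
  have Wc: "W \<in> carrier_mat ?n ?n" and WW: "mat_adjoint W * W = 1\<^sub>m ?n" "W * mat_adjoint W = 1\<^sub>m ?n"
    using W by (auto simp: unitary_mat_def)
  define B where "B = mat_adjoint W * A * W"
  have B: "B \<in> carrier_mat ?n ?n" using Wc A by (auto simp: B_def)
  have Bh: "mat_adjoint B = B"
    using Wc A Suc.prems(2) unfolding B_def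
    by (simp add: adj_mult[of _ ?n ?n _ ?n] assoc_mult_mat[of _ ?n ?n _ ?n _ ?n]
      mult_carrier_mat[of _ ?n ?n])
  have sym: "B $$ (i, j) = cnj (B $$ (j, i))" if "i < ?n" "j < ?n" for i j
    using that B adj_index[of i B j] Bh by auto
  have B0: "B $$ (i, 0) = (if i = 0 then e else 0)" if i: "i < ?n" for i
  proof -
    have "B = mat_adjoint W * (A * W)" using A Wc by (simp add: B_def assoc_mult_mat[of _ ?n ?n _ ?n _ ?n]
      mult_carrier_mat[of _ ?n ?n])
    then have "B $$ (i, 0) = row (mat_adjoint W) i \<bullet> col (A * W) 0"
      using i A Wc by auto
    also have "col (A * W) 0 = A *\<^sub>v col W 0" using A Wc by (intro col_mult2[of _ ?n ?n _ ?n]) auto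
    finally have "B $$ (i, 0) = row (mat_adjoint W) i \<bullet> (A *\<^sub>v col W 0)" .
    also have "\<dots> = e * (row (mat_adjoint W) i \<bullet> col W 0)"
      unfolding We using Wc i by (subst scalar_prod_smult_right) auto
    also have "row (mat_adjoint W) i \<bullet> col W 0 = (mat_adjoint W * W) $$ (i, 0)" using i Wc by auto
    finally show ?thesis using i by (simp add: WW)
  qed
  have e: "e = of_real (Re e)" using sym[of 0 0] B0[of 0]
    by (simp add: complex_eq_iff)
  define C where "C = Matrix.mat m m (\<lambda>(i, j). B $$ (Suc i, Suc j))"
  have C: "C \<in> carrier_mat m m" by (simp add: C_def)
  have "mat_adjoint C = C"
    by (rule eq_matI) (auto simp: C_def intro!: sym[symmetric])
  from Suc.IH[OF C this] obtain V d where V: "unitary_mat m V" and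
    Cd: "C = V * real_diag m d * mat_adjoint V" by (auto simp: spectral_dec_def)
  have Vc: "V \<in> carrier_mat m m" using V by (simp add: unitary_mat_def)
  let ?blk = "\<lambda>x X. four_block_mat (Matrix.mat 1 1 (\<lambda>_. x)) (0\<^sub>m 1 m) (0\<^sub>m m 1) X :: complex mat"
  have blk_mult: "?blk x X * ?blk y Y = ?blk (x * y) (X * Y)"
    if "X \<in> carrier_mat m m" "Y \<in> carrier_mat m m" for x y X Y
  proof -
    have "Matrix.mat 1 1 (\<lambda>_. x) * Matrix.mat 1 1 (\<lambda>_. y) = Matrix.mat 1 1 (\<lambda>_. x * y)"
      by (rule eq_matI) (auto simp: scalar_prod_def)
    then show ?thesis using that
      by (subst mult_four_block_mat[of _ 1 1 _ m _ m _ _ 1 _ m]) auto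
  qed
  have blk_adj: "mat_adjoint (?blk x X) = ?blk (cnj x) (mat_adjoint X)" if "X \<in> carrier_mat m m" for x X
    using that by (intro eq_matI) (auto simp: index_mat_four_block)
  have B_blk: "B = ?blk e C"
  proof (rule eq_matI)
    fix i j assume "i < dim_row (?blk e C)" "j < dim_col (?blk e C)"
    then have ij: "i < ?n" "j < ?n" using C by auto
    have B0': "B $$ (0, j) = (if j = 0 then e else 0)" using sym[of 0 j] B0[OF ij(2)] ij e
      by (metis complex_cnj_complex_of_real complex_cnj_zero zero_less_Suc)
    show "B $$ (i, j) = ?blk e C $$ (i, j)"
      using ij C B0[OF ij(1)] B0' by (cases i; cases j) (auto simp: C_def)
  qed (use B C in auto)
  define D where "D = (\<lambda>i. case i of 0 \<Rightarrow> Re e | Suc k \<Rightarrow> d k)"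
  have D_blk: "real_diag ?n D = ?blk e (real_diag m d)"
  proof (rule eq_matI)
    fix i j assume "i < dim_row (?blk e (real_diag m d))" "j < dim_col (?blk e (real_diag m d))"
    then have ij: "i < ?n" "j < ?n" by (auto simp: mat_diag_def)
    show "real_diag ?n D $$ (i, j) = ?blk e (real_diag m d) $$ (i, j)"
      using ij e by (cases i; cases j) (auto simp: mat_diag_def D_def)
  qed (auto simp: mat_diag_def)
  have one_blk: "?blk 1 (1\<^sub>m m) = 1\<^sub>m ?n"
    by (rule eq_matI) auto
  have U: "unitary_mat ?n (?blk 1 V)"
  proof (rule unitary_matI)
    show "mat_adjoint (?blk 1 V) * ?blk 1 V = 1\<^sub>m ?n"
      unfolding blk_adj[OF Vc] blk_mult[OF adj_carrier[OF Vc] Vc]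
      using V one_blk by (simp add: unitary_mat_def)
  qed (use Vc in auto)
  have Uc: "?blk 1 V \<in> carrier_mat ?n ?n" using Vc by auto
  have B_eq: "B = ?blk 1 V * real_diag ?n D * mat_adjoint (?blk 1 V)"
    unfolding B_blk Cd D_blk blk_adj[OF Vc] blk_mult[OF Vc mat_diag_dim]
      blk_mult[OF mult_carrier_mat[OF Vc mat_diag_dim] adj_carrier[OF Vc]] by simp
  have "W * B * mat_adjoint W = (W * mat_adjoint W) * A * (W * mat_adjoint W)"
    using Wc A unfolding B_def by (simp add: assoc_mult_mat[of _ ?n ?n _ ?n _ ?n]
      mult_carrier_mat[of _ ?n ?n])
  then have "A = W * B * mat_adjoint W" using A by (simp add: WW)
  also have "\<dots> = (W * ?blk 1 V) * real_diag ?n D * mat_adjoint (W * ?blk 1 V)"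
    unfolding B_eq using Wc Uc by (simp add: adj_mult[of _ ?n ?n _ ?n] assoc_mult_mat[of _ ?n ?n _ ?n _ ?n]
      mult_carrier_mat[of _ ?n ?n])
  finally have "spectral_dec ?n (W * ?blk 1 V) D A"
    using unitary_mat_mult[OF W U] by (simp add: spectral_dec_def)
  then show ?case by blast
qed

section \<open>Functional calculus\<close>

declare index_mult_mat(1) [simp del]

abbreviation rtr :: "complex mat \<Rightarrow> real" where "rtr A \<equiv> Re (mat_trace A)"

text \<open>One type holds the matrices of all sizes, so the size is a locale parameter. It is
  instantiated at 2 for the test matrices and left arbitrary in the final theorem.\<close>

locale cmat = fixes n :: nat
begin

abbreviation M :: "complex mat set" where "M \<equiv> carrier_mat n n"
abbreviation adj :: "complex mat \<Rightarrow> complex mat" where "adj \<equiv> mat_adjoint"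
abbreviation dg :: "(nat \<Rightarrow> real) \<Rightarrow> complex mat" where "dg \<equiv> real_diag n"
abbreviation spec :: "complex mat \<Rightarrow> (nat \<Rightarrow> real) \<Rightarrow> complex mat \<Rightarrow> bool" where
  "spec \<equiv> spectral_dec n"
abbreviation psd :: "complex mat set" where "psd \<equiv> psd_mats n"

lemma closed [simp]:
  "A \<in> M \<Longrightarrow> B \<in> M \<Longrightarrow> A * B \<in> M" "A \<in> M \<Longrightarrow> B \<in> M \<Longrightarrow> A + B \<in> M"
  "A \<in> M \<Longrightarrow> B \<in> M \<Longrightarrow> A - B \<in> M" "A \<in> M \<Longrightarrow> adj A \<in> M" "A \<in> M \<Longrightarrow> c \<cdot>\<^sub>m A \<in> M"
  "1\<^sub>m n \<in> M" "0\<^sub>m n n \<in> M"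
  by auto

lemma massoc: "A \<in> M \<Longrightarrow> B \<in> M \<Longrightarrow> C \<in> M \<Longrightarrow> A * B * C = A * (B * C)"
  by (rule assoc_mult_mat)

lemma mdistrib:
  "A \<in> M \<Longrightarrow> B \<in> M \<Longrightarrow> C \<in> M \<Longrightarrow> (A + B) * C = A * C + B * C"
  "A \<in> M \<Longrightarrow> B \<in> M \<Longrightarrow> C \<in> M \<Longrightarrow> C * (A + B) = C * A + C * B"
  "A \<in> M \<Longrightarrow> B \<in> M \<Longrightarrow> C \<in> M \<Longrightarrow> (A - B) * C = A * C - B * C"
  "A \<in> M \<Longrightarrow> B \<in> M \<Longrightarrow> C \<in> M \<Longrightarrow> C * (A - B) = C * A - C * B"
  by (auto simp: add_mult_distrib_mat[of _ n n] mult_add_distrib_mat[of _ n n]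
      minus_mult_distrib_mat[of _ n n] mult_minus_distrib_mat[of _ n n])

lemma msmult:
  "A \<in> M \<Longrightarrow> B \<in> M \<Longrightarrow> (c \<cdot>\<^sub>m A) * B = c \<cdot>\<^sub>m (A * B)"
  "A \<in> M \<Longrightarrow> B \<in> M \<Longrightarrow> A * (c \<cdot>\<^sub>m B) = c \<cdot>\<^sub>m (A * B)"
  by (auto simp: mult_smult_assoc_mat[of _ n n] mult_smult_distrib[of _ n n])

lemma msmult_smult: "a \<cdot>\<^sub>m (b \<cdot>\<^sub>m A) = (a * b) \<cdot>\<^sub>m (A :: complex mat)"
  by (rule eq_matI) auto

lemma mone [simp]: "A \<in> M \<Longrightarrow> 1\<^sub>m n * A = A" "A \<in> M \<Longrightarrow> A * 1\<^sub>m n = A"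
  by auto

lemma mzero [simp]: "A \<in> M \<Longrightarrow> A * 0\<^sub>m n n = 0\<^sub>m n n" "A \<in> M \<Longrightarrow> 0\<^sub>m n n * A = 0\<^sub>m n n"
  by (auto simp: right_mult_zero_mat left_mult_zero_mat)

lemma tr_zero [simp]: "mat_trace (0\<^sub>m n n) = 0"
  by (simp add: mat_trace_def)

lemma madj:
  "A \<in> M \<Longrightarrow> B \<in> M \<Longrightarrow> adj (A * B) = adj B * adj A"
  "A \<in> M \<Longrightarrow> B \<in> M \<Longrightarrow> adj (A + B) = adj A + adj B"
  "A \<in> M \<Longrightarrow> B \<in> M \<Longrightarrow> adj (A - B) = adj A - adj B"
  "A \<in> M \<Longrightarrow> adj (c \<cdot>\<^sub>m A) = cnj c \<cdot>\<^sub>m adj A"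
  by (rule adj_mult; assumption) (rule eq_matI; auto)+

lemma dim_dg [simp]: "dim_row (mat_diag n f) = n" "dim_col (mat_diag n f) = n"
  by (auto simp: mat_diag_def)

lemma adj_dg [simp]: "adj (dg d) = dg d"
  by (rule eq_matI) (auto simp: mat_diag_def)

lemma mult_index: "A \<in> M \<Longrightarrow> B \<in> M \<Longrightarrow> i < n \<Longrightarrow> j < n \<Longrightarrow>
    (A * B) $$ (i, j) = (\<Sum>k<n. A $$ (i, k) * B $$ (k, j))"
  by (auto simp: scalar_prod_def atLeast0LessThan index_mult_mat(1))

lemma dg_mult_index:
  "A \<in> M \<Longrightarrow> i < n \<Longrightarrow> j < n \<Longrightarrow> (dg d * A) $$ (i, j) = d i * A $$ (i, j)"
  "A \<in> M \<Longrightarrow> i < n \<Longrightarrow> j < n \<Longrightarrow> (A * dg d) $$ (i, j) = A $$ (i, j) * d j"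
  by (simp_all add: mat_diag_mult_left[of _ n n] mat_diag_mult_right[of _ n n])

lemma dg_mult [simp]: "dg a * dg b = dg (\<lambda>i. a i * b i)"
  by simp

lemma dg_cong: "(\<And>i. i < n \<Longrightarrow> a i = b i) \<Longrightarrow> dg a = dg b"
  by (rule eq_matI) (auto simp: mat_diag_def)

lemma tr_add: "A \<in> M \<Longrightarrow> B \<in> M \<Longrightarrow> mat_trace (A + B) = mat_trace A + mat_trace B"
  and tr_minus: "A \<in> M \<Longrightarrow> B \<in> M \<Longrightarrow> mat_trace (A - B) = mat_trace A - mat_trace B"
  and tr_smult: "A \<in> M \<Longrightarrow> mat_trace (c \<cdot>\<^sub>m A) = c * mat_trace A"
  by (auto simp: mat_trace_def sum.distrib sum_subtractf sum_distrib_left)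

lemma tr_mult: "A \<in> M \<Longrightarrow> B \<in> M \<Longrightarrow>
    mat_trace (A * B) = (\<Sum>i<n. \<Sum>j<n. A $$ (i, j) * B $$ (j, i))"
  unfolding mat_trace_def
  by (intro sum.cong) (auto simp: mult_index)

lemma tr_comm: "A \<in> M \<Longrightarrow> B \<in> M \<Longrightarrow> mat_trace (A * B) = mat_trace (B * A)"
  unfolding tr_mult by (subst sum.swap) (simp add: mult.commute)

lemma tr_adj_mult: "A \<in> M \<Longrightarrow> B \<in> M \<Longrightarrow>
    mat_trace (adj A * B) = (\<Sum>i<n. \<Sum>j<n. cnj (A $$ (i, j)) * B $$ (i, j))"
  by (subst tr_mult, simp, simp, subst sum.swap) (auto intro!: sum.cong)

lemma unitaryD:
  assumes "unitary_mat n U"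
  shows "U \<in> M" "adj U * U = 1\<^sub>m n" "U * adj U = 1\<^sub>m n"
    "\<And>X. X \<in> M \<Longrightarrow> adj U * (U * X) = X" "\<And>X. X \<in> M \<Longrightarrow> U * (adj U * X) = X"
  using assms by (auto simp: unitary_mat_def simp flip: massoc)

lemma specD:
  assumes "spec U d A"
  shows "unitary_mat n U" "U \<in> M" "A \<in> M" "adj A = A" "A = U * dg d * adj U"
  using assms by (auto simp: spectral_dec_def unitary_mat_def madj massoc)

lemma spec_one: "unitary_mat n V \<Longrightarrow> spec V (\<lambda>_. 1) (1\<^sub>m n)"
  using unitaryD[of V] by (auto simp: spectral_dec_def)

lemma spec_change: "unitary_mat n U \<Longrightarrow> spec U d (U * dg d * adj U)"
  by (auto simp: spectral_dec_def)

text \<open>In the two eigenbases \<open>A * X = X * B\<close> says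
  \<open>(a i - b j) * W $$ (i, j) = 0\<close>, so \<open>W\<close> lives where the eigenvalues
  agree, and there \<open>f\<close> may be applied to both. With \<open>X\<close> the identity this
  is the uniqueness of the functional calculus.\<close>

lemma intertwine_spec:
  assumes "spec U a A" "spec V b B" and X: "X \<in> M" and AX: "A * X = X * B"
  shows "(U * dg (\<lambda>i. f (a i)) * adj U) * X = X * (V * dg (\<lambda>i. f (b i)) * adj V)"
proof -
  note U = specD[OF assms(1)] unitaryD[OF specD(1)[OF assms(1)]]
  note V = specD[OF assms(2)] unitaryD[OF specD(1)[OF assms(2)]]
  note c = U(2) V(2) X U(3) V(3)
  define W where "W = adj U * X * V"
  have W: "W \<in> M" using c by (simp add: W_def)
  have "dg a * W = adj U * (A * X) * V"
    unfolding W_def using c U(8-) by (subst U(5)) (simp add: massoc)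
  also have "\<dots> = adj U * X * (B * V)" using c AX by (simp add: massoc)
  also have "\<dots> = W * dg b"
    unfolding W_def using c V(7-) by (subst V(5)) (simp add: massoc)
  finally have e: "dg a * W = W * dg b" .
  have "dg (\<lambda>i. f (a i)) * W = W * dg (\<lambda>i. f (b i))"
  proof (rule eq_matI)
    fix i j assume "i < dim_row (W * dg (\<lambda>i. f (b i)))" "j < dim_col (W * dg (\<lambda>i. f (b i)))"
    then have ij: "i < n" "j < n" using W by (auto simp: mat_diag_def)
    have "(dg a * W) $$ (i, j) = (W * dg b) $$ (i, j)" using e by simp
    then have "W $$ (i, j) = 0 \<or> a i = b j" using ij W by (auto simp: dg_mult_index)
    then show "(dg (\<lambda>i. f (a i)) * W) $$ (i, j) = (W * dg (\<lambda>i. f (b i))) $$ (i, j)"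
      using ij W by (auto simp: dg_mult_index)
  qed (use W in \<open>auto simp: mat_diag_def\<close>)
  then have "U * (dg (\<lambda>i. f (a i)) * W) * adj V = U * (W * dg (\<lambda>i. f (b i))) * adj V" by simp
  then show ?thesis unfolding W_def using c U(7-) V(7-) by (simp add: massoc)
qed

lemma mat_fun_spec:
  assumes "spec U d A"
  shows "mat_fun f A = U * dg (\<lambda>i. f (d i)) * adj U"
proof -
  note U = specD[OF assms]
  have dA: "dim_row A = n" using U(3) by auto
  show ?thesis unfolding mat_fun_def Let_def dA
  proof (rule the_equality)
    show "\<exists>Ua da. Ua \<in> M \<and> Ua * adj Ua = 1\<^sub>m n \<and> adj Ua * Ua = 1\<^sub>m n \<and>
       A = Ua * dg da * adj Ua \<and> U * dg (\<lambda>i. f (d i)) * adj U = Ua * dg (\<lambda>i. f (da i)) * adj Ua"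
      using assms by (auto simp: spectral_dec_def unitary_mat_def)
    fix N assume "\<exists>Ua da. Ua \<in> M \<and> Ua * adj Ua = 1\<^sub>m n \<and> adj Ua * Ua = 1\<^sub>m n \<and>
       A = Ua * dg da * adj Ua \<and> N = Ua * dg (\<lambda>i. f (da i)) * adj Ua"
    then obtain V b where V: "spec V b A" and N: "N = V * dg (\<lambda>i. f (b i)) * adj V"
      by (auto simp: spectral_dec_def unitary_mat_def)
    show "N = U * dg (\<lambda>i. f (d i)) * adj U"
      using intertwine_spec[OF V assms, of "1\<^sub>m n" f] U V N specD(2)[OF V] by simp
  qed
qed

lemma spec_mat_fun: "spec U d A \<Longrightarrow> spec U (\<lambda>i. f (d i)) (mat_fun f A)"
  using mat_fun_spec[of U d A f] spec_change specD(1) by auto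

text \<open>This reduces the trace inequalities below to scalar inequalities between the summands.\<close>

lemma tr_two_spec:
  assumes "spec U a A" "spec V b B" "K \<in> M" "L \<in> M"
  shows "mat_trace (adj K * A * L * B) = (\<Sum>i<n. \<Sum>j<n. complex_of_real (a i * b j) *
    (cnj ((adj U * K * V) $$ (i, j)) * (adj U * L * V) $$ (i, j)))"
proof -
  note U = specD[OF assms(1)] unitaryD[OF specD(1)[OF assms(1)]]
  note V = specD[OF assms(2)] unitaryD[OF specD(1)[OF assms(2)]]
  note c = U(2) V(2) assms(3,4)
  define P where "P = adj U * K * V"
  define Q where "Q = adj U * L * V"
  have PQ: "P \<in> M" "Q \<in> M" using c by (auto simp: P_def Q_def)
  have "adj K * A * L * B = (adj K * (U * dg a * adj U) * L * V * dg b) * adj V"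
    using c by (subst U(5), subst V(5)) (simp add: massoc)
  then have "mat_trace (adj K * A * L * B) = mat_trace (adj V * (adj K * (U * dg a * adj U) * L * V * dg b))"
    using c by (simp add: tr_comm)
  also have "adj V * (adj K * (U * dg a * adj U) * L * V * dg b) = adj P * (dg a * Q * dg b)"
    using c by (simp add: P_def Q_def madj massoc)
  also have "mat_trace \<dots> = (\<Sum>i<n. \<Sum>j<n. cnj (P $$ (i, j)) * (dg a * Q * dg b) $$ (i, j))"
    using PQ by (intro tr_adj_mult) auto
  also have "\<dots> = (\<Sum>i<n. \<Sum>j<n. complex_of_real (a i * b j) * (cnj (P $$ (i, j)) * Q $$ (i, j)))"
    using PQ by (intro sum.cong refl) (simp add: dg_mult_index)
  finally show ?thesis unfolding P_def Q_def .
qed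

lemma rtr_two_spec:
  assumes "spec U a A" "spec V b B" "K \<in> M"
  shows "rtr (adj K * A * K * B) =
    (\<Sum>i<n. \<Sum>j<n. a i * b j * (cmod ((adj U * K * V) $$ (i, j)))\<^sup>2)"
  unfolding tr_two_spec[OF assms assms(3)] Re_sum
  by (intro sum.cong refl) (simp add: cmod_def power2_eq_square algebra_simps)

lemma rtr_left_spec:
  assumes "spec U a A" "unitary_mat n V" "K \<in> M"
  shows "rtr (adj K * A * K) =
    (\<Sum>i<n. \<Sum>j<n. a i * (cmod ((adj U * K * V) $$ (i, j)))\<^sup>2)"
  using rtr_two_spec[OF assms(1) spec_one[OF assms(2)] assms(3)] specD[OF assms(1)] assms by simp

lemma rtr_right_spec:
  assumes "spec V b B" "unitary_mat n U" "K \<in> M"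
  shows "rtr (K * B * adj K) =
    (\<Sum>i<n. \<Sum>j<n. b j * (cmod ((adj U * K * V) $$ (i, j)))\<^sup>2)"
proof -
  have B: "B \<in> M" using specD(3)[OF assms(1)] .
  have "mat_trace (K * B * adj K) = mat_trace (adj K * (K * B))"
    using B assms(3) by (intro tr_comm) auto
  then show ?thesis
    using rtr_two_spec[OF spec_one[OF assms(2)] assms(1) assms(3)] B assms(3) by (simp add: massoc)
qed

lemma unitary_one: "unitary_mat n (1\<^sub>m n)"
  by (auto simp: unitary_mat_def)

lemma unitary_adj: "unitary_mat n U \<Longrightarrow> unitary_mat n (adj U)"
  by (auto simp: unitary_mat_def)

lemma unitary_rows:
  assumes "unitary_mat n W" "i < n"
  shows "(\<Sum>j<n. (cmod (W $$ (i, j)))\<^sup>2) = 1"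
proof -
  have "(W * adj W) $$ (i, i) = 1" using unitaryD[OF assms(1)] assms(2) by simp
  then have "(\<Sum>j<n. W $$ (i, j) * cnj (W $$ (i, j))) = 1"
    using unitaryD(1)[OF assms(1)] assms(2) by (auto simp: mult_index)
  then have "complex_of_real (\<Sum>j<n. (cmod (W $$ (i, j)))\<^sup>2) = 1"
    by (simp only: of_real_sum complex_norm_square)
  then show ?thesis by (simp only: of_real_eq_1_iff)
qed

lemma unitary_cols:
  assumes "unitary_mat n W" "j < n"
  shows "(\<Sum>i<n. (cmod (W $$ (i, j)))\<^sup>2) = 1"
  using unitary_rows[OF unitary_adj[OF assms(1)] assms(2)] unitaryD(1)[OF assms(1)] assms(2) by auto

lemma rtr_spec:
  assumes "spec U a A"
  shows "rtr A = (\<Sum>i<n. a i)"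
proof -
  have "rtr A = (\<Sum>i<n. \<Sum>j<n. a i * (cmod ((adj U * 1\<^sub>m n * U) $$ (i, j)))\<^sup>2)"
    using rtr_left_spec[OF assms specD(1)[OF assms], of "1\<^sub>m n"] specD[OF assms] by simp
  also have "\<dots> = (\<Sum>i<n. \<Sum>j<n. if i = j then a i else 0)"
    using specD(2)[OF assms] unitaryD(2)[OF specD(1)[OF assms]] by (intro sum.cong refl) (auto)
  finally show ?thesis by simp
qed

section \<open>Powers of positive semidefinite matrices\<close>

lemma sprod_adj:
  assumes A: "A \<in> M" and xy: "x \<in> carrier_vec n" "y \<in> carrier_vec n"
  shows "(A *\<^sub>v x) \<bullet>c y = x \<bullet>c (adj A *\<^sub>v y)"
proof -
  have "(A *\<^sub>v x) \<bullet>c y = (\<Sum>i<n. \<Sum>k<n. A $$ (i, k) * x $ k * cnj (y $ i))"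
    using assms by (auto simp: scalar_prod_def atLeast0LessThan sum_distrib_right intro!: sum.cong)
  also have "\<dots> = (\<Sum>k<n. \<Sum>i<n. A $$ (i, k) * x $ k * cnj (y $ i))" by (rule sum.swap)
  also have "\<dots> = x \<bullet>c (adj A *\<^sub>v y)"
    using assms by (auto simp: scalar_prod_def atLeast0LessThan sum_distrib_left mult.assoc mult.left_commute intro!: sum.cong)
  finally show ?thesis .
qed

lemma sprod_self:
  assumes "x \<in> carrier_vec n"
  shows "x \<bullet>c x = complex_of_real (\<Sum>k<n. (cmod (x $ k))\<^sup>2)"
  unfolding of_real_sum complex_norm_square using assms
  by (auto simp: scalar_prod_def atLeast0LessThan)

lemma psdD: "A \<in> psd \<Longrightarrow> A \<in> M" "A \<in> psd \<Longrightarrow> adj A = A"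
  by (auto simp: psd_mats_def)

lemma gram_psd: 
  assumes R: "R \<in> M"
  shows "adj R * R \<in> psd"
proof -
  have "Re (((adj R * R) *\<^sub>v x) \<bullet>c x) \<ge> 0" if x: "x \<in> carrier_vec n" for x
  proof -
    have "((adj R * R) *\<^sub>v x) \<bullet>c x = (R *\<^sub>v x) \<bullet>c (R *\<^sub>v x)"
      using R x sprod_adj[of "adj R" "R *\<^sub>v x" x] assoc_mult_mat_vec[of "adj R" n n R n x] by auto
    also have "Re \<dots> \<ge> 0" using R x sprod_self[of "R *\<^sub>v x"] by (simp add: sum_nonneg)
    finally show ?thesis .
  qed
  then show ?thesis using R by (auto simp: psd_mats_def madj)
qed

lemma psd_spectral:
  assumes "A \<in> psd"
  obtains U d where "spec U d A" "\<forall>i. 0 \<le> d i"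
proof -
  note A = psdD[OF assms]
  obtain U d where S: "spec U d A" using hermitian_spectral[OF A] by auto
  note U = specD[OF S] unitaryD[OF specD(1)[OF S]]
  have d: "d i \<ge> 0" if i: "i < n" for i
  proof -
    let ?u = "col U i"
    have u: "?u \<in> carrier_vec n" using U(2) by auto
    have "A * U = U * dg d" using U(2,7) by (subst U(5)) (simp add: massoc)
    then have "A *\<^sub>v ?u = col (U * dg d) i" using U(2,3) i by (simp flip: col_mult2[of _ n n _ n])
    also have "\<dots> = complex_of_real (d i) \<cdot>\<^sub>v ?u"
      using U(2) i by (intro eq_vecI) (auto simp: dg_mult_index mult.commute)
    finally have "(A *\<^sub>v ?u) \<bullet>c ?u = of_real (d i) * (?u \<bullet>c ?u)" using u by simp
    also have "?u \<bullet>c ?u = complex_of_real (\<Sum>k<n. (cmod (U $$ (k, i)))\<^sup>2)"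
      using sprod_self[OF u] i U(2) by auto
    also have "\<dots> = 1" using unitary_cols[OF U(1) i] by simp
    finally have "Re ((A *\<^sub>v ?u) \<bullet>c ?u) = d i" by simp
    then show ?thesis using assms u by (auto simp: psd_mats_def)
  qed
  \<comment> \<open>Resetting the eigenvalue function to 0 beyond \<open>n\<close> makes
    nonnegativity hold at every index.\<close>
  have "dg d = dg (\<lambda>i. if i < n then d i else 0)" by (rule dg_cong) auto
  then have "spec U (\<lambda>i. if i < n then d i else 0) A" using S by (simp add: spectral_dec_def)
  then show ?thesis by (rule that) (use d in auto)
qed

lemma spec_gram:
  assumes "spec U d A" "\<And>i. i < n \<Longrightarrow> 0 \<le> d i"
  obtains R where "R \<in> M" "A = adj R * R"
proof
  note U = specD[OF assms(1)] unitaryD[OF specD(1)[OF assms(1)]]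
  show "dg (\<lambda>i. sqrt (d i)) * adj U \<in> M" using U by simp
  have "dg d = dg (\<lambda>i. sqrt (d i)) * dg (\<lambda>i. sqrt (d i))"
    unfolding dg_mult using assms(2) by (intro dg_cong) simp
  then have "A = U * (dg (\<lambda>i. sqrt (d i)) * dg (\<lambda>i. sqrt (d i))) * adj U" using U(5) by simp
  then show "A = adj (dg (\<lambda>i. sqrt (d i)) * adj U) * (dg (\<lambda>i. sqrt (d i)) * adj U)"
    using U(2) by (simp add: madj massoc del: dg_mult mat_diag_diag)
qed

lemma spec_psd: "spec U d A \<Longrightarrow> (\<And>i. i < n \<Longrightarrow> 0 \<le> d i) \<Longrightarrow> A \<in> psd"
  by (erule spec_gram) (auto simp: gram_psd)

lemma psd_gram:
  assumes "A \<in> psd"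
  obtains R where "R \<in> M" "A = adj R * R"
proof -
  obtain U d where "spec U d A" "\<forall>i. 0 \<le> d i" by (rule psd_spectral[OF assms])
  then obtain R where "R \<in> M" "A = adj R * R" by (elim spec_gram) auto
  then show ?thesis by (rule that)
qed

lemma psd_congr: "A \<in> psd \<Longrightarrow> X \<in> M \<Longrightarrow> adj X * A * X \<in> psd"
proof -
  assume A: "A \<in> psd" and X: "X \<in> M"
  obtain R where R: "R \<in> M" "A = adj R * R" by (rule psd_gram[OF A])
  have "adj X * A * X = adj (R * X) * (R * X)" using R X by (simp add: madj massoc)
  then show ?thesis using gram_psd[of "R * X"] R X by simp
qed

lemma rtr_gram: "R \<in> M \<Longrightarrow> rtr (adj R * R) = (\<Sum>i<n. \<Sum>j<n. (cmod (R $$ (i, j)))\<^sup>2)"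
  by (simp add: tr_adj_mult cmod_def power2_eq_square)

lemma psd_rtr_nonneg: "A \<in> psd \<Longrightarrow> rtr A \<ge> 0"
  by (erule psd_gram) (simp add: rtr_gram sum_nonneg)

lemma rtr_congr_nonneg: "A \<in> psd \<Longrightarrow> X \<in> M \<Longrightarrow> rtr (adj X * A * X) \<ge> 0"
  by (simp add: psd_congr psd_rtr_nonneg)

text \<open>With \<open>A = R* R\<close> the trace is the sum of the squared moduli of the entries
  of \<open>R * X\<close>. This turns a vanishing quadratic form into a kernel statement.\<close>

lemma rtr_congr_zero:
  assumes "A \<in> psd" "X \<in> M" "rtr (adj X * A * X) = 0"
  shows "A * X = 0\<^sub>m n n"
proof -
  obtain R where R: "R \<in> M" "A = adj R * R" by (rule psd_gram[OF assms(1)])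
  have "adj X * A * X = adj (R * X) * (R * X)" using R assms by (simp add: madj massoc)
  then have "(\<Sum>i<n. \<Sum>j<n. (cmod ((R * X) $$ (i, j)))\<^sup>2) = 0"
    using rtr_gram[of "R * X"] R assms by simp
  then have "\<forall>i<n. \<forall>j<n. (R * X) $$ (i, j) = 0"
    by (simp add: sum_nonneg_eq_0_iff sum_nonneg)
  then have "R * X = 0\<^sub>m n n" using R(1) assms(2) by (intro eq_matI) auto
  then show ?thesis using R assms by (simp add: massoc)
qed

lemma psd_add: "A \<in> psd \<Longrightarrow> B \<in> psd \<Longrightarrow> A + B \<in> psd"
  unfolding psd_mats_def
  by (auto simp: madj add_mult_distrib_mat_vec[of _ n n] add_scalar_prod_distrib[of _ n])

lemma psd_smult: "A \<in> psd \<Longrightarrow> c \<ge> 0 \<Longrightarrow> complex_of_real c \<cdot>\<^sub>m A \<in> psd"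
proof -
  assume A: "A \<in> psd" and c: "c \<ge> 0"
  obtain R where R: "R \<in> M" "A = adj R * R" by (rule psd_gram[OF A])
  have "complex_of_real c \<cdot>\<^sub>m A = adj (complex_of_real (sqrt c) \<cdot>\<^sub>m R) * (complex_of_real (sqrt c) \<cdot>\<^sub>m R)"
    using R c by (simp add: madj msmult msmult_smult flip: of_real_mult)
  then show ?thesis using gram_psd[of "complex_of_real (sqrt c) \<cdot>\<^sub>m R"] R by simp
qed

lemma convex_comb_psd: "A \<in> psd \<Longrightarrow> B \<in> psd \<Longrightarrow> t \<in> {0..1} \<Longrightarrow> convex_comb t A B \<in> psd"
  unfolding convex_comb_def by (intro psd_add psd_smult) auto

lemma convex_comb_closed [simp]: "A \<in> M \<Longrightarrow> B \<in> M \<Longrightarrow> convex_comb t A B \<in> M"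
  unfolding convex_comb_def by auto

lemma rtr_convex_comb:
  assumes "A \<in> M" "B \<in> M" "X \<in> M" "Y \<in> M"
  shows "rtr (X * convex_comb t A B * Y) = t * rtr (X * A * Y) + (1 - t) * rtr (X * B * Y)"
  using assms unfolding convex_comb_def by (simp add: mdistrib msmult tr_add tr_smult)

text \<open>The generalized inverse in the definition of negative powers is absorbed by
  \<open>inverse 0 = 0\<close> and \<open>0 powr r = 0\<close>.\<close>

lemma mat_powr_spec:
  assumes "spec U d A" "\<forall>i. 0 \<le> d i"
  shows "mat_powr A r = U * dg (\<lambda>i. d i powr r) * adj U"
proof (cases "r < 0")
  case True
  have "spec U (\<lambda>i. inverse (d i)) (gen_inverse A)"
    unfolding gen_inverse_def using spec_mat_fun[OF assms(1)] .
  then have "mat_powr A r = U * dg (\<lambda>i. inverse (d i) powr (- r)) * adj U"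
    using True mat_fun_spec[of U "\<lambda>i. inverse (d i)" _ "\<lambda>t. t powr - r"] by (simp add: mat_powr_def)
  also have "dg (\<lambda>i. inverse (d i) powr (- r)) = dg (\<lambda>i. d i powr r)"
    using assms(2) by (intro dg_cong) (simp add: powr_minus inverse_powr)
  finally show ?thesis .
next
  case False
  then show ?thesis using mat_fun_spec[OF assms(1)] by (simp add: mat_powr_def)
qed

lemma spec_mat_powr:
  assumes "spec U d A" "\<forall>i. 0 \<le> d i"
  shows "spec U (\<lambda>i. d i powr r) (mat_powr A r)"
  using mat_powr_spec[OF assms] spec_change[OF specD(1)[OF assms(1)]] by simp

lemma mat_powr_psd: "A \<in> psd \<Longrightarrow> mat_powr A r \<in> psd"
  by (erule psd_spectral) (auto intro: spec_mat_powr spec_psd[OF spec_mat_powr])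

lemma mat_powr_closed [simp]: "A \<in> psd \<Longrightarrow> mat_powr A r \<in> M"
  and mat_powr_adj [simp]: "A \<in> psd \<Longrightarrow> adj (mat_powr A r) = mat_powr A r"
  using mat_powr_psd psdD by blast+

lemma mat_powr_mult: "A \<in> psd \<Longrightarrow> mat_powr A r * mat_powr A s = mat_powr A (r + s)"
proof -
  assume "A \<in> psd"
  then obtain U d where S: "spec U d A" "\<forall>i. 0 \<le> d i" by (elim psd_spectral)
  note U = specD[OF S(1)] unitaryD[OF specD(1)[OF S(1)]]
  have "dg (\<lambda>i. d i powr r) * dg (\<lambda>i. d i powr s) = dg (\<lambda>i. d i powr (r + s))"
    by (simp add: powr_add)
  then show ?thesis using U(2,7,9) S
    by (simp add: mat_powr_spec massoc del: dg_mult mat_diag_diag)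
      (metis U(2) closed(1) closed(4) massoc mat_diag_dim)
qed

lemma mat_powr_mult_left: "A \<in> psd \<Longrightarrow> X \<in> M \<Longrightarrow>
    mat_powr A r * (mat_powr A s * X) = mat_powr A (r + s) * X"
  by (simp add: mat_powr_mult flip: massoc)

lemma mat_powr_powr: "A \<in> psd \<Longrightarrow> mat_powr (mat_powr A r) s = mat_powr A (r * s)"
proof -
  assume "A \<in> psd"
  then obtain U d where S: "spec U d A" "\<forall>i. 0 \<le> d i" by (elim psd_spectral)
  have "mat_powr (mat_powr A r) s = U * dg (\<lambda>i. (d i powr r) powr s) * adj U"
    by (rule mat_powr_spec[OF spec_mat_powr[OF S]]) auto
  then show ?thesis using S by (simp add: mat_powr_spec powr_powr)
qed

lemma mat_powr_one [simp]: "A \<in> psd \<Longrightarrow> mat_powr A 1 = A"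
proof -
  assume "A \<in> psd"
  then obtain U d where S: "spec U d A" "\<forall>i. 0 \<le> d i" by (elim psd_spectral)
  then show ?thesis using specD(5)[OF S(1)] by (simp add: mat_powr_spec)
qed

lemma mat_powr_half: "A \<in> psd \<Longrightarrow> mat_powr A (1/2) * mat_powr A (1/2) = A"
  by (simp add: mat_powr_mult)

lemma mat_powr_zero_mult: "A \<in> psd \<Longrightarrow> mat_powr A 0 * A = A" "A \<in> psd \<Longrightarrow> A * mat_powr A 0 = A"
  using mat_powr_mult[of A 0 1] mat_powr_mult[of A 1 0] by auto

lemma mat_powr_intertwine:
  assumes "A \<in> psd" "B \<in> psd" "X \<in> M" "A * X = X * B"
  shows "mat_powr A r * X = X * mat_powr B r"
proof -
  obtain U a where A: "spec U a A" "\<forall>i. 0 \<le> a i" by (rule psd_spectral[OF assms(1)])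
  obtain V b where B: "spec V b B" "\<forall>i. 0 \<le> b i" by (rule psd_spectral[OF assms(2)])
  show ?thesis using intertwine_spec[OF A(1) B(1) assms(3,4), of "\<lambda>t. t powr r"] A B
    by (simp add: mat_powr_spec)
qed

lemma smult_spec: "spec U d A \<Longrightarrow> spec U (\<lambda>i. c * d i) (complex_of_real c \<cdot>\<^sub>m A)"
proof -
  assume A: "spec U d A"
  have "dg (\<lambda>i. c * d i) = complex_of_real c \<cdot>\<^sub>m dg d"
    by (rule eq_matI) (auto simp: mat_diag_def)
  then show ?thesis using specD[OF A] by (auto simp: spectral_dec_def msmult)
qed

lemma mat_powr_smult:
  assumes "A \<in> psd" "c \<ge> 0"
  shows "mat_powr (complex_of_real c \<cdot>\<^sub>m A) r = complex_of_real (c powr r) \<cdot>\<^sub>m mat_powr A r"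
proof -
  obtain U a where A: "spec U a A" "\<forall>i. 0 \<le> a i" by (rule psd_spectral[OF assms(1)])
  have "spec U (\<lambda>i. c * a i) (complex_of_real c \<cdot>\<^sub>m A)" using smult_spec[OF A(1)] .
  then have "mat_powr (complex_of_real c \<cdot>\<^sub>m A) r = U * dg (\<lambda>i. c powr r * a i powr r) * adj U"
    using A assms(2) by (subst mat_powr_spec[where U = U and d = "\<lambda>i. c * a i"]) (auto simp: powr_mult)
  also have "spec U (\<lambda>i. c powr r * a i powr r) (complex_of_real (c powr r) \<cdot>\<^sub>m mat_powr A r)"
    using smult_spec[OF spec_mat_powr[OF A]] .
  then have "U * dg (\<lambda>i. c powr r * a i powr r) * adj U = complex_of_real (c powr r) \<cdot>\<^sub>m mat_powr A r"
    by (rule specD(5)[symmetric])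
  finally show ?thesis .
qed

lemma rtr_mat_powr: "spec U d A \<Longrightarrow> (\<forall>i. 0 \<le> d i) \<Longrightarrow> rtr (mat_powr A r) = (\<Sum>i<n. d i powr r)"
  using rtr_spec[OF spec_mat_powr] .

section \<open>Supports and the domain\<close>

lemma proj_range_absorb:
  assumes "P \<in> M" "P * P = P" "Q \<in> M" "mat_range Q \<subseteq> mat_range P"
  shows "P * Q = Q"
proof (rule eq_matI)
  fix i j assume "i < dim_row Q" "j < dim_col Q"
  then have ij: "i < n" "j < n" using assms(3) by auto
  have "col Q j = Q *\<^sub>v unit_vec n j" using assms(3) ij
    by (intro eq_vecI) (auto simp: scalar_prod_right_unit)
  then have "col Q j \<in> mat_range P" using assms(3,4) by (auto simp: mat_range_def)
  then obtain x where x: "x \<in> carrier_vec n" "col Q j = P *\<^sub>v x" using assms(1) by (auto simp: mat_range_def)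
  then have "P *\<^sub>v col Q j = col Q j"
    using assms(1,2) assoc_mult_mat_vec[of P n n P n x] by simp
  moreover have "col (P * Q) j = P *\<^sub>v col Q j" using assms(1,3) ij by (intro col_mult2[of _ n n _ n]) auto
  ultimately have "col (P * Q) j = col Q j" by simp
  then have "col (P * Q) j $ i = col Q j $ i" by simp
  then show "(P * Q) $$ (i, j) = Q $$ (i, j)" using assms(1,3) ij by (auto simp: index_mult_mat(1))
qed (use assms in auto)

lemma supp_proj_eq:
  assumes "A \<in> psd"
  shows "supp_proj A = mat_powr A 0"
proof -
  let ?P = "mat_powr A 0"
  note A = psdD[OF assms]
  have dA: "dim_row A = n" "dim_col A = n" using A by auto
  have P: "?P \<in> M" "adj ?P = ?P" "?P * ?P = ?P" using assms by (auto simp: mat_powr_mult)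
  have sub: "mat_range (X * Y) \<subseteq> mat_range X" if "X \<in> M" "Y \<in> M" for X Y
    using that assoc_mult_mat_vec[of X n n Y n] by (fastforce simp: mat_range_def)
  have "A = ?P * A" "?P = A * mat_powr A (- 1)"
    using assms mat_powr_mult[of A 1 "- 1"] by (auto simp: mat_powr_zero_mult)
  then have R: "mat_range ?P = mat_range A"
    using sub[OF P(1) A(1)] sub[OF A(1) mat_powr_closed[OF assms, of "- 1"]] by auto
  show ?thesis unfolding supp_proj_def dA
  proof (rule the_equality)
    show "?P \<in> M \<and> adj ?P = ?P \<and> ?P * ?P = ?P \<and> mat_range ?P = mat_range A" using P R by simp
    fix Q assume Q: "Q \<in> M \<and> adj Q = Q \<and> Q * Q = Q \<and> mat_range Q = mat_range A"
    \<comment> \<open>Projections with equal range absorb each other; the adjoint of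
      \<open>?P * Q = Q\<close> reads \<open>Q * ?P = Q\<close>, hence
      \<open>Q = ?P\<close>.\<close>
    have "?P * Q = Q" "Q * ?P = ?P" using P R Q by (auto intro!: proj_range_absorb)
    then show "Q = ?P" using P Q madj(1)[of ?P Q] by metis
  qed
qed

text \<open>In one direction, compressing \<open>?P - ?Q\<close> to the complement of
  \<open>?P\<close> leaves minus a positive matrix, which must vanish. In the other,
  \<open>?Q * ?P = ?Q\<close> makes the difference itself an orthogonal projection.\<close>

lemma loewner_supp_iff:
  assumes A: "A \<in> psd" and B: "B \<in> psd"
  shows "loewner_le n (supp_proj B) (supp_proj A) \<longleftrightarrow> B * mat_powr A 0 = B"
proof
  let ?P = "mat_powr A 0" and ?Q = "mat_powr B 0"
  have P: "?P \<in> M" "adj ?P = ?P" "?P * ?P = ?P" using A by (auto simp: mat_powr_mult)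
  have Q: "?Q \<in> M" "adj ?Q = ?Q" "?Q * ?Q = ?Q" using B by (auto simp: mat_powr_mult)
  {
    assume "loewner_le n (supp_proj B) (supp_proj A)"
    then have D: "?P - ?Q \<in> psd" using A B by (simp add: loewner_le_def supp_proj_eq)
    define X where "X = 1\<^sub>m n - ?P"
    have X: "X \<in> M" "adj X = X" "?P * X = 0\<^sub>m n n"
      using P by (auto simp: X_def madj mdistrib)
    have "adj X * (?P - ?Q) * X = (adj X * (?P * X)) - adj X * ?Q * X"
      using P Q X by (simp add: mdistrib massoc)
    also have "rtr \<dots> = - rtr (adj X * ?Q * X)"
      using P Q X by (subst tr_minus) (auto simp: tr_mult)
    finally have "rtr (adj X * ?Q * X) \<le> 0" using rtr_congr_nonneg[OF D X(1)] by simp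
    then have "rtr (adj X * ?Q * X) = 0" using rtr_congr_nonneg[OF mat_powr_psd[OF B] X(1), of 0] by simp
    then have QX: "?Q * X = 0\<^sub>m n n" using rtr_congr_zero[OF mat_powr_psd[OF B] X(1)] by simp
    have "B * X = B * (?Q * X)" using B X psdD[OF B] by (simp add: mat_powr_zero_mult flip: massoc)
    then have "B - B * ?P = 0\<^sub>m n n" using QX P psdD[OF B] by (simp add: X_def mdistrib)
    then show "B * ?P = B"
      using P psdD[OF B] by (intro eq_matI) (auto simp: mat_eq_iff)
  }
  {
    assume BP: "B * ?P = B"
    have "mat_powr B (-1) * (B * ?P) = ?Q" using BP mat_powr_mult[OF B, of "-1" 1] B by simp
    then have "?Q * ?P = ?Q" using mat_powr_mult[OF B, of "-1" 1] B P psdD[OF B] by (simp flip: massoc)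
    moreover from this have "?P * ?Q = ?Q" using P Q madj(1)[of ?Q ?P] by simp
    ultimately have "(?P - ?Q) * (?P - ?Q) = ?P - ?Q"
      using P Q by (simp add: mdistrib) (intro eq_matI; auto)
    then have "adj (?P - ?Q) * (?P - ?Q) = ?P - ?Q" using P Q by (simp add: madj)
    then have "?P - ?Q \<in> psd" using gram_psd[of "?P - ?Q"] P Q by simp
    then show "loewner_le n (supp_proj B) (supp_proj A)"
      using A B by (simp add: loewner_le_def supp_proj_eq)
  }
qed

section \<open>The domain as an algebraic condition\<close>

definition dom :: "complex mat \<Rightarrow> complex mat \<Rightarrow> bool" where
  "dom A B \<longleftrightarrow> A \<in> psd \<and> B \<in> psd \<and> B * mat_powr A 0 = B"

lemma G_domain_iff: "(A, B) \<in> G_domain n \<longleftrightarrow> dom A B"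
  unfolding G_domain_def dom_def using loewner_supp_iff by auto

text \<open>Kernel inclusion, tested on matrices instead of vectors, is the form of the support
  condition that passes to convex combinations. The decisive test matrix is the complement of the
  support projection of \<open>A\<close>.\<close>

lemma domI_kernel:
  assumes "A \<in> psd" "B \<in> psd" "\<And>X. X \<in> M \<Longrightarrow> A * X = 0\<^sub>m n n \<Longrightarrow> B * X = 0\<^sub>m n n"
  shows "dom A B"
proof -
  let ?X = "1\<^sub>m n - mat_powr A 0"
  have "?X \<in> M" using assms by simp
  moreover have "A * ?X = 0\<^sub>m n n" using assms psdD[OF assms(1)] by (simp add: mdistrib mat_powr_zero_mult)
  ultimately have "B * ?X = 0\<^sub>m n n" using assms(3) by blast
  then have "B - B * mat_powr A 0 = 0\<^sub>m n n" using assms psdD[OF assms(2)] by (simp add: mdistrib)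
  then have "B * mat_powr A 0 = B"
    using assms(1) psdD[OF assms(2)] by (intro eq_matI) (auto simp: mat_eq_iff)
  then show ?thesis using assms by (simp add: dom_def)
qed

lemma dom_kernel:
  assumes "dom A B" "X \<in> M" "A * X = 0\<^sub>m n n"
  shows "B * X = 0\<^sub>m n n"
proof -
  have c: "A \<in> psd" "B \<in> psd" "A \<in> M" "B \<in> M" using assms psdD by (auto simp: dom_def)
  have "B * X = B * mat_powr A 0 * X" using assms by (simp add: dom_def)
  also have "mat_powr A 0 = mat_powr A (- 1) * A" using mat_powr_mult[of A "-1" 1] c by simp
  also have "B * (mat_powr A (- 1) * A) * X = B * (mat_powr A (- 1) * (A * X))"
    using c assms by (simp add: massoc)
  finally show ?thesis using assms c by simp
qed

lemma convex_comb_zero [simp]: "A \<in> M \<Longrightarrow> B \<in> M \<Longrightarrow> convex_comb 0 A B = B"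
  and convex_comb_one [simp]: "A \<in> M \<Longrightarrow> B \<in> M \<Longrightarrow> convex_comb 1 A B = A"
  unfolding convex_comb_def by (auto intro!: eq_matI)

lemma convex_comb_same [simp]: "A \<in> M \<Longrightarrow> convex_comb t A A = A"
  unfolding convex_comb_def by (intro eq_matI) (auto simp: algebra_simps)

lemma dom_convex_comb:
  assumes "dom A1 B1" "dom A2 B2" "t \<in> {0..1}"
  shows "dom (convex_comb t A1 A2) (convex_comb t B1 B2)"
proof -
  have c: "A1 \<in> psd" "A2 \<in> psd" "B1 \<in> psd" "B2 \<in> psd" using assms by (auto simp: dom_def)
  note m = c[THEN psdD(1)]
  consider "t = 0" | "t = 1" | "0 < t" "t < 1" using assms(3) by fastforce
  then show ?thesis
  proof cases
    case 3
    show ?thesis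
    proof (rule domI_kernel)
      fix X assume X: "X \<in> M" "convex_comb t A1 A2 * X = 0\<^sub>m n n"
      \<comment> \<open>Two nonnegative quadratic forms add up to zero with positive weights, so
        both vanish, and each pair carries the kernel from \<open>A\<close> to
        \<open>B\<close>.\<close>
      have "t * rtr (adj X * A1 * X) + (1 - t) * rtr (adj X * A2 * X) = rtr (adj X * (convex_comb t A1 A2 * X))"
        using rtr_convex_comb[OF m(1,2), of "adj X" X t] X m by (simp add: massoc)
      also have "\<dots> = 0" using X by (simp add: tr_mult)
      finally have "t * rtr (adj X * A1 * X) + (1 - t) * rtr (adj X * A2 * X) = 0" .
      moreover have "t * rtr (adj X * A1 * X) \<ge> 0" "(1 - t) * rtr (adj X * A2 * X) \<ge> 0"
        using 3 c X rtr_congr_nonneg by auto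
      ultimately have "rtr (adj X * A1 * X) = 0" "rtr (adj X * A2 * X) = 0" using 3 by (auto simp: add_nonneg_eq_0_iff)
      then have "B1 * X = 0\<^sub>m n n" "B2 * X = 0\<^sub>m n n"
        using rtr_congr_zero c X dom_kernel assms by blast+
      then show "convex_comb t B1 B2 * X = 0\<^sub>m n n"
        using X m by (simp add: convex_comb_def mdistrib msmult)
    qed (use c assms convex_comb_psd in auto)
  qed (use assms m in auto)
qed

lemma dom_mat_powr:
  assumes "dom A B" "p > 0"
  shows "dom (mat_powr A p) (mat_powr B p)"
proof -
  have c: "A \<in> psd" "B \<in> psd" "A \<in> M" "B \<in> M" using assms psdD by (auto simp: dom_def)
  have "mat_powr B p * mat_powr A 0 = mat_powr B (p - 1) * (B * mat_powr A 0)"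
    using c mat_powr_mult[of B "p - 1" 1] by (simp flip: massoc)
  also have "\<dots> = mat_powr B p" using assms c mat_powr_mult[of B "p - 1" 1] by (simp add: dom_def)
  finally show ?thesis using c by (simp add: dom_def mat_powr_psd mat_powr_powr)
qed

section \<open>The geometric mean\<close>

lemma geo_mean_psd: "A \<in> psd \<Longrightarrow> B \<in> psd \<Longrightarrow> geo_mean \<alpha> A B \<in> psd"
proof -
  assume AB: "A \<in> psd" "B \<in> psd"
  have "mat_powr A (- (1/2)) * B * mat_powr A (- (1/2)) \<in> psd"
    using psd_congr[of B "mat_powr A (- (1/2))"] AB by simp
  then show ?thesis unfolding geo_mean_def
    using psd_congr[OF mat_powr_psd, of _ "mat_powr A (1/2)"] AB by simp
qed

text \<open>The flip \<open>A #\<^sub>\<alpha> B = B #\<^sub>1\<^sub>-\<^sub>\<alpha> A\<close>: with \<open>X = A\<^sup>-\<^sup>1\<^sup>/\<^sup>2 B\<^sup>1\<^sup>/\<^sup>2\<close> it is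
  \<open>(X X\<^sup>*)\<^sup>\<alpha> = X (X\<^sup>* X)\<^sup>\<alpha>\<^sup>-\<^sup>1 X\<^sup>*\<close>.\<close>

lemma geo_mean_flip:
  assumes "dom A B"
  shows "geo_mean \<alpha> A B = mat_powr B (1/2) *
    mat_powr (mat_powr B (1/2) * mat_powr A (- 1) * mat_powr B (1/2)) (\<alpha> - 1) * mat_powr B (1/2)"
proof -
  have c: "A \<in> psd" "B \<in> psd" "A \<in> M" "B \<in> M" and BA: "B * mat_powr A 0 = B"
    using assms psdD by (auto simp: dom_def)
  let ?b = "mat_powr B (1/2)" and ?a = "mat_powr A (- (1/2))"
  define X where "X = ?a * ?b"
  have X: "X \<in> M" using c by (simp add: X_def)
  have XX: "adj X * X = ?b * mat_powr A (- 1) * ?b" "X * adj X = ?a * B * ?a"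
    using c mat_powr_half[OF c(2)] by (auto simp: X_def madj massoc mat_powr_mult_left)
  have psdX: "adj X * X \<in> psd" "X * adj X \<in> psd" using gram_psd[OF X] gram_psd[of "adj X"] X by auto
  have "X * adj X * X = X * (adj X * X)" using X by (simp add: massoc)
  then have "mat_powr (X * adj X) (\<alpha> - 1) * X = X * mat_powr (adj X * X) (\<alpha> - 1)"
    by (rule mat_powr_intertwine[OF psdX(2,1) X])
  then have F: "mat_powr (X * adj X) \<alpha> = X * mat_powr (adj X * X) (\<alpha> - 1) * adj X"
    using mat_powr_mult[OF psdX(2), of "\<alpha> - 1" 1] psdX X by (simp flip: massoc)
  have "mat_powr B (- (1/2)) * (B * mat_powr A 0) = ?b" using BA c mat_powr_mult[of B "- (1/2)" 1] by simp
  \<comment> \<open>\<open>A^(1/2)\<close> times \<open>A^(-1/2)\<close> is only the support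
    projection of \<open>A\<close>; the support condition lets \<open>B^(1/2)\<close> absorb
    it.\<close>
  then have bA: "?b * mat_powr A 0 = ?b" using c mat_powr_mult[of B "- (1/2)" 1] by (simp flip: massoc)
  then have Ab: "mat_powr A 0 * ?b = ?b" using madj(1)[of ?b "mat_powr A 0"] c by simp
  have AX: "mat_powr A (1/2) * X = ?b" using c Ab by (simp add: X_def mat_powr_mult_left)
  then have XA: "adj X * mat_powr A (1/2) = ?b" using madj(1)[of "mat_powr A (1/2)" X] c X by simp
  have "geo_mean \<alpha> A B = mat_powr A (1/2) * mat_powr (X * adj X) \<alpha> * mat_powr A (1/2)"
    by (simp add: geo_mean_def XX)
  also have "\<dots> = (mat_powr A (1/2) * X) * mat_powr (adj X * X) (\<alpha> - 1) * (adj X * mat_powr A (1/2))"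
    unfolding F using c X psdX by (simp add: massoc)
  finally show ?thesis unfolding AX XA XX .
qed

text \<open>\<open>A\<close> now enters only through \<open>A^(-p)\<close>, and the inner exponent
  drops to \<open>\<alpha> - 1\<close>: for \<open>\<alpha> = 2\<close> the inner power disappears,
  and a rank one projection \<open>B\<close> reduces everything to a scalar.\<close>

lemma Tr_G_flip:
  assumes "dom A B" "p > 0"
  shows "Tr_G \<alpha> p A B = rtr (mat_powr (mat_powr B (p/2) *
    mat_powr (mat_powr B (p/2) * mat_powr A (- p) * mat_powr B (p/2)) (\<alpha> - 1) * mat_powr B (p/2)) (1/p))"
proof -
  have c: "A \<in> psd" "B \<in> psd" using assms by (auto simp: dom_def)
  then show ?thesis
    unfolding Tr_G_def G_mean_def geo_mean_flip[OF dom_mat_powr[OF assms]]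
    by (simp add: mat_powr_powr)
qed

end

section \<open>Scalar inequalities\<close>

text \<open>\<open>frac_rep r F v\<close> says that \<open>v\<close> is obtained from \<open>F\<close> by the positive linear functional which
  maps \<open>s \<mapsto> x / (x + s)\<close> to \<open>x\<^sup>r\<close>: up to a constant it is integration against \<open>s\<^sup>r\<^sup>-\<^sup>1 ds\<close>
  for \<open>r < 1\<close>, and the limit of \<open>s F(s)\<close> for \<open>r = 1\<close>.\<close>

definition stieltjes_const :: "real \<Rightarrow> real" where
  "stieltjes_const r = (LINT s|lborel. indicator {0<..} s * (s powr (r - 1) * (1 / (1 + s))))"

definition frac_rep :: "real \<Rightarrow> (real \<Rightarrow> real) \<Rightarrow> real \<Rightarrow> bool" where
  "frac_rep r F v \<longleftrightarrow> (if r < 1 then has_bochner_integral lborel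
     (\<lambda>s. indicator {0<..} s * (s powr (r - 1) * F s)) (stieltjes_const r * v)
     else ((\<lambda>s. s * F s) \<longlongrightarrow> v) at_top)"

text \<open>The integrand is dominated by \<open>s powr (r - 1)\<close> on \<open>[0, 1]\<close>,
  where \<open>r > 0\<close> gives integrability, and by \<open>s powr (r - 2)\<close> beyond 1,
  where \<open>r < 1\<close> does.\<close>

lemma stieltjes_integrable:
  assumes r: "0 < r" "r < 1"
  shows "integrable lborel (\<lambda>s::real. indicator {0<..} s * (s powr (r - 1) * (1 / (1 + s))))"
proof -
  have 1: "integrable lborel (\<lambda>s::real. indicator {0..1} s * s powr (r - 1))"
  proof (rule integrableI_nonneg)
    have "((\<lambda>s. s powr (r - 1)) has_integral (1 / r)) {0..1}"
      using has_integral_powr_from_0[of "r - 1" 1] r by simp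
    then have "((\<lambda>s::real. indicator {0..1} s * s powr (r - 1)) has_integral (1 / r)) UNIV"
      by (subst (asm) has_integral_restrict_UNIV[symmetric])
        (auto elim!: has_integral_eq[rotated] simp: indicator_def)
    then have "(\<integral>\<^sup>+ s. ennreal (indicator {0..1} s * s powr (r - 1)) \<partial>lborel) = ennreal (1 / r)"
      by (intro nn_integral_has_integral_lborel) auto
    then show "(\<integral>\<^sup>+ s. ennreal (indicator {0..1} s * s powr (r - 1)) \<partial>lborel) < \<infinity>" by simp
  qed auto
  have 2: "integrable lborel (\<lambda>s::real. indicator {1..} s * s powr (r - 2))"
  proof (rule integrableI_nonneg)
    have "((\<lambda>s. s powr (r - 2)) has_integral (1 / (1 - r))) {1..}"
      using has_integral_powr_to_inf[of "r - 2" 1] r minus_divide_right[of 1 "r - 1"] by simp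
    then have "((\<lambda>s::real. indicator {1..} s * s powr (r - 2)) has_integral (1 / (1 - r))) UNIV"
      by (subst (asm) has_integral_restrict_UNIV[symmetric])
        (auto elim!: has_integral_eq[rotated] simp: indicator_def)
    then have "(\<integral>\<^sup>+ s. ennreal (indicator {1..} s * s powr (r - 2)) \<partial>lborel) = ennreal (1 / (1 - r))"
      by (intro nn_integral_has_integral_lborel) auto
    then show "(\<integral>\<^sup>+ s. ennreal (indicator {1..} s * s powr (r - 2)) \<partial>lborel) < \<infinity>" by simp
  qed auto
  have "norm (indicator {0<..} s * (s powr (r - 1) * (1 / (1 + s)))) \<le>
      norm (indicator {0..1} s * s powr (r - 1) + indicator {1..} s * s powr (r - 2))" for s :: real
  proof -
    consider "s \<le> 0" | "0 < s" "s < 1" | "1 \<le> s" by linarith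
    then show ?thesis
    proof cases
      case 2
      then show ?thesis by (simp add: indicator_def divide_simps)
    next
      case 3
      have "s powr (r - 1) = s powr (r - 2) * s" using 3 powr_add[of s "r - 2" 1] by simp
      then have "s powr (r - 1) * (1 / (1 + s)) \<le> s powr (r - 2)" using 3 by (simp add: divide_simps)
      then show ?thesis using 3 by (simp add: indicator_def) 
    qed (simp add: indicator_def)
  qed
  then show ?thesis
    by (intro Bochner_Integration.integrable_bound[OF Bochner_Integration.integrable_add[OF 1 2]]) auto
qed

lemma stieltjes_const_pos:
  assumes r: "0 < r" "r < 1"
  shows "stieltjes_const r > 0"
proof -
  \<comment> \<open>On \<open>[1, 2]\<close> the two factors are at least 1/2 and 1/3.\<close>
  have "1 / 6 = (LINT s|lborel. indicator {1..2::real} s * (1 / 6 :: real))" by simp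
  also have "\<dots> \<le> stieltjes_const r" unfolding stieltjes_const_def
  proof (rule integral_mono)
    fix s :: real
    show "indicator {1..2} s * (1 / 6) \<le> indicator {0<..} s * (s powr (r - 1) * (1 / (1 + s)))"
    proof (cases "s \<in> {1..2}")
      case True
      have "1 / 2 \<le> s powr (- 1)" using True by (simp add: powr_minus divide_simps)
      also have "\<dots> \<le> s powr (r - 1)" using True r by (intro powr_mono) auto
      finally have "1 / 2 * (1 / 3) \<le> s powr (r - 1) * (1 / (1 + s))"
        using True by (intro mult_mono) (auto simp: divide_simps)
      then show ?thesis using True by simp
    qed (auto simp: indicator_def)
  qed (use stieltjes_integrable[OF r] in auto)
  finally show ?thesis by simp
qed

text \<open>For \<open>r < 1\<close>, substituting \<open>s / x\<close> for \<open>s\<close> in the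
  integral that defines the constant pulls out \<open>x powr r\<close>; for \<open>r = 1\<close>,
  \<open>s * (x / (x + s))\<close> tends to \<open>x\<close>.\<close>

lemma frac_rep_base:
  assumes r: "0 < r" "r \<le> 1" and x: "0 \<le> x"
  shows "frac_rep r (\<lambda>s. x / (x + s)) (x powr r)"
proof (cases "x = 0")
  case True
  then show ?thesis using r by (auto simp: frac_rep_def has_bochner_integral_zero)
next
  case False
  then have x: "x > 0" using x by simp
  show ?thesis
  proof (cases "r < 1")
    case True
    have "has_bochner_integral lborel (\<lambda>s::real. indicator {0<..} s * (s powr (r - 1) * (1 / (1 + s))))
        (stieltjes_const r)"
      using stieltjes_integrable[OF r(1) True] by (simp add: has_bochner_integral_iff stieltjes_const_def)
    then have "has_bochner_integral lborel
        (\<lambda>s. indicator {0<..} (0 + 1 / x * s) * ((0 + 1 / x * s) powr (r - 1) * (1 / (1 + (0 + 1 / x * s)))))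
        (stieltjes_const r /\<^sub>R \<bar>1 / x\<bar>)"
      using x by (subst (asm) lborel_has_bochner_integral_real_affine_iff[where c = "1 / x" and t = 0]) auto
    then have "has_bochner_integral lborel (\<lambda>s. x powr (r - 1) *
        (indicator {0<..} (0 + 1 / x * s) * ((0 + 1 / x * s) powr (r - 1) * (1 / (1 + (0 + 1 / x * s))))))
        (x powr (r - 1) * (stieltjes_const r /\<^sub>R \<bar>1 / x\<bar>))"
      by (rule has_bochner_integral_mult_right)
    also have "(\<lambda>s. x powr (r - 1) *
        (indicator {0<..} (0 + 1 / x * s) * ((0 + 1 / x * s) powr (r - 1) * (1 / (1 + (0 + 1 / x * s)))))) =
      (\<lambda>s. indicator {0<..} s * (s powr (r - 1) * (x / (x + s))))"
    proof
      fix s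
      have "x powr (r - 1) * (s / x) powr (r - 1) = s powr (r - 1)" if "s > 0"
        using that x by (simp flip: powr_mult)
      then show "x powr (r - 1) *
        (indicator {0<..} (0 + 1 / x * s) * ((0 + 1 / x * s) powr (r - 1) * (1 / (1 + (0 + 1 / x * s))))) =
        indicator {0<..} s * (s powr (r - 1) * (x / (x + s)))"
        using x by (cases "s > 0") (auto simp: indicator_def field_simps)
    qed
    also have "x powr (r - 1) * (stieltjes_const r /\<^sub>R \<bar>1 / x\<bar>) = stieltjes_const r * x powr r"
      using x powr_add[of x "r - 1" 1] by simp
    finally show ?thesis using True by (simp add: frac_rep_def)
  next
    case False
    then have "r = 1" using r by simp
    moreover have "((\<lambda>s. s * (x / (x + s))) \<longlongrightarrow> x) at_top" by real_asymp
    ultimately show ?thesis using x by (simp add: frac_rep_def)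
  qed
qed

lemma frac_rep_sum:
  assumes "finite I" "\<And>i. i \<in> I \<Longrightarrow> frac_rep r (F i) (v i)"
  shows "frac_rep r (\<lambda>s. \<Sum>i\<in>I. c i * F i s) (\<Sum>i\<in>I. c i * v i)"
proof (cases "r < 1")
  case True
  have "has_bochner_integral lborel (\<lambda>s. \<Sum>i\<in>I. c i * (indicator {0<..} s * (s powr (r - 1) * F i s)))
    (\<Sum>i\<in>I. c i * (stieltjes_const r * v i))"
    using assms True unfolding frac_rep_def
    by (intro has_bochner_integral_sum has_bochner_integral_mult_right) auto
  also have "(\<lambda>s. \<Sum>i\<in>I. c i * (indicator {0<..} s * (s powr (r - 1) * F i s))) =
      (\<lambda>s. indicator {0<..} s * (s powr (r - 1) * (\<Sum>i\<in>I. c i * F i s)))"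
    by (simp add: sum_distrib_left mult_ac)
  also have "(\<Sum>i\<in>I. c i * (stieltjes_const r * v i)) = stieltjes_const r * (\<Sum>i\<in>I. c i * v i)"
    by (simp add: sum_distrib_left mult_ac)
  finally show ?thesis using True by (simp add: frac_rep_def)
next
  case False
  have "((\<lambda>s. \<Sum>i\<in>I. c i * (s * F i s)) \<longlongrightarrow> (\<Sum>i\<in>I. c i * v i)) at_top"
    using assms False unfolding frac_rep_def by (intro tendsto_sum tendsto_mult_left) auto
  then show ?thesis using False by (simp add: frac_rep_def sum_distrib_left mult_ac)
qed

lemma frac_rep_mult: "frac_rep r F v \<Longrightarrow> frac_rep r (\<lambda>s. c * F s) (c * v)"
  using frac_rep_sum[of "{()}" r "\<lambda>_. F" "\<lambda>_. v" "\<lambda>_. c"] by simp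

lemma frac_rep_add: "frac_rep r F v \<Longrightarrow> frac_rep r G w \<Longrightarrow> frac_rep r (\<lambda>s. F s + G s) (v + w)"
  using frac_rep_sum[of "UNIV :: bool set" r "\<lambda>b. if b then F else G" "\<lambda>b. if b then v else w" "\<lambda>_. 1"]
  by (simp add: UNIV_bool add.commute)

lemma frac_rep_convex:
  "frac_rep r F v \<Longrightarrow> frac_rep r G w \<Longrightarrow> frac_rep r (\<lambda>s. t * F s + (1 - t) * G s) (t * v + (1 - t) * w)"
  by (intro frac_rep_add frac_rep_mult)

lemma frac_rep_double_sum:
  assumes "0 < r" "r \<le> 1" "finite I" "finite J" "\<And>i j. i \<in> I \<Longrightarrow> j \<in> J \<Longrightarrow> 0 \<le> x i j"
  shows "frac_rep r (\<lambda>s. \<Sum>i\<in>I. \<Sum>j\<in>J. c i j * (x i j / (x i j + s)))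
    (\<Sum>i\<in>I. \<Sum>j\<in>J. c i j * x i j powr r)"
proof -
  have "frac_rep r (\<lambda>s. \<Sum>j\<in>J. c i j * (x i j / (x i j + s))) (\<Sum>j\<in>J. c i j * x i j powr r)" if "i \<in> I" for i
    using assms that by (intro frac_rep_sum frac_rep_base) auto
  from frac_rep_sum[OF assms(3) this, where c = "\<lambda>_. 1"] show ?thesis by simp
qed

text \<open>Both versions of the functional are positive. The inequalities for the geometric mean,
  of Lieb and of Ando all pass through here, each compared at fixed \<open>s\<close> with an
  extremal matrix that may depend on \<open>s\<close>.\<close>

lemma frac_rep_mono:
  assumes r: "0 < r" "r \<le> 1" and F: "frac_rep r F v" and G: "frac_rep r G w"
    and le: "\<And>s. s > 0 \<Longrightarrow> F s \<le> G s"
  shows "v \<le> w"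
proof (cases "r < 1")
  case True
  let ?I = "\<lambda>F s. indicator {0<..} s * (s powr (r - 1) * F s) :: real"
  have i: "integrable lborel (?I F)" "integrable lborel (?I G)"
    "stieltjes_const r * v = (LINT s|lborel. ?I F s)" "stieltjes_const r * w = (LINT s|lborel. ?I G s)"
    using F G True unfolding frac_rep_def has_bochner_integral_iff by auto
  have "?I F s \<le> ?I G s" for s
    by (cases "s > 0") (auto intro!: mult_left_mono le)
  then have "stieltjes_const r * v \<le> stieltjes_const r * w"
    unfolding i(3,4) by (intro integral_mono i(1,2))
  then show ?thesis using stieltjes_const_pos[OF r(1) True] by simp
next
  case False
  have "\<forall>\<^sub>F s in at_top. s * F s \<le> s * G s"
    using eventually_gt_at_top[of "0::real"] by eventually_elim (simp add: le)
  then show ?thesis using F G False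
    by (intro tendsto_le[of at_top "\<lambda>s. s * G s" w "\<lambda>s. s * F s" v]) (auto simp: frac_rep_def)
qed

section \<open>Young, Jensen and completed squares\<close>

lemma young_powr:
  assumes "0 \<le> a" "0 \<le> b" "0 < p" "p \<le> (1::real)"
  shows "a powr p * b powr (1 - p) \<le> p * a + (1 - p) * b"
proof (cases "a = 0 \<or> b = 0")
  case False
  then show ?thesis using assms Youngs_inequality_0[of p "1 - p" a b] by simp
qed (use assms in auto)

text \<open>Young's inequality between \<open>y i powr \<sigma>\<close> and
  \<open>z powr \<sigma>\<close> is the tangent line bound for the power at the mean
  \<open>z\<close>; averaging it with the weights gives the claim.\<close>

lemma jensen_powr:
  assumes "finite I" "\<And>i. i \<in> I \<Longrightarrow> 0 \<le> w i" "(\<Sum>i\<in>I. w i) = 1" "\<And>i. i \<in> I \<Longrightarrow> 0 \<le> y i" "\<sigma> \<ge> (1::real)"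
  shows "(\<Sum>i\<in>I. w i * y i) powr \<sigma> \<le> (\<Sum>i\<in>I. w i * y i powr \<sigma>)"
proof -
  define z where "z = (\<Sum>i\<in>I. w i * y i)"
  have z: "z \<ge> 0" unfolding z_def using assms by (intro sum_nonneg) auto
  have y: "y i * z powr (\<sigma> - 1) \<le> 1 / \<sigma> * y i powr \<sigma> + (1 - 1 / \<sigma>) * z powr \<sigma>" if "i \<in> I" for i
  proof -
    have "\<sigma> * (1 - 1 / \<sigma>) = \<sigma> - 1" using assms(5) by (simp add: field_simps)
    then show ?thesis
      using young_powr[of "y i powr \<sigma>" "z powr \<sigma>" "1 / \<sigma>"] assms(4)[OF that] assms(5)
      by (simp add: powr_powr)
  qed
  have "z powr \<sigma> = z * z powr (\<sigma> - 1)" using z assms(5) powr_add[of z 1 "\<sigma> - 1"] by simp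
  also have "\<dots> = (\<Sum>i\<in>I. w i * (y i * z powr (\<sigma> - 1)))"
    by (simp add: z_def sum_distrib_right sum_distrib_left mult_ac)
  also have "\<dots> \<le> (\<Sum>i\<in>I. w i * (1 / \<sigma> * y i powr \<sigma> + (1 - 1 / \<sigma>) * z powr \<sigma>))"
    using assms y by (intro sum_mono mult_left_mono) auto
  also have "\<dots> = 1 / \<sigma> * (\<Sum>i\<in>I. w i * y i powr \<sigma>) + (1 - 1 / \<sigma>) * z powr \<sigma> * (\<Sum>i\<in>I. w i)"
    unfolding sum_distrib_left sum.distrib[symmetric] by (intro sum.cong refl) (simp add: algebra_simps)
  finally have "1 / \<sigma> * z powr \<sigma> \<le> 1 / \<sigma> * (\<Sum>i\<in>I. w i * y i powr \<sigma>)"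
    using assms(3) by (simp add: algebra_simps)
  then show ?thesis using assms(5) unfolding z_def by (simp add: divide_simps)
qed

text \<open>A concave quadratic in \<open>x\<close>, largest at \<open>x = e / (e + s) * y\<close>.
  This is the scalar content of the variational formulas that are suprema; there \<open>x\<close> is
  an entry of the free matrix in suitable coordinates.\<close>

lemma complete_square:
  assumes "0 \<le> e" "0 < s"
  shows "2 * e * Re (cnj x * y) - (e + s) * (cmod x)\<^sup>2 \<le> e * (cmod y)\<^sup>2 * (e / (e + s))"
proof -
  define k where "k = e / (e + s)"
  have k: "(e + s) * k = e" using assms by (simp add: k_def)
  have "e * Re (cnj x * y) \<le> e * (cmod x * cmod y)"
    using complex_Re_le_cmod[of "cnj x * y"] assms by (intro mult_left_mono) (auto simp: norm_mult)
  moreover have "0 \<le> (e + s) * (cmod x - k * cmod y)\<^sup>2" using assms by simp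
  moreover have "(e + s) * (cmod x - k * cmod y)\<^sup>2 =
      (e + s) * (cmod x)\<^sup>2 - 2 * ((e + s) * k) * (cmod x * cmod y) + ((e + s) * k) * (cmod y)\<^sup>2 * k"
    by (simp add: power2_eq_square algebra_simps)
  ultimately show ?thesis unfolding k k_def[symmetric] by linarith
qed

lemma complete_square_eq:
  assumes "0 \<le> e" "0 < s" "x = complex_of_real (e / (e + s)) * y"
  shows "2 * e * Re (cnj x * y) - (e + s) * (cmod x)\<^sup>2 = e * (cmod y)\<^sup>2 * (e / (e + s))"
proof -
  define k where "k = e / (e + s)"
  have k: "(e + s) * k = e" using assms(1,2) by (simp add: k_def)
  have x: "x = complex_of_real k * y" using assms(3) by (simp add: k_def)
  have "Re (cnj x * y) = k * (cmod y)\<^sup>2"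
    unfolding x cmod_power2 by (simp add: power2_eq_square algebra_simps)
  moreover have "(e + s) * (cmod x)\<^sup>2 = ((e + s) * k) * k * (cmod y)\<^sup>2"
    unfolding x by (simp add: norm_mult power2_eq_square)
  ultimately show ?thesis unfolding k k_def[symmetric] by (simp add: algebra_simps)
qed

section \<open>Trace inequalities of Peierls type\<close>

context cmat
begin

text \<open>Right multiplication keeps column \<open>i\<close> and clears the others, so the trace
  of a congruence by \<open>F * unit_diag i\<close> is the quadratic form at the \<open>i\<close>-th
  column of \<open>F\<close>.\<close>

abbreviation unit_diag :: "nat \<Rightarrow> complex mat" where
  "unit_diag i \<equiv> dg (\<lambda>k. if k = i then 1 else 0)"

lemma rtr_unit_diag:
  assumes "spec V y Y" "F \<in> M" "i < n"
  shows "rtr (adj (F * unit_diag i) * Y * (F * unit_diag i)) = (\<Sum>k<n. y k * (cmod ((adj V * F) $$ (k, i)))\<^sup>2)"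
proof -
  note c = specD(2,3)[OF assms(1)] assms(2)
  have e: "(adj V * (F * unit_diag i) * 1\<^sub>m n) $$ (k, j) = (if j = i then (adj V * F) $$ (k, i) else 0)"
    if "k < n" "j < n" for k j
    using c that dg_mult_index(2)[of "adj V * F" k j "\<lambda>k. if k = i then 1 else 0"] by (auto simp: massoc)
  have "rtr (adj (F * unit_diag i) * Y * (F * unit_diag i)) =
    (\<Sum>k<n. \<Sum>j<n. y k * (cmod ((adj V * (F * unit_diag i) * 1\<^sub>m n) $$ (k, j)))\<^sup>2)"
    using c by (intro rtr_left_spec[OF assms(1) unitary_one]) auto
  also have "\<dots> = (\<Sum>k<n. \<Sum>j<n. if j = i then y k * (cmod ((adj V * F) $$ (k, i)))\<^sup>2 else 0)"
    using e by (intro sum.cong refl) auto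
  finally show ?thesis using assms(3) by simp
qed

lemma adj_mult_diag: "F \<in> M \<Longrightarrow> i < n \<Longrightarrow>
    (adj F * F) $$ (i, i) = complex_of_real (\<Sum>k<n. (cmod (F $$ (k, i)))\<^sup>2)"
  unfolding of_real_sum complex_norm_square by (auto simp: mult_index mult.commute intro!: sum.cong)

lemma partial_isometry_sums:
  assumes F: "F \<in> M" "adj F * F = dg c" and c: "\<And>i. i < n \<Longrightarrow> c i \<in> {0, 1}"
  shows "j < n \<Longrightarrow> (\<Sum>i<n. (cmod (F $$ (i, j)))\<^sup>2) = c j"
    and "i < n \<Longrightarrow> (\<Sum>j<n. (cmod (F $$ (i, j)))\<^sup>2) \<le> 1"
proof -
  show col: "(\<Sum>i<n. (cmod (F $$ (i, j)))\<^sup>2) = c j" if "j < n" for j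
  proof -
    have "complex_of_real (\<Sum>i<n. (cmod (F $$ (i, j)))\<^sup>2) = of_real (c j)"
      using adj_mult_diag[OF F(1) that] that unfolding F(2) by (simp add: mat_diag_def)
    then show ?thesis by (simp only: of_real_eq_iff)
  qed
  have Fc: "F * dg c = F"
  proof (rule eq_matI)
    fix i j assume "i < dim_row F" "j < dim_col F"
    then have ij: "i < n" "j < n" using F by auto
    have "F $$ (i, j) = 0" if "c j = 0"
      using col[OF ij(2)] that ij by (auto simp: sum_nonneg_eq_0_iff)
    then show "(F * dg c) $$ (i, j) = F $$ (i, j)" using F(1) ij c[OF ij(2)] by (auto simp: dg_mult_index)
  qed (use F in auto)
  define R where "R = F * adj F"
  have R: "R \<in> M" "adj R = R" using F by (auto simp: R_def madj)
  have "R * R = (F * (adj F * F)) * adj F" unfolding R_def using F(1) by (simp add: massoc)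
  then have RR: "adj R * R = R" using R(2) unfolding F(2) Fc by (simp add: R_def)
  show "(\<Sum>j<n. (cmod (F $$ (i, j)))\<^sup>2) \<le> 1" if i: "i < n"
  proof -
    define x where "x = (\<Sum>j<n. (cmod (F $$ (i, j)))\<^sup>2)"
    have x: "R $$ (i, i) = of_real x"
      using adj_mult_diag[of "adj F" i] F(1) i by (simp add: R_def x_def)
    have "x = (\<Sum>k<n. (cmod (R $$ (k, i)))\<^sup>2)"
      using adj_mult_diag[OF R(1) i] x unfolding RR by (simp only: of_real_eq_iff)
    also have "\<dots> \<ge> (cmod (R $$ (i, i)))\<^sup>2" using i by (intro member_le_sum) auto
    finally have "x\<^sup>2 \<le> x" using x by simp
    have "x \<le> 1"
    proof (rule ccontr)
      assume "\<not> x \<le> 1"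
      then have "x * 1 < x * x" by (intro mult_strict_left_mono) auto
      with \<open>x\<^sup>2 \<le> x\<close> show False by (simp add: power2_eq_square)
    qed
    then show ?thesis unfolding x_def .
  qed
qed

lemma unitary_isometry: "unitary_mat n U \<Longrightarrow> adj U * U = dg (\<lambda>_. 1)"
  using unitaryD(2) by simp

text \<open>Jensen applies in each column, whose squared moduli in the eigenbasis of
  \<open>Y\<close> sum to 1 or to 0; the row sums, at most 1, then recombine the powers of the
  eigenvalues into the trace.\<close>

lemma peierls:
  assumes Y: "Y \<in> psd" and F: "F \<in> M" "adj F * F = dg c" "\<And>i. i < n \<Longrightarrow> c i \<in> {0, 1}" and \<sigma>: "\<sigma> \<ge> 1"
  shows "(\<Sum>i<n. rtr (adj (F * unit_diag i) * Y * (F * unit_diag i)) powr \<sigma>) \<le> rtr (mat_powr Y \<sigma>)"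
proof -
  obtain V y where V: "spec V y Y" "\<forall>i. 0 \<le> y i" by (rule psd_spectral[OF Y])
  note v = specD(2)[OF V(1)] unitaryD[OF specD(1)[OF V(1)]]
  let ?Q = "adj V * F"
  have Q: "?Q \<in> M" "adj ?Q * ?Q = dg c" using v F by (auto simp: madj massoc)
  have sums: "j < n \<Longrightarrow> (\<Sum>i<n. (cmod (?Q $$ (i, j)))\<^sup>2) = c j"
    "i < n \<Longrightarrow> (\<Sum>j<n. (cmod (?Q $$ (i, j)))\<^sup>2) \<le> 1" for i j
    using partial_isometry_sums[OF Q] F(3) by auto
  have "(\<Sum>i<n. rtr (adj (F * unit_diag i) * Y * (F * unit_diag i)) powr \<sigma>) =
      (\<Sum>i<n. (\<Sum>k<n. (cmod (?Q $$ (k, i)))\<^sup>2 * y k) powr \<sigma>)"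
    using rtr_unit_diag[OF V(1) F(1)] by (simp add: mult.commute)
  also have "\<dots> \<le> (\<Sum>i<n. \<Sum>k<n. (cmod (?Q $$ (k, i)))\<^sup>2 * y k powr \<sigma>)"
  proof (rule sum_mono)
    fix i assume "i \<in> {..<n}"
    then have i: "i < n" by simp
    show "(\<Sum>k<n. (cmod (?Q $$ (k, i)))\<^sup>2 * y k) powr \<sigma> \<le> (\<Sum>k<n. (cmod (?Q $$ (k, i)))\<^sup>2 * y k powr \<sigma>)"
    proof (cases "c i = 0")
      case True
      then have "\<forall>k<n. (cmod (?Q $$ (k, i)))\<^sup>2 = 0" using sums(1)[OF i] by (simp add: sum_nonneg_eq_0_iff)
      then show ?thesis by simp
    next
      case False
      then show ?thesis using sums(1)[OF i] F(3)[OF i] V \<sigma> by (intro jensen_powr) auto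
    qed
  qed
  also have "\<dots> = (\<Sum>k<n. (\<Sum>i<n. (cmod (?Q $$ (k, i)))\<^sup>2) * y k powr \<sigma>)"
    by (subst sum.swap) (simp add: sum_distrib_right)
  also have "\<dots> \<le> (\<Sum>k<n. 1 * y k powr \<sigma>)" using sums(2) by (intro sum_mono mult_right_mono) auto
  also have "\<dots> = rtr (mat_powr Y \<sigma>)" using rtr_mat_powr[OF V] by simp
  finally show ?thesis .
qed

text \<open>Monotonicity and convexity of \<open>Tr X^\<sigma>\<close> at once. All is tested in the
  eigenbasis of \<open>X\<close>: there the diagonal entries of \<open>X\<close> are its
  eigenvalues, while \<open>peierls\<close> bounds the powers of those of \<open>Y\<close> and
  \<open>Z\<close>.\<close>

lemma rtr_mat_powr_mono_convex:
  assumes psd: "X \<in> psd" "Y \<in> psd" "Z \<in> psd" and \<sigma>: "\<sigma> \<ge> 1" and t: "t \<in> {0..1}"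
    and le: "\<And>W. W \<in> M \<Longrightarrow> rtr (adj W * X * W) \<le> t * rtr (adj W * Y * W) + (1 - t) * rtr (adj W * Z * W)"
  shows "rtr (mat_powr X \<sigma>) \<le> t * rtr (mat_powr Y \<sigma>) + (1 - t) * rtr (mat_powr Z \<sigma>)"
proof -
  obtain U x where U: "spec U x X" "\<forall>i. 0 \<le> x i" by (rule psd_spectral[OF psd(1)])
  note u = specD(1)[OF U(1)]
  let ?W = "\<lambda>i. U * unit_diag i"
  have W: "?W i \<in> M" for i using specD(2)[OF U(1)] by simp
  define f where "f Y i = rtr (adj (?W i) * Y * ?W i)" for Y i
  have f0: "f Y i \<ge> 0" "f Z i \<ge> 0" for i unfolding f_def using psd W rtr_congr_nonneg by auto
  have x: "f X i = x i" if "i < n" for i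
  proof -
    have "f X i = (\<Sum>k<n. x k * (cmod ((adj U * U) $$ (k, i)))\<^sup>2)"
      unfolding f_def using rtr_unit_diag[OF U(1) specD(2)[OF U(1)] that] .
    also have "\<dots> = (\<Sum>k<n. if k = i then x i else 0)"
      using unitaryD[OF u] that by (intro sum.cong) auto
    finally show ?thesis using that by simp
  qed
  have c: "x i powr \<sigma> \<le> t * f Y i powr \<sigma> + (1 - t) * f Z i powr \<sigma>" if "i < n" for i
  proof -
    have "x i powr \<sigma> \<le> (t * f Y i + (1 - t) * f Z i) powr \<sigma>"
      using le[OF W, of i] x[OF that] U(2) \<sigma> unfolding f_def by (intro powr_mono2) auto
    also have "\<dots> \<le> t * f Y i powr \<sigma> + (1 - t) * f Z i powr \<sigma>"
      using jensen_powr[of "UNIV :: bool set" "\<lambda>b. if b then t else 1 - t" "\<lambda>b. if b then f Y i else f Z i" \<sigma>]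
        t f0 \<sigma> by (auto simp: UNIV_bool add.commute)
    finally show ?thesis .
  qed
  have "rtr (mat_powr X \<sigma>) = (\<Sum>i<n. x i powr \<sigma>)" using rtr_mat_powr[OF U] .
  also have "\<dots> \<le> (\<Sum>i<n. t * f Y i powr \<sigma> + (1 - t) * f Z i powr \<sigma>)"
    using c by (intro sum_mono) auto
  also have "\<dots> = t * (\<Sum>i<n. f Y i powr \<sigma>) + (1 - t) * (\<Sum>i<n. f Z i powr \<sigma>)"
    by (simp add: sum.distrib sum_distrib_left)
  also have "\<dots> \<le> t * rtr (mat_powr Y \<sigma>) + (1 - t) * rtr (mat_powr Z \<sigma>)"
    unfolding f_def using t psd \<sigma> unitary_isometry[OF u] specD(2)[OF U(1)]
    by (intro add_mono mult_left_mono peierls[where c = "\<lambda>_. 1"]) auto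
  finally show ?thesis .
qed

section \<open>Joint operator convexity of the geometric mean\<close>

text \<open>\<open>V = D^(1/2) U\<close>, where \<open>U\<close> diagonalises
  \<open>D^(-1/2) C D^(-1/2)\<close>. As \<open>V\<close> may be singular, \<open>adj V * L\<close>
  need not reach every matrix; the last clause secures the one value at which the variational
  formula is attained.\<close>

lemma geo_mean_congruence:
  assumes "dom D C"
  obtains V e where "V \<in> M" "\<forall>i. 0 \<le> e i" "D = V * adj V" "C = V * dg e * adj V"
    "\<And>\<alpha>. geo_mean \<alpha> D C = V * dg (\<lambda>i. e i powr \<alpha>) * adj V"
    "\<And>s W. s > 0 \<Longrightarrow> W \<in> M \<Longrightarrow> \<exists>L\<in>M. adj V * L = dg (\<lambda>i. e i / (e i + s)) * (adj V * W)"
proof -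
  have c: "D \<in> psd" "C \<in> psd" "D \<in> M" "C \<in> M" and CD: "C * mat_powr D 0 = C"
    using assms psdD by (auto simp: dom_def)
  have DC: "mat_powr D 0 * C = C" using madj(1)[of C "mat_powr D 0"] c CD psdD(2)[OF c(2)] by simp
  let ?h = "mat_powr D (1/2)" and ?g = "mat_powr D (- (1/2))"
  define T where "T = ?g * C * ?g"
  have T: "T \<in> psd" unfolding T_def using psd_congr[of C ?g] c by simp
  have hTh: "?h * T * ?h = C" unfolding T_def
    using c CD DC by (simp add: massoc mat_powr_mult mat_powr_mult_left)
  have PT: "mat_powr D 0 * T = T" unfolding T_def using c by (simp add: massoc mat_powr_mult_left)
  obtain U e where U: "spec U e T" "\<forall>i. 0 \<le> e i" by (rule psd_spectral[OF T])
  note u = specD(2,5)[OF U(1)] unitaryD[OF specD(1)[OF U(1)]]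
  define V where "V = ?h * U"
  have V: "V \<in> M" "adj V = adj U * ?h" using u c by (auto simp: V_def madj)
  have f: "?h * (U * dg f * adj U) * ?h = V * dg f * adj V" for f
    unfolding V(2) unfolding V_def using u(1) c by (simp add: massoc)
  show ?thesis
  proof (rule that[of V e])
    have "V * adj V = ?h * (U * (adj U * ?h))" unfolding V(2) unfolding V_def using u(1) c by (simp add: massoc)
    then show "D = V * adj V" using u c by (simp add: mat_powr_mult)
    show "C = V * dg e * adj V" using f[of e] hTh u(2) by simp
    show "geo_mean \<alpha> D C = V * dg (\<lambda>i. e i powr \<alpha>) * adj V" for \<alpha>
      using f mat_powr_spec[OF U] by (simp add: geo_mean_def T_def)
    fix s :: real and W assume s: "s > 0" and W: "W \<in> M"
    define k where "k i = e i / (e i + s)" for i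
    define G where "G = U * dg k * adj U"
    have G: "G \<in> M" using u by (simp add: G_def)
    \<comment> \<open>\<open>G\<close> is \<open>T / (T + s)\<close>. The factor \<open>T\<close> on
      its left puts its range inside the support of \<open>D\<close>, where
      \<open>D^(1/2) D^(-1/2)\<close> acts as the identity.\<close>
    define R where "R = U * dg (\<lambda>i. 1 / (e i + s)) * adj U"
    have R: "R \<in> M" using u by (simp add: R_def)
    have "T * R = (U * dg e * adj U) * R" using u(2) by simp
    also have "\<dots> = U * (dg e * dg (\<lambda>i. 1 / (e i + s))) * adj U"
      unfolding R_def using u by (simp add: massoc del: mat_diag_diag dg_mult)
    also have "\<dots> = G" unfolding G_def k_def by simp
    finally have TR: "G = T * R" ..
    have "mat_powr D 0 * G = (mat_powr D 0 * T) * R"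
      unfolding TR using c R psdD(1)[OF T] by (simp add: massoc)
    then have PG: "mat_powr D 0 * G = G" using PT TR by simp
    have V_mult: "adj V * Y = adj U * (?h * Y)" if "Y \<in> M" for Y
      unfolding V(2) using u(1) c(1) that by (simp add: massoc)
    have "adj V * (?g * (G * (?h * W))) = adj U * (?h * (?g * (G * (?h * W))))"
      using c G W by (intro V_mult) auto
    also have "?h * (?g * (G * (?h * W))) = (mat_powr D 0 * G) * (?h * W)"
      using c G W by (simp add: mat_powr_mult_left massoc)
    also have "adj U * ((mat_powr D 0 * G) * (?h * W)) = (adj U * U) * dg k * (adj U * (?h * W))"
      unfolding PG unfolding G_def using u(1) c W by (simp add: massoc)
    also have "\<dots> = dg k * (adj V * W)" using V_mult[OF W] u(1,4) c W by simp
    finally show "\<exists>L\<in>M. adj V * L = dg (\<lambda>i. e i / (e i + s)) * (adj V * W)"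
      using c G W unfolding k_def by (intro bexI[of _ "?g * (G * (?h * W))"]) auto
  qed (use V U in auto)
qed

text \<open>For fixed \<open>L\<close> this is linear in the pair \<open>(D, C)\<close>; in the
  invertible case its maximum over \<open>L\<close> is
  \<open>Tr W* C (C + s D)^(-1) C W\<close>.\<close>

definition mean_form :: "real \<Rightarrow> complex mat \<Rightarrow> complex mat \<Rightarrow> complex mat \<Rightarrow> complex mat \<Rightarrow> real" where
  "mean_form s D C W L = 2 * rtr (adj L * C * W) - rtr (adj L * C * L) - s * rtr (adj L * D * L)"

text \<open>In the coordinates \<open>adj V * L\<close> and \<open>adj V * W\<close> the form splits
  into scalar quadratics. Writing \<open>e^\<alpha> = e * e^(\<alpha> - 1)\<close> leaves an
  exponent in \<open>(0, 1]\<close>, which \<open>frac_rep\<close> resolves into the fractions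
  \<open>e / (e + s)\<close>.\<close>

lemma geo_mean_variational:
  assumes "dom D C" "W \<in> M" "1 < \<alpha>" "\<alpha> \<le> 2"
  obtains F where "frac_rep (\<alpha> - 1) F (rtr (adj W * geo_mean \<alpha> D C * W))"
    "\<And>s L. s > 0 \<Longrightarrow> L \<in> M \<Longrightarrow> mean_form s D C W L \<le> F s"
    "\<And>s. s > 0 \<Longrightarrow> \<exists>L\<in>M. mean_form s D C W L = F s"
proof -
  obtain V e where V: "V \<in> M" "\<forall>i. 0 \<le> e i" "D = V * adj V" "C = V * dg e * adj V"
    "\<And>\<alpha>. geo_mean \<alpha> D C = V * dg (\<lambda>i. e i powr \<alpha>) * adj V"
    "\<And>s W. s > 0 \<Longrightarrow> W \<in> M \<Longrightarrow> \<exists>L\<in>M. adj V * L = dg (\<lambda>i. e i / (e i + s)) * (adj V * W)"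
    by (rule geo_mean_congruence[OF assms(1)]) blast
  have tr: "mat_trace (adj L * (V * dg f * adj V) * K) =
      (\<Sum>i<n. \<Sum>j<n. of_real (f i) * (cnj ((adj V * L) $$ (i, j)) * (adj V * K) $$ (i, j)))"
    if "L \<in> M" "K \<in> M" for L K f
  proof -
    have "adj L * (V * dg f * adj V) * K = adj (adj V * L) * (dg f * (adj V * K))"
      using that V(1) by (simp add: madj massoc)
    then show ?thesis using that V(1)
      by (simp add: tr_adj_mult dg_mult_index mult.left_commute)
  qed
  have one: "V * adj V = V * dg (\<lambda>_. 1) * adj V" using V(1) by simp
  define F where "F s = (\<Sum>i<n. \<Sum>j<n. (e i * (cmod ((adj V * W) $$ (i, j)))\<^sup>2) * (e i / (e i + s)))" for s
  have form: "mean_form s D C W L = (\<Sum>i<n. \<Sum>j<n.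
      2 * e i * Re (cnj ((adj V * L) $$ (i, j)) * (adj V * W) $$ (i, j)) - (e i + s) * (cmod ((adj V * L) $$ (i, j)))\<^sup>2)"
    if L: "L \<in> M" for s L
  proof -
    have sq: "Re (of_real c * (cnj x * x)) = c * (cmod x)\<^sup>2" for x :: complex and c :: real
      by (simp add: cmod_def power2_eq_square algebra_simps)
    have re: "Re (of_real c * z) = c * Re z" for c z by simp
    have comb: "2 * (\<Sum>i<n. \<Sum>j<n. e i * g i j) - (\<Sum>i<n. \<Sum>j<n. e i * h i j) - s * (\<Sum>i<n. \<Sum>j<n. 1 * h i j) =
      (\<Sum>i<n. \<Sum>j<n. 2 * e i * g i j - (e i + s) * h i j)" for g h :: "nat \<Rightarrow> nat \<Rightarrow> real"
      by (simp add: sum_distrib_left sum_subtractf sum.distrib algebra_simps)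
    show ?thesis
      unfolding mean_form_def V(3,4) one tr[OF L assms(2)] tr[OF L L] Re_sum sq
      unfolding re by (rule comb)
  qed
  show ?thesis
  proof (rule that[of F])
    have "rtr (adj W * geo_mean \<alpha> D C * W) =
        (\<Sum>i<n. \<Sum>j<n. (e i * (cmod ((adj V * W) $$ (i, j)))\<^sup>2) * e i powr (\<alpha> - 1))"
      unfolding V(5) tr[OF assms(2,2)] Re_sum
    proof (intro sum.cong refl)
      fix i j
      have "e i powr \<alpha> = e i * e i powr (\<alpha> - 1)" using V(2) powr_add[of "e i" 1 "\<alpha> - 1"] by simp
      then show "Re (of_real (e i powr \<alpha>) * (cnj ((adj V * W) $$ (i, j)) * (adj V * W) $$ (i, j))) =
        e i * (cmod ((adj V * W) $$ (i, j)))\<^sup>2 * e i powr (\<alpha> - 1)"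
        by (simp add: cmod_def power2_eq_square algebra_simps)
    qed
    moreover have "frac_rep (\<alpha> - 1) F (\<Sum>i<n. \<Sum>j<n. (e i * (cmod ((adj V * W) $$ (i, j)))\<^sup>2) * e i powr (\<alpha> - 1))"
      unfolding F_def using assms V(2) by (intro frac_rep_double_sum) auto
    ultimately show "frac_rep (\<alpha> - 1) F (rtr (adj W * geo_mean \<alpha> D C * W))" by simp
    fix s :: real assume s: "s > 0"
    show "mean_form s D C W L \<le> F s" if "L \<in> M" for L
      unfolding form[OF that] F_def using V(2) s by (intro sum_mono complete_square) auto
    obtain L where L: "L \<in> M" "adj V * L = dg (\<lambda>i. e i / (e i + s)) * (adj V * W)"
      using V(6)[OF s assms(2)] by auto
    have "mean_form s D C W L = F s"
      unfolding form[OF L(1)] F_def L(2)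
      using V(1,2) s assms(2) dg_mult_index(1)[of "adj V * W" _ _ "\<lambda>i. e i / (e i + s)"]
      by (intro sum.cong refl complete_square_eq) (auto simp del: of_real_divide of_real_add)
    then show "\<exists>L\<in>M. mean_form s D C W L = F s" using L(1) by blast
  qed
qed

text \<open>\<open>D\<close> enters the form with the coefficient \<open>- s\<close>, so it suffices
  that it dominates the combination of \<open>D1\<close> and \<open>D2\<close>. This freedom lets
  \<open>D\<close> be the \<open>p\<close>-th power of a convex combination.\<close>

lemma geo_mean_jointly_convex:
  assumes dom: "dom D1 C1" "dom D2 C2" "dom D (convex_comb t C1 C2)"
    and D: "\<And>L. L \<in> M \<Longrightarrow> t * rtr (adj L * D1 * L) + (1 - t) * rtr (adj L * D2 * L) \<le> rtr (adj L * D * L)"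
    and t: "t \<in> {0..1}" and \<alpha>: "1 < \<alpha>" "\<alpha> \<le> 2" and W: "W \<in> M"
  shows "rtr (adj W * geo_mean \<alpha> D (convex_comb t C1 C2) * W) \<le>
    t * rtr (adj W * geo_mean \<alpha> D1 C1 * W) + (1 - t) * rtr (adj W * geo_mean \<alpha> D2 C2 * W)"
proof -
  let ?C = "convex_comb t C1 C2"
  have c: "C1 \<in> M" "C2 \<in> M" using dom psdD by (auto simp: dom_def)
  obtain F where F: "frac_rep (\<alpha> - 1) F (rtr (adj W * geo_mean \<alpha> D ?C * W))"
    "\<And>s. s > 0 \<Longrightarrow> \<exists>L\<in>M. mean_form s D ?C W L = F s"
    by (rule geo_mean_variational[OF dom(3) W \<alpha>]) blast
  obtain F1 where F1: "frac_rep (\<alpha> - 1) F1 (rtr (adj W * geo_mean \<alpha> D1 C1 * W))"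
    "\<And>s L. s > 0 \<Longrightarrow> L \<in> M \<Longrightarrow> mean_form s D1 C1 W L \<le> F1 s"
    by (rule geo_mean_variational[OF dom(1) W \<alpha>]) blast
  obtain F2 where F2: "frac_rep (\<alpha> - 1) F2 (rtr (adj W * geo_mean \<alpha> D2 C2 * W))"
    "\<And>s L. s > 0 \<Longrightarrow> L \<in> M \<Longrightarrow> mean_form s D2 C2 W L \<le> F2 s"
    by (rule geo_mean_variational[OF dom(2) W \<alpha>]) blast
  show ?thesis
  proof (rule frac_rep_mono[OF _ _ F(1) frac_rep_convex[OF F1(1) F2(1)]])
    fix s :: real assume s: "s > 0"
    \<comment> \<open>A maximiser for the combined pair is a competitor for each of the two
      pairs.\<close>
    obtain L where L: "L \<in> M" "mean_form s D ?C W L = F s" using F(2)[OF s] by auto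
    have "s * (t * rtr (adj L * D1 * L) + (1 - t) * rtr (adj L * D2 * L)) \<le> s * rtr (adj L * D * L)"
      using D[OF L(1)] s by simp
    then have "F s \<le> t * mean_form s D1 C1 W L + (1 - t) * mean_form s D2 C2 W L"
      unfolding L(2)[symmetric] mean_form_def using c W L(1) rtr_convex_comb[of C1 C2 "adj L" W t] rtr_convex_comb[of C1 C2 "adj L" L t]
      by (simp add: algebra_simps)
    also have "\<dots> \<le> t * F1 s + (1 - t) * F2 s"
      using t F1(2)[OF s L(1)] F2(2)[OF s L(1)] by (intro add_mono mult_left_mono) auto
    finally show "F s \<le> t * F1 s + (1 - t) * F2 s" .
  qed (use \<alpha> in auto)
qed

lemma Tr_G_1_jointly_convex:
  assumes dom: "dom A1 B1" "dom A2 B2" and t: "t \<in> {0..1}" and \<alpha>: "1 < \<alpha>" "\<alpha> \<le> 2"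
  shows "Tr_G \<alpha> 1 (convex_comb t A1 A2) (convex_comb t B1 B2) \<le> t * Tr_G \<alpha> 1 A1 B1 + (1 - t) * Tr_G \<alpha> 1 A2 B2"
proof -
  have c: "A1 \<in> psd" "A2 \<in> psd" using dom by (auto simp: dom_def)
  have G: "Tr_G \<alpha> 1 A B = rtr (adj (1\<^sub>m n) * geo_mean \<alpha> A B * 1\<^sub>m n)" if "dom A B" for A B
  proof -
    have "A \<in> psd" "B \<in> psd" using that by (auto simp: dom_def)
    then show ?thesis using geo_mean_psd[of A B \<alpha>] psdD(1)[of "geo_mean \<alpha> A B"]
      by (simp add: Tr_G_def G_mean_def)
  qed
  show ?thesis
    unfolding G[OF dom(1)] G[OF dom(2)] G[OF dom_convex_comb[OF dom t]]
    using rtr_convex_comb[OF c[THEN psdD(1)] adj_carrier]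
    by (intro geo_mean_jointly_convex dom dom_convex_comb t \<alpha>) auto
qed

end

section \<open>Lieb concavity and Ando convexity\<close>

text \<open>For \<open>y > 0\<close> the coefficient on the left is
  \<open>a * y / (a + s * y)\<close>, the parallel sum of \<open>a / s\<close> and \<open>y\<close>.
  After multiplication by \<open>s * (a + s * y)\<close> the gap is, up to the triangle inequality,
  the square of \<open>a * cmod u - s * y * cmod v\<close>.\<close>

lemma parallel_sum_le:
  assumes "0 \<le> a" "0 \<le> y" "0 < s"
  shows "y * (cmod (u + v))\<^sup>2 * (a / y / (a / y + s)) \<le> 1 / s * (a * (cmod u)\<^sup>2) + y * (cmod v)\<^sup>2"
proof (cases "y = 0")
  case False
  then have y: "y > 0" using assms by simp
  have pos: "s * (a + s * y) > 0" using assms y by (simp add: add_nonneg_pos)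
  have "(cmod (u + v))\<^sup>2 \<le> (cmod u + cmod v)\<^sup>2"
    by (intro power_mono norm_triangle_ineq) auto
  then have "s * a * y * (cmod (u + v))\<^sup>2 \<le> s * a * y * (cmod u + cmod v)\<^sup>2"
    using assms by (intro mult_left_mono) auto
  also have "\<dots> = (a * (cmod u)\<^sup>2 + s * y * (cmod v)\<^sup>2) * (a + s * y) - (a * cmod u - s * y * cmod v)\<^sup>2"
    by (simp add: power2_eq_square algebra_simps)
  also have "\<dots> \<le> (a * (cmod u)\<^sup>2 + s * y * (cmod v)\<^sup>2) * (a + s * y)" by simp
  also have "\<dots> = s * (a + s * y) * (1 / s * (a * (cmod u)\<^sup>2) + y * (cmod v)\<^sup>2)"
    using assms by (simp add: field_simps)
  also have "s * a * y * (cmod (u + v))\<^sup>2 = s * (a + s * y) * (y * (cmod (u + v))\<^sup>2 * (a / y / (a / y + s)))"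
  proof -
    have "a / y / (a / y + s) = a / (a + s * y)" using y by (simp add: field_simps)
    moreover have "a + s * y \<noteq> 0"
    proof
      assume "a + s * y = 0"
      with pos show False by simp
    qed
    then have "(a + s * y) * (a / (a + s * y)) = a" by simp
    moreover have "s * D * (y * N * r) = s * (D * r) * y * N" for D N r :: real by simp
    ultimately show ?thesis by (simp only:)
  qed
  finally show ?thesis using pos by (simp only: mult_le_cancel_left_pos)
qed (use assms in auto)

lemma parallel_sum_eq:
  assumes "0 \<le> a" "0 \<le> y" "0 < s" "k = s * y / (a + s * y)"
  shows "1 / s * (a * (cmod (of_real k * w))\<^sup>2) + y * (cmod (of_real (1 - k) * w))\<^sup>2 =
    y * (cmod w)\<^sup>2 * (a / y / (a / y + s))"
proof (cases "y = 0")
  case False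
  then have y: "y > 0" using assms by simp
  have pos: "a + s * y > 0" using assms y by (simp add: add_nonneg_pos)
  have k: "1 - k = a / (a + s * y)" using pos assms(4) by (simp add: field_simps)
  have q: "a / y / (a / y + s) = 1 - k" using y unfolding k by (simp add: field_simps)
  have a: "a * k = s * y * (1 - k)" unfolding k unfolding assms(4) by simp
  have "1 / s * (a * (cmod (of_real k * w))\<^sup>2) + y * (cmod (of_real (1 - k) * w))\<^sup>2 =
      ((a * k) * k / s + y * (1 - k) * (1 - k)) * (cmod w)\<^sup>2"
    unfolding norm_mult norm_of_real power_mult_distrib power2_abs by (simp add: power2_eq_square algebra_simps)
  also have "a * k * k / s = y * (1 - k) * k" unfolding a using assms(3) by simp
  also have "(y * (1 - k) * k + y * (1 - k) * (1 - k)) * (cmod w)\<^sup>2 = y * (1 - k) * (cmod w)\<^sup>2"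
    by (simp add: algebra_simps)
  finally show ?thesis unfolding q by simp
qed (use assms in simp)

context cmat
begin

text \<open>Since \<open>a^p y^(1-p) = y (a/y)^p\<close>, each \<open>s\<close> contributes parallel
  sums of eigenvalues, which are minima over splittings of the entries of \<open>K\<close> in the
  two eigenbases. For a fixed splitting the bound is linear in \<open>(A, Y)\<close>, which is the
  source of joint concavity.\<close>

lemma lieb_variational:
  assumes psd: "A \<in> psd" "Y \<in> psd" and K: "K \<in> M" and p: "0 < p" "p < 1"
  obtains F where "frac_rep p F (rtr (adj K * mat_powr A p * K * mat_powr Y (1 - p)))"
    "\<And>s K1 K2. s > 0 \<Longrightarrow> K1 \<in> M \<Longrightarrow> K2 \<in> M \<Longrightarrow> K = K1 + K2 \<Longrightarrow>
      F s \<le> 1 / s * rtr (adj K1 * A * K1) + rtr (K2 * Y * adj K2)"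
    "\<And>s. s > 0 \<Longrightarrow> \<exists>K1\<in>M. \<exists>K2\<in>M. K = K1 + K2 \<and>
      F s = 1 / s * rtr (adj K1 * A * K1) + rtr (K2 * Y * adj K2)"
proof -
  obtain U a where U: "spec U a A" "\<forall>i. 0 \<le> a i" by (rule psd_spectral[OF psd(1)])
  obtain V y where V: "spec V y Y" "\<forall>i. 0 \<le> y i" by (rule psd_spectral[OF psd(2)])
  note u = unitaryD[OF specD(1)[OF U(1)]] and v = unitaryD[OF specD(1)[OF V(1)]]
  define W where "W = adj U * K * V"
  have W: "W \<in> M" using u v K by (simp add: W_def)
  define F where "F s = (\<Sum>i<n. \<Sum>j<n. (y j * (cmod (W $$ (i, j)))\<^sup>2) * (a i / y j / (a i / y j + s)))" for s
  have form: "1 / s * rtr (adj K1 * A * K1) + rtr (K2 * Y * adj K2) = (\<Sum>i<n. \<Sum>j<n.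
      1 / s * (a i * (cmod ((adj U * K1 * V) $$ (i, j)))\<^sup>2) + y j * (cmod ((adj U * K2 * V) $$ (i, j)))\<^sup>2)"
    if "K1 \<in> M" "K2 \<in> M" for s K1 K2
    unfolding rtr_left_spec[OF U(1) specD(1)[OF V(1)] that(1)] rtr_right_spec[OF V(1) specD(1)[OF U(1)] that(2)]
    by (simp add: sum.distrib sum_distrib_left)
  show ?thesis
  proof (rule that[of F])
    have "rtr (adj K * mat_powr A p * K * mat_powr Y (1 - p)) =
        (\<Sum>i<n. \<Sum>j<n. a i powr p * y j powr (1 - p) * (cmod (W $$ (i, j)))\<^sup>2)"
      unfolding W_def by (rule rtr_two_spec[OF spec_mat_powr[OF U] spec_mat_powr[OF V] K])
    also have "\<dots> = (\<Sum>i<n. \<Sum>j<n. (y j * (cmod (W $$ (i, j)))\<^sup>2) * (a i / y j) powr p)"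
    proof (intro sum.cong refl)
      fix i j
      have "y j powr (1 - p) = y j / y j powr p" using V(2) p powr_diff[of "y j" 1 p] by auto
      then show "a i powr p * y j powr (1 - p) * (cmod (W $$ (i, j)))\<^sup>2 =
          y j * (cmod (W $$ (i, j)))\<^sup>2 * (a i / y j) powr p"
        using U(2) V(2) by (simp add: powr_divide)
    qed
    finally show "frac_rep p F (rtr (adj K * mat_powr A p * K * mat_powr Y (1 - p)))"
      unfolding F_def using p U(2) V(2) by (simp only:) (intro frac_rep_double_sum, auto)
    fix s :: real assume s: "s > 0"
    show "F s \<le> 1 / s * rtr (adj K1 * A * K1) + rtr (K2 * Y * adj K2)"
      if K12: "K1 \<in> M" "K2 \<in> M" "K = K1 + K2" for K1 K2
    proof -
      have "W = adj U * K1 * V + adj U * K2 * V" unfolding W_def K12(3) using K12 u v by (simp add: mdistrib)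
      then have "W $$ (i, j) = (adj U * K1 * V) $$ (i, j) + (adj U * K2 * V) $$ (i, j)" if "i < n" "j < n" for i j
        using that K12 u v by simp
      then show ?thesis unfolding form[OF K12(1,2)] F_def
        using U(2) V(2) s parallel_sum_le by (intro sum_mono) auto
    qed
    \<comment> \<open>The optimal splitting of an entry into \<open>u + v\<close> balances
      \<open>a i * u = s * y j * v\<close>; a zero denominator gives
      \<open>k i j = 0\<close>.\<close>
    define k where "k i j = s * y j / (a i + s * y j)" for i j
    define X where "X = Matrix.mat n n (\<lambda>(i, j). of_real (k i j) * W $$ (i, j))"
    have X: "X \<in> M" by (simp add: X_def)
    define K1 where "K1 = U * X * adj V"
    have K1: "K1 \<in> M" "adj U * K1 * V = X" using X u v by (auto simp: K1_def massoc)
    define K2 where "K2 = K - K1"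
    have K2: "K2 \<in> M" "adj U * K2 * V = W - X" using K K1 u v by (auto simp: K2_def W_def mdistrib)
    have "K = K1 + K2" unfolding K2_def using K K1 by (intro eq_matI) auto
    moreover have "1 / s * rtr (adj K1 * A * K1) + rtr (K2 * Y * adj K2) = F s"
      unfolding form[OF K1(1) K2(1)] K1(2) K2(2) F_def
    proof (intro sum.cong refl)
      fix i j assume "i \<in> {..<n}" "j \<in> {..<n}"
      then have "X $$ (i, j) = of_real (k i j) * W $$ (i, j)" "(W - X) $$ (i, j) = of_real (1 - k i j) * W $$ (i, j)"
        using W by (auto simp: X_def algebra_simps)
      then show "1 / s * (a i * (cmod (X $$ (i, j)))\<^sup>2) + y j * (cmod ((W - X) $$ (i, j)))\<^sup>2 =
          y j * (cmod (W $$ (i, j)))\<^sup>2 * (a i / y j / (a i / y j + s))"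
        using parallel_sum_eq[of "a i" "y j" s "k i j" "W $$ (i, j)"] U(2) V(2) s by (simp only: k_def)
    qed
    ultimately show "\<exists>K1\<in>M. \<exists>K2\<in>M. K = K1 + K2 \<and>
        F s = 1 / s * rtr (adj K1 * A * K1) + rtr (K2 * Y * adj K2)"
      using K1 K2 by metis
  qed
qed

lemma lieb_concave:
  assumes psd: "A1 \<in> psd" "A2 \<in> psd" "Y1 \<in> psd" "Y2 \<in> psd" and K: "K \<in> M" and p: "0 < p" "p < 1" and t: "t \<in> {0..1}"
  shows "t * rtr (adj K * mat_powr A1 p * K * mat_powr Y1 (1 - p)) +
      (1 - t) * rtr (adj K * mat_powr A2 p * K * mat_powr Y2 (1 - p)) \<le>
    rtr (adj K * mat_powr (convex_comb t A1 A2) p * K * mat_powr (convex_comb t Y1 Y2) (1 - p))"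
proof -
  let ?A = "convex_comb t A1 A2" and ?Y = "convex_comb t Y1 Y2"
  note c = psd[THEN psdD(1)]
  have psd': "?A \<in> psd" "?Y \<in> psd" using psd t convex_comb_psd by auto
  obtain F where F: "frac_rep p F (rtr (adj K * mat_powr ?A p * K * mat_powr ?Y (1 - p)))"
    "\<And>s. s > 0 \<Longrightarrow> \<exists>K1\<in>M. \<exists>K2\<in>M. K = K1 + K2 \<and>
      F s = 1 / s * rtr (adj K1 * ?A * K1) + rtr (K2 * ?Y * adj K2)"
    by (rule lieb_variational[OF psd' K p]) blast
  obtain F1 where F1: "frac_rep p F1 (rtr (adj K * mat_powr A1 p * K * mat_powr Y1 (1 - p)))"
    "\<And>s K1 K2. s > 0 \<Longrightarrow> K1 \<in> M \<Longrightarrow> K2 \<in> M \<Longrightarrow> K = K1 + K2 \<Longrightarrow>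
      F1 s \<le> 1 / s * rtr (adj K1 * A1 * K1) + rtr (K2 * Y1 * adj K2)"
    by (rule lieb_variational[OF psd(1,3) K p]) blast
  obtain F2 where F2: "frac_rep p F2 (rtr (adj K * mat_powr A2 p * K * mat_powr Y2 (1 - p)))"
    "\<And>s K1 K2. s > 0 \<Longrightarrow> K1 \<in> M \<Longrightarrow> K2 \<in> M \<Longrightarrow> K = K1 + K2 \<Longrightarrow>
      F2 s \<le> 1 / s * rtr (adj K1 * A2 * K1) + rtr (K2 * Y2 * adj K2)"
    by (rule lieb_variational[OF psd(2,4) K p]) blast
  show ?thesis
  proof (rule frac_rep_mono[OF _ _ frac_rep_convex[OF F1(1) F2(1)] F(1)])
    fix s :: real assume s: "s > 0"
    \<comment> \<open>An optimal splitting for the combination is admissible for both pairs.\<close>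
    obtain K1 K2 where k: "K1 \<in> M" "K2 \<in> M" "K = K1 + K2"
      and eq: "F s = 1 / s * rtr (adj K1 * ?A * K1) + rtr (K2 * ?Y * adj K2)" using F(2)[OF s] by blast
    have "t * F1 s + (1 - t) * F2 s \<le> t * (1 / s * rtr (adj K1 * A1 * K1) + rtr (K2 * Y1 * adj K2)) +
        (1 - t) * (1 / s * rtr (adj K1 * A2 * K1) + rtr (K2 * Y2 * adj K2))"
      using t F1(2)[OF s k] F2(2)[OF s k] by (intro add_mono mult_left_mono) auto
    also have "\<dots> = F s"
      unfolding eq rtr_convex_comb[OF c(1,2) adj_carrier[OF k(1)] k(1)] rtr_convex_comb[OF c(3,4) k(2) adj_carrier[OF k(2)]]
      by (simp add: algebra_simps add_divide_distrib diff_divide_distrib)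
    finally show "t * F1 s + (1 - t) * F2 s \<le> F s" .
  qed (use p in auto)
qed

lemma one_psd: "1\<^sub>m n \<in> psd"
  using gram_psd[of "1\<^sub>m n"] by simp

lemma mat_powr_one_mat [simp]: "mat_powr (1\<^sub>m n) r = 1\<^sub>m n"
  using mat_powr_spec[OF spec_one[OF unitary_one], of r] by simp

text \<open>Lieb's concavity with both \<open>Y1\<close> and \<open>Y2\<close> the identity; the
  exponent 1, excluded there, is the linear case.\<close>

lemma mat_powr_concave:
  assumes psd: "A1 \<in> psd" "A2 \<in> psd" and L: "L \<in> M" and p: "0 < p" "p \<le> 1" and t: "t \<in> {0..1}"
  shows "t * rtr (adj L * mat_powr A1 p * L) + (1 - t) * rtr (adj L * mat_powr A2 p * L) \<le>
    rtr (adj L * mat_powr (convex_comb t A1 A2) p * L)"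
proof (cases "p = 1")
  case True
  then show ?thesis using psd L psdD rtr_convex_comb[of A1 A2 "adj L" L t] t convex_comb_psd[of A1 A2 t] by simp
next
  case False
  then show ?thesis using lieb_concave[OF psd one_psd one_psd L p(1) _ t] p psd L convex_comb_psd[OF psd t] by simp
qed

lemma Tr_G_convex_fst:
  assumes dom: "dom A1 B" "dom A2 B" and t: "t \<in> {0..1}" and \<alpha>: "1 < \<alpha>" "\<alpha> \<le> 2" and p: "0 < p" "p \<le> 1"
  shows "Tr_G \<alpha> p (convex_comb t A1 A2) B \<le> t * Tr_G \<alpha> p A1 B + (1 - t) * Tr_G \<alpha> p A2 B"
proof -
  have c: "A1 \<in> psd" "A2 \<in> psd" "B \<in> psd" using dom by (auto simp: dom_def)
  have A: "convex_comb t A1 A2 \<in> psd" using c t convex_comb_psd by auto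
  have dom': "dom (convex_comb t A1 A2) B"
    using dom_convex_comb[OF dom t] c psdD(1) by simp
  \<comment> \<open>The fixed second argument is written as a convex combination of itself with
    itself; concavity of the power supplies the domination required of the first argument.\<close>
  have "rtr (adj W * geo_mean \<alpha> (mat_powr (convex_comb t A1 A2) p) (convex_comb t (mat_powr B p) (mat_powr B p)) * W) \<le>
    t * rtr (adj W * geo_mean \<alpha> (mat_powr A1 p) (mat_powr B p) * W) +
    (1 - t) * rtr (adj W * geo_mean \<alpha> (mat_powr A2 p) (mat_powr B p) * W)" if "W \<in> M" for W
    using dom_mat_powr[OF dom(1) p(1)] dom_mat_powr[OF dom(2) p(1)] dom_mat_powr[OF dom' p(1)] c t \<alpha> p that
    by (intro geo_mean_jointly_convex mat_powr_concave) auto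
  then show ?thesis
    unfolding Tr_G_def G_mean_def using c A p t
    by (intro rtr_mat_powr_mono_convex geo_mean_psd mat_powr_psd) auto
qed

text \<open>Positive definiteness as an instance of \<open>dom\<close>, so that
  \<open>dom_convex_comb\<close> yields the convexity of this set at once.\<close>

abbreviation pd :: "complex mat \<Rightarrow> bool" where "pd Y \<equiv> dom Y (1\<^sub>m n)"

lemma pd_psd: "pd Y \<Longrightarrow> Y \<in> psd"
  by (simp add: dom_def)

lemma pd_spec_pos:
  assumes "pd Y" "spec V y Y" "\<forall>i. 0 \<le> y i" "j < n"
  shows "y j > 0"
proof -
  note v = unitaryD[OF specD(1)[OF assms(2)]]
  have "mat_powr Y 0 = 1\<^sub>m n" using assms(1) mone(1)[of "mat_powr Y 0"] by (auto simp: dom_def)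
  then have "adj V * (V * dg (\<lambda>i. y i powr 0) * adj V) * V = 1\<^sub>m n"
    using mat_powr_spec[OF assms(2,3), of 0] v by simp
  then have "dg (\<lambda>i. y i powr 0) $$ (j, j) = (1\<^sub>m n) $$ (j, j)" using v by (simp add: massoc)
  then have "y j powr 0 = 1" using assms(4) by (simp add: mat_diag_def split: if_splits)
  then show ?thesis using assms(3) by (metis less_eq_real_def powr_zero_eq_one zero_neq_one powr_0)
qed

text \<open>Here \<open>a^q y^(1-q) = a (a/y)^(q-1)\<close>, and each \<open>s\<close> contributes a
  supremum of expressions linear in \<open>(A, Y)\<close>. At an eigenvalue \<open>y = 0\<close> the
  convention would give the power the value 0, below the supremum in general; hence \<open>Y\<close>
  is positive definite.\<close>

lemma ando_variational:
  assumes A: "A \<in> psd" and Y: "pd Y" and K: "K \<in> M" and q: "1 < q" "q \<le> 2"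
  obtains F where "frac_rep (q - 1) F (rtr (adj K * mat_powr A q * K * mat_powr Y (1 - q)))"
    "\<And>s L. s > 0 \<Longrightarrow> L \<in> M \<Longrightarrow>
      2 * rtr (adj L * A * K) - rtr (adj L * A * L) - s * rtr (L * Y * adj L) \<le> F s"
    "\<And>s. s > 0 \<Longrightarrow> \<exists>L\<in>M.
      2 * rtr (adj L * A * K) - rtr (adj L * A * L) - s * rtr (L * Y * adj L) = F s"
proof -
  obtain U a where U: "spec U a A" "\<forall>i. 0 \<le> a i" by (rule psd_spectral[OF A])
  obtain V y where V: "spec V y Y" "\<forall>i. 0 \<le> y i" by (rule psd_spectral[OF pd_psd[OF Y]])
  note y = pd_spec_pos[OF Y V]
  note u = unitaryD[OF specD(1)[OF U(1)]] and v = unitaryD[OF specD(1)[OF V(1)]]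
  define W where "W = adj U * K * V"
  have W: "W \<in> M" using u v K by (simp add: W_def)
  define F where "F s = (\<Sum>i<n. \<Sum>j<n. (a i * (cmod (W $$ (i, j)))\<^sup>2) * (a i / y j / (a i / y j + s)))" for s
  have F': "F s = (\<Sum>i<n. \<Sum>j<n. (a i * (cmod (W $$ (i, j)))\<^sup>2) * (a i / (a i + s * y j)))" for s
    unfolding F_def
  proof (intro sum.cong refl)
    fix i j assume "j \<in> {..<n}"
    then have "a i / y j / (a i / y j + s) = a i / (a i + s * y j)" using y[of j] by (simp add: field_simps)
    then show "a i * (cmod (W $$ (i, j)))\<^sup>2 * (a i / y j / (a i / y j + s)) =
      a i * (cmod (W $$ (i, j)))\<^sup>2 * (a i / (a i + s * y j))" by simp
  qed
  have form: "2 * rtr (adj L * A * K) - rtr (adj L * A * L) - s * rtr (L * Y * adj L) = (\<Sum>i<n. \<Sum>j<n.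
      2 * a i * Re (cnj ((adj U * L * V) $$ (i, j)) * W $$ (i, j)) - (a i + s * y j) * (cmod ((adj U * L * V) $$ (i, j)))\<^sup>2)"
    if L: "L \<in> M" for s L
  proof -
    have re: "Re (of_real c * z) = c * Re z" for c z by simp
    have "mat_trace (adj L * A * K) = mat_trace (adj L * A * K * 1\<^sub>m n)" using A L K psdD by simp
    also have "\<dots> = (\<Sum>i<n. \<Sum>j<n. of_real (a i * 1) * (cnj ((adj U * L * V) $$ (i, j)) * W $$ (i, j)))"
      unfolding W_def by (rule tr_two_spec[OF U(1) spec_one[OF specD(1)[OF V(1)]] L K])
    finally have 1: "rtr (adj L * A * K) = (\<Sum>i<n. \<Sum>j<n. a i * Re (cnj ((adj U * L * V) $$ (i, j)) * W $$ (i, j)))"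
      unfolding mult_1_right by (simp only: Re_sum re)
    have comb: "2 * (\<Sum>i<n. \<Sum>j<n. a i * g i j) - (\<Sum>i<n. \<Sum>j<n. a i * h i j) - s * (\<Sum>i<n. \<Sum>j<n. y j * h i j) =
      (\<Sum>i<n. \<Sum>j<n. 2 * a i * g i j - (a i + s * y j) * h i j)" for g h :: "nat \<Rightarrow> nat \<Rightarrow> real"
      by (simp add: sum_distrib_left sum_subtractf sum.distrib algebra_simps)
    show ?thesis
      unfolding 1 rtr_left_spec[OF U(1) specD(1)[OF V(1)] L] rtr_right_spec[OF V(1) specD(1)[OF U(1)] L]
      by (rule comb)
  qed
  show ?thesis
  proof (rule that[of F])
    have "rtr (adj K * mat_powr A q * K * mat_powr Y (1 - q)) =
        (\<Sum>i<n. \<Sum>j<n. a i powr q * y j powr (1 - q) * (cmod (W $$ (i, j)))\<^sup>2)"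
      unfolding W_def by (rule rtr_two_spec[OF spec_mat_powr[OF U] spec_mat_powr[OF V] K])
    also have "\<dots> = (\<Sum>i<n. \<Sum>j<n. (a i * (cmod (W $$ (i, j)))\<^sup>2) * (a i / y j) powr (q - 1))"
    proof (intro sum.cong refl)
      fix i j assume "j \<in> {..<n}"
      then have "y j powr (1 - q) = 1 / y j powr (q - 1)" using y[of j] powr_minus_divide[of "y j" "q - 1"] by simp
      moreover have "a i powr q = a i * a i powr (q - 1)" using U(2) q powr_add[of "a i" 1 "q - 1"] by simp
      ultimately show "a i powr q * y j powr (1 - q) * (cmod (W $$ (i, j)))\<^sup>2 =
          a i * (cmod (W $$ (i, j)))\<^sup>2 * (a i / y j) powr (q - 1)"
        using U(2) V(2) by (simp add: powr_divide)
    qed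
    finally show "frac_rep (q - 1) F (rtr (adj K * mat_powr A q * K * mat_powr Y (1 - q)))"
      unfolding F_def using q U(2) V(2) by (simp only:) (intro frac_rep_double_sum, auto)
    fix s :: real assume s: "s > 0"
    show "2 * rtr (adj L * A * K) - rtr (adj L * A * L) - s * rtr (L * Y * adj L) \<le> F s" if "L \<in> M" for L
      unfolding form[OF that] F' using U(2) y s by (intro sum_mono complete_square) auto
    define X where "X = Matrix.mat n n (\<lambda>(i, j). of_real (a i / (a i + s * y j)) * W $$ (i, j))"
    have X: "X \<in> M" by (simp add: X_def)
    define L where "L = U * X * adj V"
    have L: "L \<in> M" "adj U * L * V = X" using X u v by (auto simp: L_def massoc)
    have "2 * rtr (adj L * A * K) - rtr (adj L * A * L) - s * rtr (L * Y * adj L) = F s"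
      unfolding form[OF L(1)] F' L(2) using U(2) y s
      by (intro sum.cong refl complete_square_eq) (auto simp: X_def)
    then show "\<exists>L\<in>M. 2 * rtr (adj L * A * K) - rtr (adj L * A * L) - s * rtr (L * Y * adj L) = F s"
      using L(1) by blast
  qed
qed

lemma pd_convex_comb: "pd Y1 \<Longrightarrow> pd Y2 \<Longrightarrow> t \<in> {0..1} \<Longrightarrow> pd (convex_comb t Y1 Y2)"
  using dom_convex_comb[of Y1 "1\<^sub>m n" Y2 "1\<^sub>m n" t] by simp

lemma ando_convex:
  assumes psd: "A1 \<in> psd" "A2 \<in> psd" and pd: "pd Y1" "pd Y2" and K: "K \<in> M" and q: "1 < q" "q \<le> 2" and t: "t \<in> {0..1}"
  shows "rtr (adj K * mat_powr (convex_comb t A1 A2) q * K * mat_powr (convex_comb t Y1 Y2) (1 - q)) \<le>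
    t * rtr (adj K * mat_powr A1 q * K * mat_powr Y1 (1 - q)) +
    (1 - t) * rtr (adj K * mat_powr A2 q * K * mat_powr Y2 (1 - q))"
proof -
  let ?A = "convex_comb t A1 A2" and ?Y = "convex_comb t Y1 Y2"
  note c = psd[THEN psdD(1)] pd[THEN pd_psd, THEN psdD(1)]
  obtain F where F: "frac_rep (q - 1) F (rtr (adj K * mat_powr ?A q * K * mat_powr ?Y (1 - q)))"
    "\<And>s. s > 0 \<Longrightarrow> \<exists>L\<in>M. 2 * rtr (adj L * ?A * K) - rtr (adj L * ?A * L) - s * rtr (L * ?Y * adj L) = F s"
    by (rule ando_variational[OF convex_comb_psd[OF psd t] pd_convex_comb[OF pd t] K q]) blast
  obtain F1 where F1: "frac_rep (q - 1) F1 (rtr (adj K * mat_powr A1 q * K * mat_powr Y1 (1 - q)))"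
    "\<And>s L. s > 0 \<Longrightarrow> L \<in> M \<Longrightarrow> 2 * rtr (adj L * A1 * K) - rtr (adj L * A1 * L) - s * rtr (L * Y1 * adj L) \<le> F1 s"
    by (rule ando_variational[OF psd(1) pd(1) K q]) blast
  obtain F2 where F2: "frac_rep (q - 1) F2 (rtr (adj K * mat_powr A2 q * K * mat_powr Y2 (1 - q)))"
    "\<And>s L. s > 0 \<Longrightarrow> L \<in> M \<Longrightarrow> 2 * rtr (adj L * A2 * K) - rtr (adj L * A2 * L) - s * rtr (L * Y2 * adj L) \<le> F2 s"
    by (rule ando_variational[OF psd(2) pd(2) K q]) blast
  show ?thesis
  proof (rule frac_rep_mono[OF _ _ F(1) frac_rep_convex[OF F1(1) F2(1)]])
    fix s :: real assume s: "s > 0"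
    obtain L where L: "L \<in> M" and
      eq: "2 * rtr (adj L * ?A * K) - rtr (adj L * ?A * L) - s * rtr (L * ?Y * adj L) = F s" using F(2)[OF s] by blast
    have "F s = t * (2 * rtr (adj L * A1 * K) - rtr (adj L * A1 * L) - s * rtr (L * Y1 * adj L)) +
        (1 - t) * (2 * rtr (adj L * A2 * K) - rtr (adj L * A2 * L) - s * rtr (L * Y2 * adj L))"
      unfolding eq[symmetric] rtr_convex_comb[OF c(1,2) adj_carrier[OF L] K]
        rtr_convex_comb[OF c(1,2) adj_carrier[OF L] L] rtr_convex_comb[OF c(3,4) L adj_carrier[OF L]]
      by (simp add: algebra_simps)
    also have "\<dots> \<le> t * F1 s + (1 - t) * F2 s"
      using t F1(2)[OF s L] F2(2)[OF s L] by (intro add_mono mult_left_mono) auto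
    finally show "F s \<le> t * F1 s + (1 - t) * F2 s" .
  qed (use q in auto)
qed

section \<open>The Epstein and Carlen--Lieb functionals\<close>

text \<open>The squared moduli of the entries form a doubly stochastic matrix, so a scalar
  inequality between eigenvalues of two matrices sums up to a trace inequality.\<close>

lemma unitary_double_sum:
  assumes "unitary_mat n W"
  shows "(\<Sum>i<n. \<Sum>j<n. (f i + g j) * (cmod (W $$ (i, j)))\<^sup>2) = (\<Sum>i<n. f i) + (\<Sum>j<n. g j)"
proof -
  have "(\<Sum>i<n. \<Sum>j<n. (f i + g j) * (cmod (W $$ (i, j)))\<^sup>2) =
      (\<Sum>i<n. f i * (\<Sum>j<n. (cmod (W $$ (i, j)))\<^sup>2)) + (\<Sum>i<n. \<Sum>j<n. g j * (cmod (W $$ (i, j)))\<^sup>2)"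
    by (simp add: sum.distrib sum_distrib_left algebra_simps)
  also have "(\<Sum>i<n. \<Sum>j<n. g j * (cmod (W $$ (i, j)))\<^sup>2) = (\<Sum>j<n. g j * (\<Sum>i<n. (cmod (W $$ (i, j)))\<^sup>2))"
    by (subst sum.swap) (simp add: sum_distrib_left)
  finally show ?thesis using unitary_rows[OF assms] unitary_cols[OF assms] by simp
qed

lemma young_trace:
  assumes psd: "N \<in> psd" "Y \<in> psd" and p: "0 < p" "p < 1"
  shows "rtr (N * mat_powr Y (1 - p)) \<le> p * rtr (mat_powr N (1 / p)) + (1 - p) * rtr Y"
proof -
  obtain U a where U: "spec U a N" "\<forall>i. 0 \<le> a i" by (rule psd_spectral[OF psd(1)])
  obtain V y where V: "spec V y Y" "\<forall>i. 0 \<le> y i" by (rule psd_spectral[OF psd(2)])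
  let ?W = "adj U * 1\<^sub>m n * V"
  have W: "unitary_mat n ?W"
    using unitary_mat_mult[OF unitary_adj[OF specD(1)[OF U(1)]] specD(1)[OF V(1)]] specD(2)[OF U(1)] by simp
  have "rtr (N * mat_powr Y (1 - p)) = rtr (adj (1\<^sub>m n) * N * 1\<^sub>m n * mat_powr Y (1 - p))"
    using psd psdD by simp
  also have "\<dots> = (\<Sum>i<n. \<Sum>j<n. a i * y j powr (1 - p) * (cmod (?W $$ (i, j)))\<^sup>2)"
    by (rule rtr_two_spec[OF U(1) spec_mat_powr[OF V]]) simp
  also have "\<dots> \<le> (\<Sum>i<n. \<Sum>j<n. (p * a i powr (1 / p) + (1 - p) * y j) * (cmod (?W $$ (i, j)))\<^sup>2)"
  proof (intro sum_mono mult_right_mono)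
    fix i j
    have "a i = (a i powr (1 / p)) powr p" using U(2) p by (simp add: powr_powr)
    then show "a i * y j powr (1 - p) \<le> p * a i powr (1 / p) + (1 - p) * y j"
      using young_powr[of "a i powr (1 / p)" "y j" p] V(2) p by simp
  qed auto
  also have "\<dots> = p * rtr (mat_powr N (1 / p)) + (1 - p) * rtr Y"
    unfolding unitary_double_sum[OF W] rtr_mat_powr[OF U] rtr_spec[OF V(1)] by (simp add: sum_distrib_left)
  finally show ?thesis .
qed

text \<open>\<open>p Tr N^(1/p)\<close> is the maximum over \<open>Y\<close> of
  \<open>Tr N Y^(1-p) - (1-p) Tr Y\<close>. By Lieb this objective is jointly concave in
  \<open>(A, Y)\<close>, and maximising out one variable keeps concavity.\<close>

lemma epstein_concave:
  assumes psd: "A1 \<in> psd" "A2 \<in> psd" and Z: "Z \<in> M" and p: "0 < p" "p \<le> 1" and t: "t \<in> {0..1}"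
  shows "t * rtr (mat_powr (adj Z * mat_powr A1 p * Z) (1 / p)) + (1 - t) * rtr (mat_powr (adj Z * mat_powr A2 p * Z) (1 / p))
    \<le> rtr (mat_powr (adj Z * mat_powr (convex_comb t A1 A2) p * Z) (1 / p))"
proof -
  define N where "N A = adj Z * mat_powr A p * Z" for A
  have N: "N A \<in> psd" if "A \<in> psd" for A unfolding N_def using psd_congr[OF mat_powr_psd[OF that] Z] .
  let ?A = "convex_comb t A1 A2"
  have A: "?A \<in> psd" using convex_comb_psd[OF psd t] .
  show ?thesis
  proof (cases "p = 1")
    case True
    then show ?thesis
      using psd A Z N psdD rtr_convex_comb[of A1 A2 "adj Z" Z t] unfolding N_def by simp
  next
    case False
    then have p1: "p < 1" using p by simp
    define Y where "Y A = mat_powr (N A) (1 / p)" for A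
    have Y: "Y A \<in> psd" if "A \<in> psd" for A unfolding Y_def using N[OF that] mat_powr_psd by blast
    \<comment> \<open>Young's inequality is an equality at \<open>Y = N^(1/p)\<close>.\<close>
    have E: "p * rtr (Y A) = rtr (N A * mat_powr (Y A) (1 - p)) - (1 - p) * rtr (Y A)" if "A \<in> psd" for A
    proof -
      have "N A * mat_powr (Y A) (1 - p) = mat_powr (N A) 1 * mat_powr (N A) (1 / p * (1 - p))"
        using N[OF that] by (simp add: Y_def mat_powr_powr)
      also have "\<dots> = mat_powr (N A) (1 + 1 / p * (1 - p))" by (rule mat_powr_mult[OF N[OF that]])
      also have "1 + 1 / p * (1 - p) = 1 / p" using p by (simp add: field_simps)
      also have "mat_powr (N A) (1 / p) = Y A" by (simp add: Y_def)
      finally show ?thesis by (simp add: algebra_simps)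
    qed
    let ?Y = "convex_comb t (Y A1) (Y A2)"
    have Y': "?Y \<in> psd" using convex_comb_psd[OF Y[OF psd(1)] Y[OF psd(2)] t] .
    have trY: "rtr ?Y = t * rtr (Y A1) + (1 - t) * rtr (Y A2)"
      using rtr_convex_comb[of "Y A1" "Y A2" "1\<^sub>m n" "1\<^sub>m n" t] Y psd psdD by simp
    have "p * (t * rtr (Y A1) + (1 - t) * rtr (Y A2)) = t * (p * rtr (Y A1)) + (1 - t) * (p * rtr (Y A2))"
      by (simp add: algebra_simps)
    also have "\<dots> = (t * rtr (N A1 * mat_powr (Y A1) (1 - p)) + (1 - t) * rtr (N A2 * mat_powr (Y A2) (1 - p))) - (1 - p) * rtr ?Y"
      unfolding E[OF psd(1)] E[OF psd(2)] trY by (simp add: algebra_simps)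
    also have "\<dots> \<le> rtr (N ?A * mat_powr ?Y (1 - p)) - (1 - p) * rtr ?Y"
      using lieb_concave[OF psd Y[OF psd(1)] Y[OF psd(2)] Z p(1) p1 t] by (simp add: N_def)
    also have "\<dots> \<le> p * rtr (Y ?A)"
      using young_trace[OF N[OF A] Y' p(1) p1] by (simp add: Y_def)
    finally show ?thesis using p(1) unfolding Y_def N_def by simp
  qed
qed

text \<open>Scalar Young after writing \<open>a^(1/q) = (a y^(1-q))^(1/q) y^(1-1/q)\<close>, which
  needs \<open>y > 0\<close>. It bounds the trace from above, as the convex functional requires an
  infimum over \<open>Y\<close>.\<close>

lemma reverse_young_trace:
  assumes N: "N \<in> psd" and Y: "pd Y" and q: "1 \<le> q"
  shows "rtr (mat_powr N (1 / q)) \<le> 1 / q * rtr (N * mat_powr Y (1 - q)) + (1 - 1 / q) * rtr Y"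
proof -
  obtain U a where U: "spec U a N" "\<forall>i. 0 \<le> a i" by (rule psd_spectral[OF N])
  obtain V y where V: "spec V y Y" "\<forall>i. 0 \<le> y i" by (rule psd_spectral[OF pd_psd[OF Y]])
  let ?W = "adj U * 1\<^sub>m n * V"
  have W: "unitary_mat n ?W"
    using unitary_mat_mult[OF unitary_adj[OF specD(1)[OF U(1)]] specD(1)[OF V(1)]] specD(2)[OF U(1)] by simp
  have "rtr (mat_powr N (1 / q)) + 0 = (\<Sum>i<n. \<Sum>j<n. (a i powr (1 / q) + 0) * (cmod (?W $$ (i, j)))\<^sup>2)"
    unfolding unitary_double_sum[OF W] rtr_mat_powr[OF U] by simp
  also have "\<dots> \<le> (\<Sum>i<n. \<Sum>j<n. (1 / q * (a i * y j powr (1 - q)) + (1 - 1 / q) * y j) * (cmod (?W $$ (i, j)))\<^sup>2)"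
  proof (intro sum_mono mult_right_mono)
    fix i j assume "j \<in> {..<n}"
    then have y: "y j > 0" using pd_spec_pos[OF Y V] by simp
    have "(y j powr (1 - q)) powr (1 / q) * y j powr (1 - 1 / q) = y j powr ((1 - q) * (1 / q) + (1 - 1 / q))"
      by (simp add: powr_powr powr_add)
    also have "(1 - q) * (1 / q) + (1 - 1 / q) = 0" using q by (simp add: field_simps)
    finally have e: "(y j powr (1 - q)) powr (1 / q) * y j powr (1 - 1 / q) = 1" using y by simp
    have "a i powr (1 / q) = (a i * y j powr (1 - q)) powr (1 / q) * y j powr (1 - 1 / q)"
      using e U(2) by (simp add: powr_mult mult.assoc)
    also have "\<dots> \<le> 1 / q * (a i * y j powr (1 - q)) + (1 - 1 / q) * y j"
      using U(2) y q by (intro young_powr) auto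
    finally show "a i powr (1 / q) + 0 \<le> 1 / q * (a i * y j powr (1 - q)) + (1 - 1 / q) * y j" by simp
  qed auto
  also have "\<dots> = 1 / q * (\<Sum>i<n. \<Sum>j<n. a i * y j powr (1 - q) * (cmod (?W $$ (i, j)))\<^sup>2) +
      (\<Sum>i<n. \<Sum>j<n. (0 + (1 - 1 / q) * y j) * (cmod (?W $$ (i, j)))\<^sup>2)"
    unfolding sum_distrib_left sum.distrib[symmetric] by (intro sum.cong refl) (simp only: algebra_simps add_0)
  also have "(\<Sum>i<n. \<Sum>j<n. a i * y j powr (1 - q) * (cmod (?W $$ (i, j)))\<^sup>2) =
      rtr (adj (1\<^sub>m n) * N * 1\<^sub>m n * mat_powr Y (1 - q))"
    by (rule rtr_two_spec[OF U(1) spec_mat_powr[OF V], symmetric]) simp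
  also have "\<dots> = rtr (N * mat_powr Y (1 - q))" using N psdD by simp
  also have "(\<Sum>i<n. \<Sum>j<n. (0 + (1 - 1 / q) * y j) * (cmod (?W $$ (i, j)))\<^sup>2) = (1 - 1 / q) * rtr Y"
    unfolding unitary_double_sum[OF W] rtr_spec[OF V(1)] by (simp add: sum_distrib_left)
  finally show ?thesis by simp
qed

text \<open>The natural minimiser \<open>N^(1/q)\<close> may be singular. Shifting its eigenvalues
  by \<epsilon> makes it positive definite, does not raise \<open>Tr N Y^(1-q)\<close> and costs
  \<open>n * \<epsilon>\<close> in \<open>Tr Y\<close>.\<close>

lemma reverse_young_near_optimal:
  assumes N: "N \<in> psd" and q: "1 \<le> q" and \<epsilon>: "\<epsilon> > 0"
  obtains Y where "pd Y" "rtr (N * mat_powr Y (1 - q)) \<le> rtr (mat_powr N (1 / q))"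
    "rtr Y = rtr (mat_powr N (1 / q)) + real n * \<epsilon>"
proof -
  obtain U a where U: "spec U a N" "\<forall>i. 0 \<le> a i" by (rule psd_spectral[OF N])
  note u = specD(5)[OF U(1)] unitaryD[OF specD(1)[OF U(1)]]
  define y where "y i = a i powr (1 / q) + \<epsilon>" for i
  have y: "y i > 0" for i using \<epsilon> by (simp add: y_def add_nonneg_pos)
  define Y where "Y = U * dg y * adj U"
  have Y: "spec U y Y" "\<forall>i. 0 \<le> y i"
    unfolding Y_def using spec_change[OF specD(1)[OF U(1)]] y by (auto intro: less_imp_le)
  have y': "y i \<noteq> 0" for i using y[of i] by simp
  show ?thesis
  proof (rule that)
    have "mat_powr Y 0 = U * dg (\<lambda>i. 1) * adj U"
      unfolding mat_powr_spec[OF Y] using y' by simp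
    then show "pd Y" using spec_psd[OF Y(1)] Y(2) one_psd u by (simp add: dom_def)
    have "N * mat_powr Y (1 - q) = U * (dg a * dg (\<lambda>i. y i powr (1 - q))) * adj U"
      unfolding mat_powr_spec[OF Y] using u by (subst u(1)) (simp add: massoc del: mat_diag_diag dg_mult)
    then have "spec U (\<lambda>i. a i * y i powr (1 - q)) (N * mat_powr Y (1 - q))"
      using spec_change[OF specD(1)[OF U(1)], of "\<lambda>i. a i * y i powr (1 - q)"] by simp
    then have "rtr (N * mat_powr Y (1 - q)) = (\<Sum>i<n. a i * y i powr (1 - q))" by (rule rtr_spec)
    also have "\<dots> \<le> (\<Sum>i<n. a i powr (1 / q))"
    proof (rule sum_mono)
      fix i
      show "a i * y i powr (1 - q) \<le> a i powr (1 / q)"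
      proof (cases "a i = 0")
        case False
        then have a: "a i > 0" using U(2) by (metis less_eq_real_def)
        have "a i * y i powr (1 - q) \<le> a i * (a i powr (1 / q)) powr (1 - q)"
          using a q \<epsilon> by (intro mult_left_mono powr_mono2') (auto simp: y_def)
        also have "\<dots> = a i powr (1 + 1 / q * (1 - q))" using a by (simp add: powr_powr powr_add)
        also have "1 + 1 / q * (1 - q) = 1 / q" using q by (simp add: field_simps)
        finally show ?thesis .
      qed simp
    qed
    also have "\<dots> = rtr (mat_powr N (1 / q))" using rtr_mat_powr[OF U] by simp
    finally show "rtr (N * mat_powr Y (1 - q)) \<le> rtr (mat_powr N (1 / q))" .
    show "rtr Y = rtr (mat_powr N (1 / q)) + real n * \<epsilon>"
      unfolding rtr_spec[OF Y(1)] rtr_mat_powr[OF U] y_def by (simp add: sum.distrib)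
  qed
qed

lemma carlen_lieb_convex:
  assumes psd: "B1 \<in> psd" "B2 \<in> psd" and Z: "Z \<in> M" and q: "1 \<le> q" "q \<le> 2" and t: "t \<in> {0..1}"
  shows "rtr (mat_powr (adj Z * mat_powr (convex_comb t B1 B2) q * Z) (1 / q)) \<le>
    t * rtr (mat_powr (adj Z * mat_powr B1 q * Z) (1 / q)) + (1 - t) * rtr (mat_powr (adj Z * mat_powr B2 q * Z) (1 / q))"
proof -
  define N where "N B = adj Z * mat_powr B q * Z" for B
  have N: "N B \<in> psd" if "B \<in> psd" for B unfolding N_def using psd_congr[OF mat_powr_psd[OF that] Z] .
  let ?B = "convex_comb t B1 B2"
  have B: "?B \<in> psd" using convex_comb_psd[OF psd t] .
  show ?thesis
  proof (cases "q = 1")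
    case True
    then show ?thesis
      using psd B Z N psdD rtr_convex_comb[of B1 B2 "adj Z" Z t] unfolding N_def by simp
  next
    case False
    then have q1: "1 < q" using q by simp
    define E where "E B = rtr (mat_powr (N B) (1 / q))" for B
    have "E ?B \<le> t * E B1 + (1 - t) * E B2"
    proof (rule field_le_epsilon)
      fix e :: real assume e: "e > 0"
      \<comment> \<open>The total cost \<open>n * \<epsilon>\<close> stays below \<open>e\<close>;
        the added 1 covers the size 0.\<close>
      define \<epsilon> where "\<epsilon> = e / (real n + 1)"
      have \<epsilon>: "\<epsilon> > 0" "real n * \<epsilon> \<le> e" using e by (auto simp: \<epsilon>_def divide_simps)
      obtain Y1 where Y1: "pd Y1" "rtr (N B1 * mat_powr Y1 (1 - q)) \<le> E B1" "rtr Y1 = E B1 + real n * \<epsilon>"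
        by (rule reverse_young_near_optimal[OF N[OF psd(1)] q(1) \<epsilon>(1)]) (auto simp: E_def)
      obtain Y2 where Y2: "pd Y2" "rtr (N B2 * mat_powr Y2 (1 - q)) \<le> E B2" "rtr Y2 = E B2 + real n * \<epsilon>"
        by (rule reverse_young_near_optimal[OF N[OF psd(2)] q(1) \<epsilon>(1)]) (auto simp: E_def)
      let ?Y = "convex_comb t Y1 Y2"
      have trY: "rtr ?Y = t * rtr Y1 + (1 - t) * rtr Y2"
        using rtr_convex_comb[of Y1 Y2 "1\<^sub>m n" "1\<^sub>m n" t] psdD(1)[OF pd_psd[OF Y1(1)]] psdD(1)[OF pd_psd[OF Y2(1)]] by simp
      have "rtr (N ?B * mat_powr ?Y (1 - q)) \<le> t * rtr (N B1 * mat_powr Y1 (1 - q)) + (1 - t) * rtr (N B2 * mat_powr Y2 (1 - q))"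
        unfolding N_def by (rule ando_convex[OF psd Y1(1) Y2(1) Z q1 q(2) t])
      also have "\<dots> \<le> t * E B1 + (1 - t) * E B2"
        using t Y1(2) Y2(2) by (intro add_mono mult_left_mono) auto
      finally have 1: "rtr (N ?B * mat_powr ?Y (1 - q)) \<le> t * E B1 + (1 - t) * E B2" .
      have "E ?B \<le> 1 / q * rtr (N ?B * mat_powr ?Y (1 - q)) + (1 - 1 / q) * rtr ?Y"
        unfolding E_def by (rule reverse_young_trace[OF N[OF B] pd_convex_comb[OF Y1(1) Y2(1) t] q(1)])
      also have "\<dots> \<le> 1 / q * (t * E B1 + (1 - t) * E B2) + (1 - 1 / q) * (t * E B1 + (1 - t) * E B2 + real n * \<epsilon>)"
      proof (intro add_mono mult_left_mono 1)
        show "rtr ?Y \<le> t * E B1 + (1 - t) * E B2 + real n * \<epsilon>"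
          unfolding trY Y1(3) Y2(3) by (simp add: algebra_simps)
      qed (use q1 in auto)
      also have "\<dots> = t * E B1 + (1 - t) * E B2 + (1 - 1 / q) * (real n * \<epsilon>)" by (simp add: algebra_simps)
      also have "(1 - 1 / q) * (real n * \<epsilon>) \<le> 1 * (real n * \<epsilon>)" using q1 \<epsilon>(1) by (intro mult_right_mono) auto
      also have "\<dots> \<le> e" using \<epsilon>(2) by simp
      finally show "E ?B \<le> t * E B1 + (1 - t) * E B2 + e" by simp
    qed
    then show ?thesis by (simp add: E_def N_def)
  qed
qed

section \<open>Joint convexity for \<open>\<alpha> = 2\<close>\<close>

text \<open>Cauchy--Schwarz for Schatten norms, read off in a singular value decomposition of \<open>X Y\<close>.\<close>

lemma schatten_cauchy_schwarz:
  assumes XY: "X \<in> M" "Y \<in> M" and \<sigma>: "\<sigma> \<ge> 1"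
  shows "2 * rtr (mat_powr (adj (X * Y) * (X * Y)) (\<sigma> / 2)) \<le>
    rtr (mat_powr (X * adj X) \<sigma>) + rtr (mat_powr (adj Y * Y) \<sigma>)"
proof -
  define H where "H = adj (X * Y) * (X * Y)"
  have H: "H \<in> psd" unfolding H_def using XY by (intro gram_psd) simp
  obtain G h where G: "spec G h H" "\<forall>i. 0 \<le> h i" by (rule psd_spectral[OF H])
  note g = unitaryD[OF specD(1)[OF G(1)]]
  \<comment> \<open>Division by zero gives \<open>m i = 0\<close>, so column \<open>i\<close> of
    \<open>F\<close> is the left singular vector for \<open>sqrt (h i)\<close>, or 0 if that
    singular value vanishes.\<close>
  define m where "m i = 1 / sqrt (h i)" for i
  define F where "F = X * Y * G * dg m"
  have F: "F \<in> M" using XY g by (simp add: F_def)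
  have QQ: "adj (X * Y * G) * (X * Y * G) = dg h"
  proof -
    have "adj (X * Y * G) * (X * Y * G) = adj G * (H * G)" unfolding H_def using XY g by (simp add: madj massoc)
    also have "\<dots> = dg h" using g by (subst specD(5)[OF G(1)]) (simp add: massoc)
    finally show ?thesis .
  qed
  have FF: "adj F * F = dg (\<lambda>i. if h i = 0 then 0 else 1)"
  proof -
    have "adj F * F = dg m * (adj (X * Y * G) * (X * Y * G)) * dg m"
      unfolding F_def using XY g by (simp add: madj massoc)
    also have "\<dots> = dg (\<lambda>i. m i * h i * m i)" unfolding QQ by simp
    also have "\<dots> = dg (\<lambda>i. if h i = 0 then 0 else 1)"
    proof (rule dg_cong)
      fix i
      have "sqrt (h i) * sqrt (h i) = h i" using G(2) by simp
      then show "m i * h i * m i = (if h i = 0 then 0 else 1)" by (simp add: m_def)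
    qed
    finally show ?thesis .
  qed
  define P where "P = adj X * F"
  define R where "R = Y * G"
  have PR: "P \<in> M" "R \<in> M" using XY F g by (auto simp: P_def R_def)
  have "adj P * R = dg m * (adj (X * Y * G) * (X * Y * G))"
    unfolding P_def R_def F_def using XY g by (simp add: madj massoc)
  then have PR_diag: "adj P * R = dg (\<lambda>i. m i * h i)" unfolding QQ by simp
  \<comment> \<open>\<open>\<alpha> i\<close> and \<open>\<beta> i\<close> are the quadratic forms
    of \<open>X * adj X\<close> and \<open>adj Y * Y\<close> at the left and right singular vectors;
    the inner product of the corresponding columns of \<open>P\<close> and \<open>R\<close> is the
    singular value.\<close>
  define \<alpha> where "\<alpha> i = (\<Sum>k<n. (cmod (P $$ (k, i)))\<^sup>2)" for i
  define \<beta> where "\<beta> i = (\<Sum>k<n. (cmod (R $$ (k, i)))\<^sup>2)" for i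
  have nn: "\<alpha> i \<ge> 0" "\<beta> i \<ge> 0" for i by (auto simp: \<alpha>_def \<beta>_def sum_nonneg)
  have le: "h i \<le> \<alpha> i * \<beta> i" if i: "i < n" for i
  proof -
    have mh: "m i * h i = sqrt (h i)" using G(2) by (simp add: m_def real_div_sqrt)
    have "(adj P * R) $$ (i, i) = of_real (m i * h i)" unfolding PR_diag using i by (simp add: mat_diag_def)
    then have "of_real (sqrt (h i)) = (\<Sum>k<n. cnj (P $$ (k, i)) * R $$ (k, i))"
      using PR i mh by (simp add: mult_index)
    then have "sqrt (h i) = cmod (\<Sum>k<n. cnj (P $$ (k, i)) * R $$ (k, i))"
      using G(2) by (metis abs_of_nonneg norm_of_real real_sqrt_ge_zero)
    also have "\<dots> \<le> (\<Sum>k<n. cmod (P $$ (k, i)) * cmod (R $$ (k, i)))"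
      by (rule order_trans[OF norm_sum]) (simp add: norm_mult)
    finally have "sqrt (h i) \<le> (\<Sum>k<n. cmod (P $$ (k, i)) * cmod (R $$ (k, i)))" .
    then have "(sqrt (h i))\<^sup>2 \<le> (\<Sum>k<n. cmod (P $$ (k, i)) * cmod (R $$ (k, i)))\<^sup>2"
      using G(2) by (intro power_mono) auto
    also have "\<dots> \<le> \<alpha> i * \<beta> i" unfolding \<alpha>_def \<beta>_def by (rule Cauchy_Schwarz_ineq_sum)
    finally show ?thesis using G(2) by simp
  qed
  have h: "2 * h i powr (\<sigma> / 2) \<le> \<alpha> i powr \<sigma> + \<beta> i powr \<sigma>" if i: "i < n" for i
  proof -
    have "h i powr (\<sigma> / 2) \<le> (\<alpha> i * \<beta> i) powr (\<sigma> / 2)"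
      using le[OF i] G(2) \<sigma> by (intro powr_mono2) auto
    also have "\<dots> = (\<alpha> i powr \<sigma>) powr (1/2) * (\<beta> i powr \<sigma>) powr (1 - 1/2)"
      using nn by (simp add: powr_mult powr_powr)
    also have "\<dots> \<le> 1/2 * \<alpha> i powr \<sigma> + (1 - 1/2) * \<beta> i powr \<sigma>" by (intro young_powr) auto
    finally show ?thesis by simp
  qed
  have unit: "rtr (adj (T * unit_diag i) * (adj S * S) * (T * unit_diag i)) = (\<Sum>k<n. (cmod ((S * T) $$ (k, i)))\<^sup>2)"
    if "S \<in> M" "T \<in> M" "i < n" for S T i
  proof -
    have "adj (T * unit_diag i) * (adj S * S) * (T * unit_diag i) = adj (S * T * unit_diag i) * 1\<^sub>m n * (S * T * unit_diag i)"
      using that by (simp add: madj massoc)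
    also have "rtr \<dots> = (\<Sum>k<n. 1 * (cmod ((adj (1\<^sub>m n) * (S * T)) $$ (k, i)))\<^sup>2)"
      using that by (intro rtr_unit_diag spec_one unitary_one) auto
    finally show ?thesis using that by simp
  qed
  have "2 * rtr (mat_powr H (\<sigma> / 2)) = (\<Sum>i<n. 2 * h i powr (\<sigma> / 2))"
    unfolding rtr_mat_powr[OF G] by (simp add: sum_distrib_left)
  also have "\<dots> \<le> (\<Sum>i<n. \<alpha> i powr \<sigma> + \<beta> i powr \<sigma>)" using h by (intro sum_mono) simp
  also have "\<dots> = (\<Sum>i<n. \<alpha> i powr \<sigma>) + (\<Sum>i<n. \<beta> i powr \<sigma>)" by (rule sum.distrib)
  also have "(\<Sum>i<n. \<alpha> i powr \<sigma>) = (\<Sum>i<n. rtr (adj (F * unit_diag i) * (X * adj X) * (F * unit_diag i)) powr \<sigma>)"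
    using unit[of "adj X" F] XY F by (intro sum.cong refl) (simp add: \<alpha>_def P_def)
  also have "\<dots> \<le> rtr (mat_powr (X * adj X) \<sigma>)"
    using gram_psd[of "adj X"] XY F FF \<sigma>
    by (intro peierls[where c = "\<lambda>i. if h i = 0 then 0 else 1"]) (auto split: if_splits)
  also have "(\<Sum>i<n. \<beta> i powr \<sigma>) = (\<Sum>i<n. rtr (adj (G * unit_diag i) * (adj Y * Y) * (G * unit_diag i)) powr \<sigma>)"
    using unit[of Y G] XY g by (intro sum.cong refl) (simp add: \<beta>_def R_def)
  also have "\<dots> \<le> rtr (mat_powr (adj Y * Y) \<sigma>)"
    using gram_psd[of Y] XY g(1) unitary_isometry[OF specD(1)[OF G(1)]] \<sigma>
    by (intro peierls[where c = "\<lambda>_. 1"]) auto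
  finally show ?thesis unfolding H_def by simp
qed

lemma Tr_G_2:
  assumes "dom A B" "p > 0"
  shows "Tr_G 2 p A B = rtr (mat_powr (mat_powr B p * mat_powr A (- p) * mat_powr B p) (1 / p))"
proof -
  have c: "A \<in> psd" "B \<in> psd" using assms by (auto simp: dom_def)
  have "mat_powr B (p/2) * mat_powr A (- p) * mat_powr B (p/2) \<in> psd"
    using psd_congr[OF mat_powr_psd[OF c(1)], of "mat_powr B (p/2)"] c by simp
  then show ?thesis unfolding Tr_G_flip[OF assms] using c
    by (simp add: massoc mat_powr_mult mat_powr_mult_left)
qed

text \<open>Zhang's variational formula: for fixed \<open>Z\<close> the left-hand side is jointly convex, and
  \<open>Z = A\<^sup>-\<^sup>p B\<^sup>p\<close> gives equality.\<close>

lemma Tr_G_2_ge: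
  assumes dom: "dom A B" and Z: "Z \<in> M" and p: "0 < p" "p \<le> 1"
  shows "2 * rtr (mat_powr (adj Z * mat_powr B (2 * p) * Z) (1 / (2 * p))) - rtr (mat_powr (adj Z * mat_powr A p * Z) (1 / p))
    \<le> Tr_G 2 p A B"
proof -
  have c: "A \<in> psd" "B \<in> psd" using dom by (auto simp: dom_def)
  have BA: "mat_powr B p * mat_powr A 0 = mat_powr B p"
    using dom_mat_powr[OF dom p(1)] c by (simp add: dom_def mat_powr_powr)
  define X where "X = mat_powr B p * mat_powr A (- p / 2)"
  define Y where "Y = mat_powr A (p / 2) * Z"
  have XY: "X \<in> M" "Y \<in> M" using c Z by (auto simp: X_def Y_def)
  \<comment> \<open>The middle powers of \<open>A\<close> leave its support projection, which
    \<open>mat_powr B p\<close> absorbs.\<close>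
  have "X * Y = mat_powr B p * mat_powr A 0 * Z" unfolding X_def Y_def using c Z by (simp add: massoc mat_powr_mult_left)
  then have "X * Y = mat_powr B p * Z" unfolding BA .
  then have 1: "adj (X * Y) * (X * Y) = adj Z * mat_powr B (2 * p) * Z"
    using c Z by (simp add: madj massoc mat_powr_mult_left)
  have 2: "X * adj X = mat_powr B p * mat_powr A (- p) * mat_powr B p"
    unfolding X_def using c by (simp add: madj massoc mat_powr_mult_left)
  have 3: "adj Y * Y = adj Z * mat_powr A p * Z"
    unfolding Y_def using c Z by (simp add: madj massoc mat_powr_mult_left)
  show ?thesis
    using schatten_cauchy_schwarz[OF XY, of "1 / p"] p unfolding 1 2 3 Tr_G_2[OF dom p(1)] by (simp add: mult.commute)
qed

lemma Tr_G_2_attained: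
  assumes dom: "dom A B" and p: "0 < p"
  obtains Z where "Z \<in> M" "Tr_G 2 p A B =
    2 * rtr (mat_powr (adj Z * mat_powr B (2 * p) * Z) (1 / (2 * p))) - rtr (mat_powr (adj Z * mat_powr A p * Z) (1 / p))"
proof
  have c: "A \<in> psd" "B \<in> psd" using dom by (auto simp: dom_def)
  define Z where "Z = mat_powr A (- p) * mat_powr B p"
  define S where "S = mat_powr B p * mat_powr A (- p) * mat_powr B p"
  have S: "S \<in> psd" unfolding S_def using psd_congr[OF mat_powr_psd[OF c(1)], of "mat_powr B p"] c by simp
  show "mat_powr A (- p) * mat_powr B p \<in> M" using c by simp
  have 1: "adj Z * mat_powr B (2 * p) * Z = mat_powr S 2"
  proof -
    have "mat_powr B (2 * p) = mat_powr B p * mat_powr B p" using c by (simp add: mat_powr_mult)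
    then have "adj Z * mat_powr B (2 * p) * Z = S * S" unfolding Z_def S_def using c by (simp add: madj massoc)
    also have "\<dots> = mat_powr S 1 * mat_powr S 1" using S by simp
    finally show ?thesis unfolding mat_powr_mult[OF S] by simp
  qed
  have 2: "adj Z * mat_powr A p * Z = S"
    unfolding Z_def S_def using c by (simp add: madj massoc mat_powr_mult_left)
  show "Tr_G 2 p A B = 2 * rtr (mat_powr (adj (mat_powr A (- p) * mat_powr B p) * mat_powr B (2 * p) * (mat_powr A (- p) * mat_powr B p)) (1 / (2 * p))) -
      rtr (mat_powr (adj (mat_powr A (- p) * mat_powr B p) * mat_powr A p * (mat_powr A (- p) * mat_powr B p)) (1 / p))"
    unfolding Z_def[symmetric] 1 2 Tr_G_2[OF dom p] S_def[symmetric] using S by (simp add: mat_powr_powr)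
qed

lemma Tr_G_2_jointly_convex:
  assumes dom: "dom A1 B1" "dom A2 B2" and t: "t \<in> {0..1}" and p: "1/2 \<le> p" "p \<le> 1"
  shows "Tr_G 2 p (convex_comb t A1 A2) (convex_comb t B1 B2) \<le> t * Tr_G 2 p A1 B1 + (1 - t) * Tr_G 2 p A2 B2"
proof -
  have c: "A1 \<in> psd" "A2 \<in> psd" "B1 \<in> psd" "B2 \<in> psd" using dom by (auto simp: dom_def)
  have p0: "0 < p" using p by simp
  define E where "E Z A = rtr (mat_powr (adj Z * mat_powr A p * Z) (1 / p))" for Z A
  define D where "D Z B = rtr (mat_powr (adj Z * mat_powr B (2 * p) * Z) (1 / (2 * p)))" for Z B
  obtain Z where Z: "Z \<in> M" and eq: "Tr_G 2 p (convex_comb t A1 A2) (convex_comb t B1 B2) =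
      2 * D Z (convex_comb t B1 B2) - E Z (convex_comb t A1 A2)"
    unfolding D_def E_def by (rule Tr_G_2_attained[OF dom_convex_comb[OF dom t] p0])
  have "D Z (convex_comb t B1 B2) \<le> t * D Z B1 + (1 - t) * D Z B2"
    unfolding D_def using p by (intro carlen_lieb_convex c Z t) auto
  moreover have "t * E Z A1 + (1 - t) * E Z A2 \<le> E Z (convex_comb t A1 A2)"
    unfolding E_def using p p0 by (intro epstein_concave c Z t) auto
  ultimately have "Tr_G 2 p (convex_comb t A1 A2) (convex_comb t B1 B2) \<le>
      t * (2 * D Z B1 - E Z A1) + (1 - t) * (2 * D Z B2 - E Z A2)"
    unfolding eq by (simp add: algebra_simps)
  also have "\<dots> \<le> t * Tr_G 2 p A1 B1 + (1 - t) * Tr_G 2 p A2 B2"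
    unfolding D_def E_def using t p p0 Z dom by (intro add_mono mult_left_mono Tr_G_2_ge) auto
  finally show ?thesis .
qed

section \<open>Consequences of joint convexity\<close>

lemma jointly_convexD:
  assumes "Tr_G_jointly_convex \<alpha> p" "n \<ge> 1" "dom A1 B1" "dom A2 B2" "t \<in> {0..1}"
  shows "Tr_G \<alpha> p (convex_comb t A1 A2) (convex_comb t B1 B2) \<le> t * Tr_G \<alpha> p A1 B1 + (1 - t) * Tr_G \<alpha> p A2 B2"
  using assms unfolding Tr_G_jointly_convex_def G_domain_iff[symmetric] by blast

lemma zero_psd: "0\<^sub>m n n \<in> psd"
  using gram_psd[of "0\<^sub>m n n"] by simp

lemma dom_zero: "A \<in> psd \<Longrightarrow> dom A (0\<^sub>m n n)"
  by (simp add: dom_def zero_psd)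

lemma one_smult [simp]: "1 \<cdot>\<^sub>m A = (A :: complex mat)"
  by (rule eq_matI) auto

lemma dom_smult:
  assumes "dom A B" "c > 0"
  shows "dom (complex_of_real c \<cdot>\<^sub>m A) (complex_of_real c \<cdot>\<^sub>m B)"
proof -
  have "A \<in> psd" "B \<in> psd" using assms by (auto simp: dom_def)
  then show ?thesis
    using assms psd_smult[of A c] psd_smult[of B c] psdD by (simp add: dom_def mat_powr_smult msmult)
qed

lemma mat_powr_zero_mat: "mat_powr (0\<^sub>m n n) r = 0\<^sub>m n n"
proof -
  have "spec (1\<^sub>m n) (\<lambda>_. 0) (0\<^sub>m n n)"
    using unitary_one by (auto simp: spectral_dec_def mat_diag_def intro!: eq_matI)
  then have "mat_powr (0\<^sub>m n n) r = 1\<^sub>m n * dg (\<lambda>_. 0 powr r) * adj (1\<^sub>m n)"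
    by (rule mat_powr_spec) simp
  also have "\<dots> = 0\<^sub>m n n" by (auto simp: mat_diag_def intro!: eq_matI)
  finally show ?thesis .
qed

lemma Tr_G_zero: "A \<in> psd \<Longrightarrow> p > 0 \<Longrightarrow> Tr_G \<alpha> p A (0\<^sub>m n n) = 0"
  unfolding Tr_G_flip[OF dom_zero] by (simp add: mat_powr_zero_mat)

text \<open>The inner sandwich is homogeneous of degree 0, so scaling reaches only the outer
  factors; they give \<open>c powr p\<close>, which the power \<open>1 / p\<close> turns into
  \<open>c\<close>.\<close>

lemma Tr_G_smult:
  assumes "dom A B" "c > 0" "p > 0"
  shows "Tr_G \<alpha> p (complex_of_real c \<cdot>\<^sub>m A) (complex_of_real c \<cdot>\<^sub>m B) = c * Tr_G \<alpha> p A B"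
proof -
  have AB: "A \<in> psd" "B \<in> psd" using assms by (auto simp: dom_def)
  let ?b = "mat_powr B (p / 2)" and ?a = "mat_powr A (- p)"
  define Y where "Y = mat_powr (?b * ?a * ?b) (\<alpha> - 1)"
  have Y: "Y \<in> psd"
    unfolding Y_def using psd_congr[OF mat_powr_psd[OF AB(1)], of ?b] AB by (intro mat_powr_psd) simp
  have Z: "?b * Y * ?b \<in> psd" using psd_congr[OF Y, of ?b] AB by simp
  have *: "(complex_of_real (c powr (p / 2)) \<cdot>\<^sub>m ?b) * (complex_of_real d \<cdot>\<^sub>m W) * (complex_of_real (c powr (p / 2)) \<cdot>\<^sub>m ?b) =
      complex_of_real (d * c powr p) \<cdot>\<^sub>m (?b * W * ?b)" if "W \<in> M" for d W
  proof -
    have "c powr (p / 2) * (c powr (p / 2)) = c powr p" by (simp flip: powr_add)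
    then have e: "c powr (p / 2) * (d * c powr (p / 2)) = d * c powr p" for d by (metis mult.left_commute)
    show ?thesis using that AB by (simp add: msmult msmult_smult e flip: of_real_mult)
  qed
  have 1: "(complex_of_real (c powr (p / 2)) \<cdot>\<^sub>m ?b) * (complex_of_real (c powr (- p)) \<cdot>\<^sub>m ?a) * (complex_of_real (c powr (p / 2)) \<cdot>\<^sub>m ?b)
      = ?b * ?a * ?b"
    using *[of ?a "c powr (- p)"] AB assms(2) by (simp flip: powr_add)
  have 2: "(complex_of_real (c powr (p / 2)) \<cdot>\<^sub>m ?b) * Y * (complex_of_real (c powr (p / 2)) \<cdot>\<^sub>m ?b) =
      complex_of_real (c powr p) \<cdot>\<^sub>m (?b * Y * ?b)"
    using *[of Y 1] psdD(1)[OF Y] by simp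
  show ?thesis
    unfolding Tr_G_flip[OF assms(1,3)] Tr_G_flip[OF dom_smult[OF assms(1,2)] assms(3)]
    using AB assms Z
    by (simp add: mat_powr_smult 1 2 Y_def[symmetric] powr_powr tr_smult mat_powr_psd)
qed

text \<open>Joint convexity and homogeneity give subadditivity; adding the pair \<open>(X, 0)\<close>, on which
  the functional vanishes, shows that it decreases in the first argument.\<close>

lemma Tr_G_antimono_fst:
  assumes jc: "Tr_G_jointly_convex \<alpha> p" and n: "n \<ge> 1" and dom: "dom A B" and X: "X \<in> psd" and p: "p > 0"
  shows "Tr_G \<alpha> p (A + X) B \<le> Tr_G \<alpha> p A B"
proof -
  have c: "A \<in> M" "B \<in> M" "X \<in> M" using dom X psdD by (auto simp: dom_def)
  have 1: "convex_comb (1 / 2) (complex_of_real 2 \<cdot>\<^sub>m A) (complex_of_real 2 \<cdot>\<^sub>m X) = A + X"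
    and 2: "convex_comb (1 / 2) (complex_of_real 2 \<cdot>\<^sub>m B) (0\<^sub>m n n) = B"
    using c unfolding convex_comb_def by (auto intro!: eq_matI)
  have "complex_of_real 2 \<cdot>\<^sub>m X \<in> psd" using psd_smult[OF X, of 2] by simp
  then show ?thesis
    using jointly_convexD[OF jc n dom_smult[OF dom, of 2] dom_zero, of "complex_of_real 2 \<cdot>\<^sub>m X" "1 / 2"]
      Tr_G_smult[OF dom _ p, of 2] Tr_G_zero[OF _ p]
    unfolding 1 2 by simp
qed

text \<open>No eigenvalue exceeds the trace \<open>T\<close>, so
  \<open>z^\<sigma> <= z * T^(\<sigma> - 1)\<close>. This removes the outer power
  \<open>1 / p\<close> from an upper bound for \<open>Tr_G\<close>.\<close>

lemma rtr_mat_powr_le: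
  assumes Z: "Z \<in> psd" and \<sigma>: "\<sigma> \<ge> 1"
  shows "rtr (mat_powr Z \<sigma>) \<le> rtr Z powr \<sigma>"
proof -
  obtain U z where U: "spec U z Z" "\<forall>i. 0 \<le> z i" by (rule psd_spectral[OF Z])
  define T where "T = (\<Sum>i<n. z i)"
  have T: "T \<ge> 0" unfolding T_def using U(2) by (simp add: sum_nonneg)
  have split: "x powr \<sigma> = x * x powr (\<sigma> - 1)" if "x \<ge> 0" for x :: real
    using that \<sigma> powr_add[of x 1 "\<sigma> - 1"] by simp
  have "(\<Sum>i<n. z i powr \<sigma>) \<le> (\<Sum>i<n. z i * T powr (\<sigma> - 1))"
  proof (rule sum_mono)
    fix i assume "i \<in> {..<n}"
    then have "z i \<le> T" unfolding T_def using U(2) by (intro member_le_sum) auto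
    then show "z i powr \<sigma> \<le> z i * T powr (\<sigma> - 1)"
      unfolding split[OF U(2)[rule_format]] using U(2) \<sigma> by (intro mult_left_mono powr_mono2) auto
  qed
  also have "\<dots> = T powr \<sigma>" using split[OF T] by (simp add: T_def sum_distrib_right)
  finally show ?thesis unfolding rtr_mat_powr[OF U] rtr_spec[OF U(1)] T_def .
qed

text \<open>Lets an explicitly known inverse serve as \<open>mat_powr A (- 1)\<close> without
  diagonalising \<open>A\<close>.\<close>

lemma left_inverse_pd:
  assumes "A \<in> psd" "Z \<in> M" "Z * A = 1\<^sub>m n"
  shows "pd A" "mat_powr A (- 1) = Z"
proof -
  have A: "A \<in> M" using assms psdD by auto
  show pd: "pd A"
  proof (rule domI_kernel[OF assms(1) one_psd])
    fix X assume X: "X \<in> M" "A * X = 0\<^sub>m n n"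
    have "X = Z * A * X" using assms X by simp
    also have "\<dots> = Z * (A * X)" using assms A X by (intro massoc)
    finally show "1\<^sub>m n * X = 0\<^sub>m n n" using X assms by simp
  qed
  have "mat_powr A 0 = 1\<^sub>m n" using pd mone(1)[of "mat_powr A 0"] assms(1) by (auto simp: dom_def)
  then have "A * mat_powr A (- 1) = 1\<^sub>m n" using mat_powr_mult[OF assms(1), of 1 "- 1"] assms(1) by simp
  then have "Z * (A * mat_powr A (- 1)) = Z" using assms by simp
  also have "Z * (A * mat_powr A (- 1)) = Z * A * mat_powr A (- 1)" using assms A by (intro massoc[symmetric]) auto
  finally show "mat_powr A (- 1) = Z" using assms by simp
qed

lemma pd_dom: "pd A \<Longrightarrow> B \<in> psd \<Longrightarrow> dom A B"
proof -
  assume A: "pd A" and B: "B \<in> psd"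
  have "mat_powr A 0 = 1\<^sub>m n" using A mone(1)[of "mat_powr A 0"] by (auto simp: dom_def)
  then show ?thesis using A B psdD(1)[OF B] by (simp add: dom_def)
qed

end

section \<open>Real symmetric two-by-two matrices\<close>

interpretation two: cmat 2 .

definition sym2 :: "real \<Rightarrow> real \<Rightarrow> real \<Rightarrow> complex mat" where
  "sym2 a b d = Matrix.mat 2 2 (\<lambda>(i, j). complex_of_real (if i = j then if i = 0 then a else d else b))"

text \<open>For \<open>c^2 + s^2 = 1\<close> the eigenvalues are \<open>l\<close> at
  \<open>(c, s)\<close> and \<open>m\<close> at \<open>(- s, c)\<close>. Reversing the sign of
  \<open>s\<close> changes only the off-diagonal entry, which is why the reflected pairs have a
  diagonal mean.\<close>

definition rot2 :: "real \<Rightarrow> real \<Rightarrow> real \<Rightarrow> real \<Rightarrow> complex mat" where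
  "rot2 c s l m = sym2 (c\<^sup>2 * l + s\<^sup>2 * m) (c * s * (l - m)) (s\<^sup>2 * l + c\<^sup>2 * m)"

lemma sym2_closed [simp]: "sym2 a b d \<in> carrier_mat 2 2"
  by (simp add: sym2_def)

lemma sym2_index [simp]:
  "sym2 a b d $$ (0, 0) = a" "sym2 a b d $$ (0, Suc 0) = b"
  "sym2 a b d $$ (Suc 0, 0) = b" "sym2 a b d $$ (Suc 0, Suc 0) = d"
  by (auto simp: sym2_def)

lemma sum2: "(\<Sum>i<2. f i) = f 0 + f (Suc 0)" for f :: "nat \<Rightarrow> 'a :: comm_monoid_add"
  by (simp add: numeral_2_eq_2)

lemma mat2_eqI:
  assumes "A \<in> carrier_mat 2 2" "B \<in> carrier_mat 2 2"
    "A $$ (0, 0) = B $$ (0, 0)" "A $$ (0, Suc 0) = B $$ (0, Suc 0)"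
    "A $$ (Suc 0, 0) = B $$ (Suc 0, 0)" "A $$ (Suc 0, Suc 0) = B $$ (Suc 0, Suc 0)"
  shows "A = B"
proof (rule eq_matI)
  fix i j assume "i < dim_row B" "j < dim_col B"
  then have "i = 0 \<or> i = Suc 0" "j = 0 \<or> j = Suc 0" using assms(2) by auto
  then show "A $$ (i, j) = B $$ (i, j)" using assms by auto
qed (use assms in auto)

lemma mult2_index: "A \<in> carrier_mat 2 2 \<Longrightarrow> B \<in> carrier_mat 2 2 \<Longrightarrow> i < 2 \<Longrightarrow> j < 2 \<Longrightarrow>
    (A * B) $$ (i, j) = A $$ (i, 0) * B $$ (0, j) + A $$ (i, Suc 0) * (B $$ (Suc 0, j) :: complex)"
  by (subst two.mult_index) (auto simp: sum2)

lemma sym2_sandwich: "sym2 x y z * sym2 a b d * sym2 x y z =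
    sym2 (x\<^sup>2 * a + 2 * x * y * b + y\<^sup>2 * d) (x * y * a + (x * z + y\<^sup>2) * b + y * z * d) (y\<^sup>2 * a + 2 * y * z * b + z\<^sup>2 * d)"
  by (rule mat2_eqI) (simp_all add: mult2_index power2_eq_square algebra_simps)

lemma sym2_diag_mult: "sym2 a 0 d * sym2 a' 0 d' = sym2 (a * a') 0 (d * d')"
  by (rule mat2_eqI) (simp_all add: mult2_index)

lemma sym2_add: "sym2 a b d + sym2 a' b' d' = sym2 (a + a') (b + b') (d + d')"
  by (rule mat2_eqI) (auto simp: sym2_def)

lemma sym2_smult: "complex_of_real c \<cdot>\<^sub>m sym2 a b d = sym2 (c * a) (c * b) (c * d)"
  by (rule mat2_eqI) (auto simp: sym2_def)

lemma sym2_one: "1\<^sub>m 2 = sym2 1 0 1"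
  by (rule mat2_eqI) (auto simp: sym2_def)

lemma sym2_convex_comb: "convex_comb t (sym2 a b d) (sym2 a' b' d') =
    sym2 (t * a + (1 - t) * a') (t * b + (1 - t) * b') (t * d + (1 - t) * d')"
  unfolding convex_comb_def sym2_smult sym2_add ..

lemma rtr_sym2: "rtr (sym2 a b d) = a + d"
  by (simp add: mat_trace_def sym2_def sum2)

lemma rtr_sym2_mult: "rtr (sym2 a b d * sym2 a' b' d') = a * a' + 2 * b * b' + d * d'"
  by (simp add: two.tr_mult sum2)

lemma sym2_psd:
  assumes "a > 0" "b\<^sup>2 \<le> a * d"
  shows "sym2 a b d \<in> psd_mats 2"
proof -
  define e where "e = d - b\<^sup>2 / a"
  have e: "e \<ge> 0" using assms by (simp add: e_def field_simps)
  \<comment> \<open>The Cholesky factor; \<open>e\<close> is the Schur complement.\<close>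
  define R where "R = Matrix.mat 2 2 (\<lambda>(i, j). complex_of_real
    (if i = 0 then if j = 0 then sqrt a else b / sqrt a else if j = 0 then 0 else sqrt e))"
  have R: "R \<in> carrier_mat 2 2" by (simp add: R_def)
  have [simp]: "dim_row R = 2" "dim_col R = 2" by (auto simp: R_def)
  have Ri: "R $$ (0, 0) = sqrt a" "R $$ (0, Suc 0) = b / sqrt a" "R $$ (Suc 0, 0) = 0" "R $$ (Suc 0, Suc 0) = sqrt e"
    by (auto simp: R_def)
  have sq: "complex_of_real (sqrt a) * complex_of_real (sqrt a) = a" "complex_of_real (sqrt e) * complex_of_real (sqrt e) = e"
    using assms e by (auto simp flip: of_real_mult)
  have "complex_of_real (b / sqrt a) * complex_of_real (b / sqrt a) = complex_of_real (b\<^sup>2 / a)"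
    using assms by (simp add: power2_eq_square flip: of_real_mult)
  then have sq': "complex_of_real b / complex_of_real (sqrt a) * (complex_of_real b / complex_of_real (sqrt a)) = complex_of_real (b\<^sup>2 / a)"
    by simp
  have "mat_adjoint R * R = sym2 a b d"
  proof (rule mat2_eqI)
    show "(mat_adjoint R * R) $$ (Suc 0, Suc 0) = sym2 a b d $$ (Suc 0, Suc 0)"
      using R sq(2) sq' by (simp add: mult2_index Ri e_def del: times_divide_times_eq)
  qed (use R sq assms in \<open>auto simp: mult2_index Ri\<close>)
  then show ?thesis using two.gram_psd[OF R] by simp
qed

lemma rot2_spec:
  assumes "c\<^sup>2 + s\<^sup>2 = 1"
  obtains U where "\<And>l m. spectral_dec 2 U (\<lambda>i. if i = 0 then l else m) (rot2 c s l m)"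
proof
  define U where "U = Matrix.mat 2 2 (\<lambda>(i, j). complex_of_real (if i = j then c else if i = 0 then - s else s))"
  have U: "U \<in> carrier_mat 2 2" by (simp add: U_def)
  have [simp]: "dim_row U = 2" "dim_col U = 2" by (auto simp: U_def)
  have Ui: "U $$ (0, 0) = c" "U $$ (0, Suc 0) = - s" "U $$ (Suc 0, 0) = s" "U $$ (Suc 0, Suc 0) = c"
    by (auto simp: U_def)
  have "complex_of_real c * complex_of_real c + complex_of_real s * complex_of_real s = 1"
    using assms by (simp add: power2_eq_square flip: of_real_mult of_real_add)
  then have "mat_adjoint U * U = 1\<^sub>m 2"
    using U by (intro mat2_eqI) (auto simp: mult2_index Ui add.commute)
  then have "unitary_mat 2 U" using U by (intro unitary_matI)
  moreover have "rot2 c s l m = U * real_diag 2 (\<lambda>i. if i = 0 then l else m) * mat_adjoint U" for l m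
    using U unfolding rot2_def
    by (intro mat2_eqI) (auto simp: mult2_index Ui mat_diag_def power2_eq_square algebra_simps)
  ultimately show "spectral_dec 2 U (\<lambda>i. if i = 0 then l else m) (rot2 c s l m)" for l m
    by (simp add: spectral_dec_def)
qed

lemma rot2_psd:
  assumes "c\<^sup>2 + s\<^sup>2 = 1" "0 \<le> l" "0 \<le> m"
  shows "rot2 c s l m \<in> psd_mats 2"
proof -
  obtain U where "\<And>l m. spectral_dec 2 U (\<lambda>i. if i = 0 then l else m) (rot2 c s l m)"
    by (rule rot2_spec[OF assms(1)]) blast
  then show ?thesis by (rule two.spec_psd) (use assms in auto)
qed

lemma rot2_powr:
  assumes "c\<^sup>2 + s\<^sup>2 = 1" "0 \<le> l" "0 \<le> m"
  shows "mat_powr (rot2 c s l m) r = rot2 c s (l powr r) (m powr r)"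
proof -
  obtain U where U: "\<And>l m. spectral_dec 2 U (\<lambda>i. if i = 0 then l else m) (rot2 c s l m)"
    by (rule rot2_spec[OF assms(1)]) blast
  have "mat_powr (rot2 c s l m) r =
      U * real_diag 2 (\<lambda>i. (if i = 0 then l else m) powr r) * mat_adjoint U"
    using assms by (intro two.mat_powr_spec[OF U]) auto
  also have "real_diag 2 (\<lambda>i. (if i = 0 then l else m) powr r) = real_diag 2 (\<lambda>i. if i = 0 then l powr r else m powr r)"
    by (rule two.dg_cong) auto
  finally show ?thesis using two.specD(5)[OF U] by simp
qed

lemma diag2_psd: "0 \<le> a \<Longrightarrow> 0 \<le> d \<Longrightarrow> sym2 a 0 d \<in> psd_mats 2"
  using rot2_psd[of 1 0 a d] by (simp add: rot2_def)

lemma diag2_powr: "0 \<le> a \<Longrightarrow> 0 \<le> d \<Longrightarrow> mat_powr (sym2 a 0 d) r = sym2 (a powr r) 0 (d powr r)"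
  using rot2_powr[of 1 0 a d r] by (simp add: rot2_def)

lemma rot2_pd:
  assumes "c\<^sup>2 + s\<^sup>2 = 1" "0 < l" "0 < m"
  shows "two.pd (rot2 c s l m)"
proof -
  have "c\<^sup>2 * 1 + s\<^sup>2 * 1 = 1" "s\<^sup>2 * 1 + c\<^sup>2 * 1 = 1" using assms(1) by auto
  then have "mat_powr (rot2 c s l m) 0 = 1\<^sub>m 2"
    using assms by (simp add: rot2_powr) (simp add: rot2_def sym2_one add.commute)
  then show ?thesis using rot2_psd[OF assms(1), of l m] two.one_psd assms by (simp add: two.dom_def)
qed

lemma diag2_pd: "0 < a \<Longrightarrow> 0 < d \<Longrightarrow> two.pd (sym2 a 0 d)"
  using rot2_pd[of 1 0 a d] by (simp add: rot2_def)

lemma Tr_G_diag2: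
  assumes "0 < a" "0 < a'" "0 \<le> b" "0 \<le> b'" "p > 0" "\<alpha> > 1"
  shows "Tr_G \<alpha> p (sym2 a 0 a') (sym2 b 0 b') = a powr (1 - \<alpha>) * b powr \<alpha> + a' powr (1 - \<alpha>) * b' powr \<alpha>"
proof -
  have dom: "two.dom (sym2 a 0 a') (sym2 b 0 b')"
    using assms by (intro two.pd_dom[OF diag2_pd diag2_psd]) auto
  let ?f = "\<lambda>a b :: real. b powr (p / 2) * a powr (- p) * b powr (p / 2)"
  let ?g = "\<lambda>a b :: real. b powr (p / 2) * ?f a b powr (\<alpha> - 1) * b powr (p / 2)"
  have g: "?g a b powr (1 / p) = a powr (1 - \<alpha>) * b powr \<alpha>" if "0 < a" "0 \<le> b" for a b :: real
  proof (cases "b = 0")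
    case False
    then have b: "b > 0" using that by simp
    have 1: "?f a b = exp (p * (ln b - ln a))"
      using b that by (simp add: powr_def algebra_simps flip: exp_add)
    have "?g a b = exp (p * ln b + (\<alpha> - 1) * (p * (ln b - ln a)))"
      unfolding 1 using b by (simp add: powr_def algebra_simps flip: exp_add)
    then have "?g a b powr (1 / p) = exp (1 / p * (p * ln b + (\<alpha> - 1) * (p * (ln b - ln a))))"
      by (simp add: powr_def)
    also have "1 / p * (p * ln b + (\<alpha> - 1) * (p * (ln b - ln a))) = (1 - \<alpha>) * ln a + \<alpha> * ln b"
      using assms by (simp add: field_simps)
    finally show ?thesis using b that by (simp add: powr_def exp_add)
  qed (use assms in simp)
  have f: "mat_powr (sym2 b 0 b') (p / 2) * mat_powr (sym2 a 0 a') (- p) * mat_powr (sym2 b 0 b') (p / 2) =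
      sym2 (?f a b) 0 (?f a' b')"
    using assms by (simp only: diag2_powr less_imp_le sym2_diag_mult)
  have f': "mat_powr (sym2 (?f a b) 0 (?f a' b')) (\<alpha> - 1) = sym2 (?f a b powr (\<alpha> - 1)) 0 (?f a' b' powr (\<alpha> - 1))"
    by (rule diag2_powr) auto
  have "mat_powr (sym2 (?g a b) 0 (?g a' b')) (1 / p) = sym2 (?g a b powr (1 / p)) 0 (?g a' b' powr (1 / p))"
    by (rule diag2_powr) auto
  then show ?thesis
    unfolding two.Tr_G_flip[OF dom assms(5)] unfolding f f'
    unfolding diag2_powr[OF assms(3,4)] sym2_diag_mult
    by (simp only: g[OF assms(1,3)] g[OF assms(2,4)] rtr_sym2)
qed

text \<open>Compressing a matrix by the rank one projection onto \<open>(c, s)\<close> gives a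
  multiple of that projection, the factor being the quadratic form at \<open>(c, s)\<close>. Only
  this scalar passes through the powers.\<close>

lemma Tr_G_projection2:
  assumes cs: "c\<^sup>2 + s\<^sup>2 = 1" and dom: "two.dom A (rot2 c s 1 0)" and A: "mat_powr A (- p) = sym2 u v w"
    and m: "0 \<le> c\<^sup>2 * u + 2 * c * s * v + s\<^sup>2 * w" and p: "p > 0" and \<alpha>: "\<alpha> > 1"
  shows "Tr_G \<alpha> p A (rot2 c s 1 0) = (c\<^sup>2 * u + 2 * c * s * v + s\<^sup>2 * w) powr ((\<alpha> - 1) / p)"
proof -
  let ?P = "rot2 c s 1 0"
  define m where "m = c\<^sup>2 * u + 2 * c * s * v + s\<^sup>2 * w"
  have P: "?P \<in> psd_mats 2" "?P \<in> carrier_mat 2 2" using rot2_psd[OF cs, of 1 0] two.psdD by auto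
  have PP: "mat_powr ?P r = ?P" if "r \<noteq> 0" for r
    using rot2_powr[OF cs, of 1 0 r] that by simp
  have PAP: "?P * sym2 u v w * ?P = complex_of_real m \<cdot>\<^sub>m ?P"
    unfolding rot2_def sym2_sandwich sym2_smult m_def
    by (intro arg_cong3[where f = sym2]) (simp_all add: power2_eq_square algebra_simps)
  have "?P * ?P = mat_powr ?P 1 * mat_powr ?P 1" using P by simp
  also have "\<dots> = ?P" using PP[of 2] P by (simp only: two.mat_powr_mult) simp
  finally have P2: "?P * ?P = ?P" .
  have "rtr ?P = 1" using cs by (simp add: rot2_def rtr_sym2)
  then show ?thesis
    unfolding two.Tr_G_flip[OF dom p] m_def[symmetric] using p \<alpha> m[folded m_def] P
    by (simp add: PP PAP A two.mat_powr_smult two.msmult P2 two.tr_smult powr_powr)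
qed

section \<open>Necessary conditions\<close>

text \<open>Strict convexity at the points 3/2 and 1/2, whose mean is 1. The bound
  \<open>1 + (r - 1) * ln x <= x^(r-1)\<close> reduces it to
  \<open>3 ln (3/2) + ln (1/2) > 0\<close>, that is, to \<open>27/16 > 1\<close>.\<close>

lemma powr_mean_gt_one:
  assumes "r > (1::real)"
  shows "((3/2) powr r + (1/2) powr r) / 2 > 1"
proof -
  have 1: "1 + (r - 1) * ln x \<le> x powr (r - 1)" if "x > 0" for x :: real
    using exp_ge_add_one_self[of "(r - 1) * ln x"] that by (simp add: powr_def)
  have 2: "x powr r = x * x powr (r - 1)" if "x > 0" for x :: real
    using that powr_add[of x 1 "r - 1"] by simp
  have "ln ((3 / 2) ^ 3 * (1 / 2) :: real) = ln ((3 / 2) ^ 3) + ln (1 / 2)" by (rule ln_mult_pos) auto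
  also have "ln ((3 / 2) ^ 3 :: real) = 3 * ln (3 / 2)" by (subst ln_realpow) auto
  finally have "3 * ln (3 / 2) + ln (1 / 2 :: real) = ln ((3 / 2) ^ 3 * (1 / 2))" by simp
  also have "\<dots> > 0" by (rule ln_gt_zero) (simp add: power3_eq_cube)
  finally have "0 < 3 * ln (3 / 2) + ln (1 / 2 :: real)" .
  then have "0 < (r - 1) * (3 * ln (3 / 2) + ln (1 / 2))" using assms by simp
  then show ?thesis using 1[of "3/2"] 1[of "1/2"] 2[of "3/2"] 2[of "1/2"] by (simp add: algebra_simps)
qed

lemma cs_half: "(1 / sqrt 2)\<^sup>2 + (1 / sqrt 2)\<^sup>2 = (1::real)"
  by (simp add: power2_eq_square)

text \<open>\<open>A\<close> has eigenvalues 2/3 and 2 with eigenvectors at 45 degrees, so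
  \<open>A^(-1)\<close> has eigenvalues 3/2 and 1/2 and upper left entry exactly 1, like
  \<open>E\<close>. The difference \<open>A - E\<close> is singular, so the pair is extremal: for
  exponent 1 the entries agree, and every \<open>p > 1\<close> pushes that of \<open>A^(-p)\<close>
  above 1.\<close>

lemma jointly_convex_p_le_1:
  assumes jc: "Tr_G_jointly_convex \<alpha> p" and \<alpha>: "\<alpha> > 1" and p: "p > 0"
  shows "p \<le> 1"
proof (rule ccontr)
  assume "\<not> p \<le> 1"
  then have p1: "p > 1" by simp
  let ?h = "1 / sqrt 2 :: real"
  define E where "E = rot2 1 0 1 0"
  define A where "A = rot2 ?h ?h (2/3) 2"
  have E: "E = sym2 1 0 0" by (simp add: E_def rot2_def)
  have A': "A = sym2 (4/3) (- 2/3) (4/3)" by (simp add: A_def rot2_def power2_eq_square)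
  have Epsd: "E \<in> psd_mats 2" unfolding E_def by (intro rot2_psd) auto
  have domE: "two.dom E E" using Epsd by (auto simp: two.dom_def) (simp add: E diag2_powr sym2_diag_mult)
  have domA: "two.dom A E" unfolding A_def using cs_half by (intro two.pd_dom[OF rot2_pd Epsd]) auto
  have X: "A = E + sym2 (1/3) (- 2/3) (4/3)" unfolding A' E sym2_add by simp
  have "sym2 (1/3) (- 2/3) (4/3) \<in> psd_mats 2" by (intro sym2_psd) (auto simp: power2_eq_square)
  then have "Tr_G \<alpha> p A E \<le> Tr_G \<alpha> p E E"
    unfolding X by (intro two.Tr_G_antimono_fst jc domE p) auto
  also have "Tr_G \<alpha> p E E = 1"
    using Tr_G_projection2[of 1 0 E p 1 0 0 \<alpha>] domE p \<alpha> unfolding E_def[symmetric] by (simp add: E diag2_powr)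
  finally have le: "Tr_G \<alpha> p A E \<le> 1" .
  define m where "m = ((3/2) powr p + (1/2) powr p) / 2"
  have m: "m > 1" unfolding m_def using powr_mean_gt_one[OF p1] .
  have inv: "(2/3) powr (- p) = (3/2::real) powr p" "2 powr (- p) = (1/2::real) powr p"
    by (simp_all add: powr_minus powr_divide inverse_eq_divide)
  have "mat_powr A (- p) = rot2 ?h ?h ((3/2) powr p) ((1/2) powr p)"
    unfolding A_def inv[symmetric] using cs_half by (intro rot2_powr) auto
  also have "\<dots> = sym2 m (((3/2) powr p - (1/2) powr p) / 2) m"
    unfolding rot2_def m_def by (simp add: power2_eq_square add_divide_distrib)
  finally have "Tr_G \<alpha> p A E = m powr ((\<alpha> - 1) / p)"
    using Tr_G_projection2[of 1 0 A p m _ m \<alpha>] domA p \<alpha> m unfolding E_def[symmetric] by simp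
  moreover have "m powr ((\<alpha> - 1) / p) > 1" using m \<alpha> p by (intro gr_one_powr) auto
  ultimately show False using le by simp
qed

lemma jointly_convex_midpoint2:
  assumes "Tr_G_jointly_convex \<alpha> p" "two.dom A B1" "two.dom A B2"
  shows "2 * Tr_G \<alpha> p A (convex_comb (1 / 2) B1 B2) \<le> Tr_G \<alpha> p A B1 + Tr_G \<alpha> p A B2"
proof -
  have "A \<in> carrier_mat 2 2" using assms(2) two.psdD by (auto simp: two.dom_def)
  then show ?thesis using two.jointly_convexD[OF assms(1) _ assms(2,3), of "1 / 2"] by simp
qed

text \<open>The projections onto \<open>(1, 1)\<close> and \<open>(1, -1)\<close> average to half
  the identity. As \<open>N\<close> grows, midpoint convexity becomes
  \<open>(1/2)^\<alpha> <= (1/2)^((\<alpha> - 1)/p)\<close>.\<close>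

lemma jointly_convex_p_ge:
  assumes jc: "Tr_G_jointly_convex \<alpha> p" and \<alpha>: "\<alpha> > 1" and p: "p > 0"
  shows "(\<alpha> - 1) / \<alpha> \<le> p"
proof -
  let ?h = "1 / sqrt 2 :: real"
  have le: "(1/2) powr \<alpha> \<le> ((1 + N powr (- p)) / 2) powr ((\<alpha> - 1) / p)" if N: "N > 0" for N :: real
  proof -
    define A where "A = sym2 1 0 N"
    define B where "B s = rot2 ?h s 1 0" for s
    have cs: "?h\<^sup>2 + s\<^sup>2 = 1" if "s = ?h \<or> s = - ?h" for s using that cs_half by auto
    have pdA: "two.pd A" using N by (simp add: A_def diag2_pd)
    have dom: "two.dom A (B s)" if "s = ?h \<or> s = - ?h" for s
      unfolding B_def by (rule two.pd_dom[OF pdA rot2_psd]) (use cs[OF that] in auto)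
    have Ap: "mat_powr A (- p) = sym2 1 0 (N powr (- p))" using N by (simp add: A_def diag2_powr)
    have T: "Tr_G \<alpha> p A (B s) = ((1 + N powr (- p)) / 2) powr ((\<alpha> - 1) / p)" if "s = ?h \<or> s = - ?h" for s
    proof -
      have "s\<^sup>2 = 1 / 2" using that by (auto simp: power2_eq_square)
      then have e: "?h\<^sup>2 * 1 + 2 * ?h * s * 0 + s\<^sup>2 * N powr (- p) = (1 + N powr (- p)) / 2"
        by (simp add: power2_eq_square add_divide_distrib)
      show ?thesis
        using Tr_G_projection2[OF cs[OF that] dom[OF that, unfolded B_def] Ap _ p \<alpha>] unfolding e B_def by simp
    qed
    have "convex_comb (1 / 2) (B ?h) (B (- ?h)) = sym2 (1/2) 0 (1/2)"
      unfolding B_def rot2_def sym2_convex_comb by (simp add: power2_eq_square)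
    then have "2 * Tr_G \<alpha> p A (sym2 (1/2) 0 (1/2)) \<le> 2 * ((1 + N powr (- p)) / 2) powr ((\<alpha> - 1) / p)"
      using jointly_convex_midpoint2[OF jc dom[of ?h] dom[of "- ?h"]] by (simp add: T)
    moreover have "Tr_G \<alpha> p A (sym2 (1/2) 0 (1/2)) = (1/2) powr \<alpha> + N powr (1 - \<alpha>) * (1/2) powr \<alpha>"
      unfolding A_def using N p \<alpha> by (subst Tr_G_diag2) auto
    ultimately show ?thesis by (smt (verit) mult_nonneg_nonneg powr_ge_zero)
  qed
  have "((\<lambda>N. ((1 + N powr (- p)) / 2) powr ((\<alpha> - 1) / p)) \<longlongrightarrow> ((1 + 0) / 2) powr ((\<alpha> - 1) / p)) at_top"
    using p \<alpha> by (intro tendsto_intros tendsto_neg_powr filterlim_ident) auto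
  moreover have "\<forall>\<^sub>F N in at_top. (1/2) powr \<alpha> \<le> ((1 + N powr (- p)) / 2) powr ((\<alpha> - 1) / p)"
    using eventually_gt_at_top[of 0] by eventually_elim (rule le)
  ultimately have "(1/2::real) powr \<alpha> \<le> ((1 + 0) / 2) powr ((\<alpha> - 1) / p)"
    by (intro tendsto_lowerbound) auto
  then have "(\<alpha> - 1) / p \<le> \<alpha>" using powr_less_mono'[of "1/2" \<alpha> "(\<alpha> - 1) / p"] by force
  then show ?thesis using p \<alpha> by (simp add: field_simps)
qed

text \<open>Congruence by \<open>B^(1/2)\<close> carries \<open>diag(1 - \<eta>, \<eta>)\<close> to
  \<open>A\<close>, and the matrix with entries 4/3 and -2/3 from the bound \<open>p \<le> 1\<close>
  to \<open>A'\<close>. That matrix minus \<open>diag(1, 0)\<close> is singular, so raising the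
  lower entry to \<eta> has to be paid for by lowering the upper one.\<close>

lemma jointly_convex_p_1:
  assumes jc: "Tr_G_jointly_convex \<alpha> 1" and \<alpha>: "\<alpha> > 1"
  shows "\<alpha> \<le> 2"
proof (rule ccontr)
  assume "\<not> \<alpha> \<le> 2"
  define r where "r = \<alpha> - 1"
  have r: "r > 1" using \<open>\<not> \<alpha> \<le> 2\<close> by (simp add: r_def)
  let ?h = "1 / sqrt 2 :: real"
  define q where "q = ((3/2) powr r + (1/2) powr r) / 2"
  have q: "q > 1" unfolding q_def by (rule powr_mean_gt_one[OF r])
  have le: "(1 + \<epsilon>) * q \<le> (1 - \<eta>) powr (- r) + \<epsilon> * \<eta> powr (- r)"
    if \<epsilon>: "0 < \<epsilon>" and \<eta>: "0 < \<eta>" "\<eta> < 1" for \<epsilon> \<eta> :: real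
  proof -
    define B where "B = sym2 1 0 \<epsilon>"
    define A where "A = sym2 (1 - \<eta>) 0 (\<epsilon> * \<eta>)"
    define A' where "A' = sym2 (4/3) (- 2/3 * sqrt \<epsilon>) (4/3 * \<epsilon>)"
    define X where "X = sym2 (1/3 + \<eta>) (- 2/3 * sqrt \<epsilon>) (\<epsilon> * (4/3 - \<eta>))"
    have Bpsd: "B \<in> psd_mats 2" unfolding B_def using \<epsilon> by (intro diag2_psd) auto
    have domA: "two.dom A B" unfolding A_def using \<epsilon> \<eta> by (intro two.pd_dom[OF diag2_pd Bpsd]) auto
    have A'psd: "A' \<in> psd_mats 2"
      unfolding A'_def using \<epsilon> by (intro sym2_psd) (auto simp: power_mult_distrib power2_eq_square)
    have "\<epsilon> * (\<eta> * \<eta>) \<le> \<epsilon> * \<eta>" using \<epsilon> \<eta> by (intro mult_left_mono) auto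
    then have Xpsd: "X \<in> psd_mats 2"
      unfolding X_def using \<epsilon> \<eta>
      by (intro sym2_psd) (auto simp: power_mult_distrib power2_eq_square algebra_simps)
    have AX: "A' = A + X" unfolding A_def X_def A'_def sym2_add by (simp add: algebra_simps)
    define Z where "Z = sym2 1 (1 / (2 * sqrt \<epsilon>)) (1 / \<epsilon>)"
    have sq: "complex_of_real (sqrt \<epsilon>) * complex_of_real (sqrt \<epsilon>) = \<epsilon>" using \<epsilon> by (simp flip: of_real_mult)
    have "Z * A' = 1\<^sub>m 2"
      unfolding Z_def A'_def sym2_one using \<epsilon> sq
      by (intro mat2_eqI) (auto simp: mult2_index field_simps)
    note inv = two.left_inverse_pd[OF A'psd _ this]
    have domA': "two.dom A' B" by (rule two.pd_dom[OF inv(1) Bpsd]) (simp add: Z_def)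
    have A'i: "mat_powr A' (- 1) = Z" by (rule inv(2)) (simp add: Z_def)
    have Bh: "mat_powr B (1 / 2) = sym2 1 0 (sqrt \<epsilon>)"
      unfolding B_def using \<epsilon> by (simp add: diag2_powr powr_half_sqrt)
    have Y: "mat_powr B (1 / 2) * Z * mat_powr B (1 / 2) = rot2 ?h ?h (3/2) (1/2)"
      unfolding Bh Z_def sym2_sandwich rot2_def using \<epsilon> by (simp add: power2_eq_square)
    have Yr: "mat_powr (rot2 ?h ?h (3/2) (1/2)) r = sym2 q (((3/2) powr r - (1/2) powr r) / 2) q"
      using cs_half by (subst rot2_powr) (auto simp: rot2_def q_def power2_eq_square add_divide_distrib)
    have flip: "Tr_G \<alpha> 1 A' B = rtr (mat_powr B (1 / 2) * mat_powr (mat_powr B (1 / 2) * mat_powr A' (- 1) * mat_powr B (1 / 2)) (\<alpha> - 1) * mat_powr B (1 / 2))"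
    proof -
      have AB: "A' \<in> psd_mats 2" "B \<in> psd_mats 2" using A'psd Bpsd by auto
      then show ?thesis unfolding Tr_G_def G_mean_def using two.geo_mean_psd[OF AB, of \<alpha>]
        by (simp add: two.geo_mean_flip[OF domA', symmetric])
    qed
    have "Tr_G \<alpha> 1 A' B = rtr (sym2 1 0 (sqrt \<epsilon>) * sym2 q (((3/2) powr r - (1/2) powr r) / 2) q * sym2 1 0 (sqrt \<epsilon>))"
      unfolding flip A'i Y unfolding r_def[symmetric] Yr unfolding Bh ..
    also have "\<dots> = (1 + \<epsilon>) * q"
      unfolding sym2_sandwich rtr_sym2 using \<epsilon> by (simp add: algebra_simps)
    finally have "(1 + \<epsilon>) * q = Tr_G \<alpha> 1 A' B" ..
    also have "\<dots> \<le> Tr_G \<alpha> 1 A B"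
      unfolding AX by (intro two.Tr_G_antimono_fst jc domA Xpsd) auto
    also have "\<dots> = (1 - \<eta>) powr (- r) + \<epsilon> * \<eta> powr (- r)"
    proof -
      have "(\<epsilon> * \<eta>) powr (- r) * \<epsilon> powr \<alpha> = \<epsilon> powr (- r + \<alpha>) * \<eta> powr (- r)"
        using \<epsilon> \<eta> by (simp add: powr_mult flip: powr_add)
      then show ?thesis unfolding A_def B_def using \<epsilon> \<eta> \<alpha> by (subst Tr_G_diag2) (auto simp: r_def)
    qed
    finally show ?thesis .
  qed
  \<comment> \<open>The order of the limits matters: \<epsilon> goes to 0 first and removes the term
    with \<open>\<eta> powr (- r)\<close>, which blows up as \<eta> goes to 0.\<close>
  have "q \<le> (1 - \<eta>) powr (- r)" if \<eta>: "0 < \<eta>" "\<eta> < 1" for \<eta> :: real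
  proof -
    have "((\<lambda>\<epsilon>. (1 + \<epsilon>) * q) \<longlongrightarrow> (1 + 0) * q) (at_right 0)"
      "((\<lambda>\<epsilon>. (1 - \<eta>) powr (- r) + \<epsilon> * \<eta> powr (- r)) \<longlongrightarrow> (1 - \<eta>) powr (- r) + 0 * \<eta> powr (- r)) (at_right 0)"
      by (intro tendsto_intros)+
    moreover have "\<forall>\<^sub>F \<epsilon> in at_right 0. (1 + \<epsilon>) * q \<le> (1 - \<eta>) powr (- r) + \<epsilon> * \<eta> powr (- r)"
      using eventually_at_right_less[of "0::real"] by eventually_elim (rule le[OF _ \<eta>])
    ultimately have "(1 + 0) * q \<le> (1 - \<eta>) powr (- r) + 0 * \<eta> powr (- r)"
      by (intro tendsto_le[OF trivial_limit_at_right_real]) auto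
    then show ?thesis by simp
  qed
  moreover have "((\<lambda>\<eta>::real. (1 - \<eta>) powr (- r)) \<longlongrightarrow> (1 - 0) powr (- r)) (at_right 0)"
    by (intro tendsto_intros) auto
  moreover have "\<forall>\<^sub>F \<eta> in at_right (0::real). 0 < \<eta> \<and> \<eta> < 1"
    using eventually_at_right_real[of 0 1] by (simp add: greaterThanLessThan_iff)
  ultimately have "q \<le> (1 - 0) powr (- r)"
    by (intro tendsto_lowerbound[OF _ _ trivial_limit_at_right_real]) (auto elim: eventually_mono)
  then show False using q by simp
qed

text \<open>If \<open>y\<^sub>0 + y\<^sub>1 \<ge> g\<close> and \<open>y\<^sub>0 y\<^sub>1\<close> is small, then each \<open>y\<^sub>j\<close> is either at least \<open>g / 2\<close> or small.\<close>

lemma powr_bound_two: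
  assumes "0 \<le> y0" "0 \<le> y1" "0 < g" "g \<le> y0 + y1" "y0 * y1 \<le> d" "0 < r" "r \<le> (1::real)"
  shows "y0 powr r \<le> (g / 2) powr (r - 1) * y0 + (2 * d / g) powr r"
proof (cases "g / 2 \<le> y0")
  case True
  have "y0 powr r = y0 powr (r - 1) * y0" using assms True powr_add[of y0 "r - 1" 1] by simp
  also have "\<dots> \<le> (g / 2) powr (r - 1) * y0" using assms True by (intro mult_right_mono powr_mono2') auto
  finally show ?thesis by (simp add: add_increasing2)
next
  case False
  then have "g / 2 \<le> y1" using assms by simp
  then have "y0 * (g / 2) \<le> d" using assms mult_left_mono[of "g / 2" y1 y0] by linarith
  then have "y0 \<le> 2 * d / g" using assms by (simp add: field_simps)
  then have "y0 powr r \<le> (2 * d / g) powr r" using assms by (intro powr_mono2) auto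
  then show ?thesis using assms by (simp add: add_increasing)
qed

text \<open>Cyclically the inner trace is \<open>Tr C Y^(\<alpha> - 1)\<close> with
  \<open>C = B^p\<close> and \<open>Y = B^(p/2) diag(1, e) B^(p/2)\<close>. For small
  \<open>e\<close> the matrix \<open>Y\<close> is nearly of rank one, and a bound
  \<open>y^r <= P y + Q\<close> on both eigenvalues replaces the power by the computable traces of
  \<open>C Y\<close> and \<open>C\<close>.\<close>

lemma Tr_G_le_2:
  assumes C: "mat_powr B p = sym2 a b d" and a: "a > 0" and B: "B \<in> psd_mats 2" and e: "e > 0" and p: "0 < p" "p \<le> 1"
    and \<alpha>: "1 < \<alpha>" "\<alpha> \<le> 2" and A: "two.dom A B" "mat_powr A (- p) = sym2 1 0 e"
  shows "Tr_G \<alpha> p A B \<le> ((a / 2) powr (\<alpha> - 2) * (a\<^sup>2 + b\<^sup>2 + e * (b\<^sup>2 + d\<^sup>2)) +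
    (2 * (e * (a * d - b\<^sup>2)) / a) powr (\<alpha> - 1) * (a + d)) powr (1 / p)"
proof -
  let ?b = "mat_powr B (p / 2)"
  have bb: "?b * ?b = sym2 a b d" using C B by (simp add: two.mat_powr_mult)
  have b: "?b \<in> carrier_mat 2 2" using B by simp
  define Y where "Y = ?b * sym2 1 0 e * ?b"
  have Y: "Y \<in> psd_mats 2" unfolding Y_def
    using two.psd_congr[OF diag2_psd[of 1 e] b] e B by simp
  have cyc: "mat_trace (?b * X * ?b) = mat_trace (sym2 a b d * X)" if "X \<in> carrier_mat 2 2" for X
    using that b two.tr_comm[of "?b * X" ?b] by (simp add: two.massoc bb flip: two.massoc[of ?b ?b])
  obtain U y where U: "spectral_dec 2 U y Y" "\<forall>i. 0 \<le> y i" by (rule two.psd_spectral[OF Y])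
  have trY: "y 0 + y 1 = a + e * d"
    using two.rtr_spec[OF U(1)] cyc[of "sym2 1 0 e"] by (simp add: Y_def rtr_sym2_mult sum2 mult.commute)
  \<comment> \<open>Together with the trace of \<open>Y\<close>, that of its square gives the
    product of the two eigenvalues.\<close>
  have "rtr (mat_powr Y 2) = rtr (Y * Y)"
  proof -
    have "Y * Y = mat_powr Y 1 * mat_powr Y 1" using Y by simp
    then show ?thesis unfolding two.mat_powr_mult[OF Y] by simp
  qed
  also have "Y * Y = ?b * (sym2 1 0 e * sym2 a b d * sym2 1 0 e) * ?b"
    unfolding Y_def bb[symmetric] using b by (simp add: two.massoc)
  also have "rtr \<dots> = a\<^sup>2 + 2 * e * b\<^sup>2 + e\<^sup>2 * d\<^sup>2"
    unfolding sym2_sandwich using cyc by (simp add: rtr_sym2_mult power2_eq_square algebra_simps)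
  finally have "y 0 powr 2 + y 1 powr 2 = a\<^sup>2 + 2 * e * b\<^sup>2 + e\<^sup>2 * d\<^sup>2"
    using two.rtr_mat_powr[OF U, of 2] by (simp add: sum2)
  then have "(y 0)\<^sup>2 + (y 1)\<^sup>2 = a\<^sup>2 + 2 * e * b\<^sup>2 + e\<^sup>2 * d\<^sup>2" using U(2) by simp
  moreover have "(y 0 + y 1)\<^sup>2 = (y 0)\<^sup>2 + (y 1)\<^sup>2 + 2 * (y 0 * y 1)" by (simp add: power2_sum)
  ultimately have detY: "y 0 * y 1 = e * (a * d - b\<^sup>2)"
    unfolding trY by (simp add: power2_eq_square algebra_simps)
  have Cpsd: "sym2 a b d \<in> psd_mats 2" using two.mat_powr_psd[OF B, of p] C by simp
  obtain V c where V: "spectral_dec 2 V c (sym2 a b d)" "\<forall>i. 0 \<le> c i" by (rule two.psd_spectral[OF Cpsd])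
  \<comment> \<open>\<open>w j\<close> is the quadratic form of \<open>sym2 a b d\<close> at the
    \<open>j\<close>-th eigenvector of \<open>Y\<close>.\<close>
  define w where "w j = (\<Sum>i<2. c i * (cmod ((mat_adjoint V * 1\<^sub>m 2 * U) $$ (i, j)))\<^sup>2)" for j
  have w: "w j \<ge> 0" for j unfolding w_def using V(2) by (simp add: sum_nonneg)
  have form: "rtr (sym2 a b d * mat_powr Y r) = y 0 powr r * w 0 + y 1 powr r * w 1" for r
  proof -
    have "rtr (sym2 a b d * mat_powr Y r) = rtr (mat_adjoint (1\<^sub>m 2) * sym2 a b d * 1\<^sub>m 2 * mat_powr Y r)"
      using Y by simp
    also have "\<dots> = (\<Sum>i<2. \<Sum>j<2. c i * y j powr r * (cmod ((mat_adjoint V * 1\<^sub>m 2 * U) $$ (i, j)))\<^sup>2)"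
      by (rule two.rtr_two_spec[OF V(1) two.spec_mat_powr[OF U]]) simp
    also have "\<dots> = y 0 powr r * w 0 + y 1 powr r * w 1"
      unfolding w_def sum2 by (simp add: algebra_simps)
    finally show ?thesis .
  qed
  define r where "r = \<alpha> - 1"
  have r: "0 < r" "r \<le> 1" using \<alpha> by (auto simp: r_def)
  have w1: "y 0 * w 0 + y 1 * w 1 = a\<^sup>2 + b\<^sup>2 + e * (b\<^sup>2 + d\<^sup>2)"
  proof -
    have "y 0 * w 0 + y 1 * w 1 = rtr (sym2 a b d * Y)" using form[of 1] U(2) Y by simp
    also have "\<dots> = rtr (?b * Y * ?b)" using cyc[of Y] Y two.psdD by simp
    also have "?b * Y * ?b = sym2 a b d * sym2 1 0 e * sym2 a b d"
      unfolding Y_def bb[symmetric] using b by (simp add: two.massoc)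
    also have "rtr \<dots> = a\<^sup>2 + b\<^sup>2 + e * (b\<^sup>2 + d\<^sup>2)"
      unfolding sym2_sandwich rtr_sym2 by (simp add: power2_eq_square algebra_simps)
    finally show ?thesis .
  qed
  have w0: "w 0 + w 1 = a + d"
  proof -
    have "rtr (sym2 a b d) = (\<Sum>i<2. \<Sum>j<2. c i * (cmod ((mat_adjoint V * 1\<^sub>m 2 * U) $$ (i, j)))\<^sup>2)"
      using two.rtr_left_spec[OF V(1) two.specD(1)[OF U(1)], of "1\<^sub>m 2"] by simp
    then show ?thesis unfolding w_def sum2 rtr_sym2 by (simp add: algebra_simps)
  qed
  have d0: "0 \<le> d"
  proof -
    have "rtr (mat_adjoint (sym2 0 0 1) * sym2 a b d * sym2 0 0 1) \<ge> 0"
      using two.rtr_congr_nonneg[OF Cpsd, of "sym2 0 0 1"] by simp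
    also have "mat_adjoint (sym2 0 0 1) = sym2 0 0 1" by (rule mat2_eqI) (auto simp: sym2_def)
    finally show ?thesis unfolding sym2_sandwich rtr_sym2 by simp
  qed
  define P where "P = (a / 2) powr (r - 1)"
  define Q where "Q = (2 * (e * (a * d - b\<^sup>2)) / a) powr r"
  have y0: "y 0 powr r \<le> P * y 0 + Q"
    unfolding P_def Q_def using U(2) a e d0 trY detY r
    by (intro powr_bound_two[of "y 0" "y 1"]) auto
  have y1: "y 1 powr r \<le> P * y 1 + Q"
    unfolding P_def Q_def using U(2) a e d0 trY detY r
    by (intro powr_bound_two[of "y 1" "y 0"]) (auto simp: mult.commute add.commute)
  define G where "G = ?b * mat_powr Y r * ?b"
  have G: "G \<in> psd_mats 2" unfolding G_def
    using two.psd_congr[OF two.mat_powr_psd[OF Y] b] B by simp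
  have "rtr G = y 0 powr r * w 0 + y 1 powr r * w 1"
    unfolding G_def form[symmetric] using cyc[of "mat_powr Y r"] Y by simp
  also have "\<dots> \<le> (P * y 0 + Q) * w 0 + (P * y 1 + Q) * w 1"
    using w y0 y1 by (intro add_mono mult_right_mono) auto
  also have "\<dots> = P * (y 0 * w 0 + y 1 * w 1) + Q * (w 0 + w 1)" by (simp add: algebra_simps)
  finally have trG: "rtr G \<le> P * (a\<^sup>2 + b\<^sup>2 + e * (b\<^sup>2 + d\<^sup>2)) + Q * (a + d)" unfolding w0 w1 .
  have "Tr_G \<alpha> p A B = rtr (mat_powr G (1 / p))"
    unfolding two.Tr_G_flip[OF A(1) p(1)] A(2) G_def Y_def r_def ..
  also have "\<dots> \<le> rtr G powr (1 / p)" using p by (intro two.rtr_mat_powr_le G) auto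
  also have "\<dots> \<le> (P * (a\<^sup>2 + b\<^sup>2 + e * (b\<^sup>2 + d\<^sup>2)) + Q * (a + d)) powr (1 / p)"
    using trG two.psd_rtr_nonneg[OF G] p by (intro powr_mono2) auto
  finally show ?thesis unfolding P_def Q_def r_def by (simp add: diff_diff_eq)
qed

text \<open>The test pair is \<open>A = diag(1, N)\<close> with \<open>N \<rightarrow> \<infinity>\<close> and \<open>B\<^sub>\<plusminus>\<close> with eigenvalues \<open>1\<close> and \<open>K / \<delta>\<close>,
  the second eigenvector having weight \<open>\<delta>\<close> on the first coordinate. As \<open>\<delta> \<rightarrow> 0\<close> that weight
  disappears from \<open>B\<^sub>\<plusminus>\<^sup>2\<^sup>p\<close>, since \<open>2 p < 1\<close>, but contributes \<open>K\<close> to the mean of \<open>B\<^sub>+\<close> and \<open>B\<^sub>-\<close>.\<close>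

lemma jointly_convex_p_ge_half:
  assumes jc: "Tr_G_jointly_convex \<alpha> p" and \<alpha>: "1 < \<alpha>" "\<alpha> \<le> 2" and p: "p > 0"
  shows "1/2 \<le> p"
proof (rule ccontr)
  assume "\<not> 1/2 \<le> p"
  then have p2: "2 * p < 1" by simp
  have le: "(1 - \<delta> + K) powr \<alpha> \<le> ((g / 2) powr (\<alpha> - 2) * h) powr (1 / p)"
    if K: "K > 0" and \<delta>: "0 < \<delta>" "\<delta> < 1" and g: "g = (1 - \<delta>) + \<delta> * (K / \<delta>) powr p"
      and h: "h = (1 - \<delta>) + \<delta> * (K / \<delta>) powr (2 * p)" for K \<delta> g h :: real
  proof -
    define c where "c = sqrt (1 - \<delta>)"
    define s where "s = sqrt \<delta>"
    define \<mu> where "\<mu> = K / \<delta>"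
    have \<mu>: "\<mu> > 0" using K \<delta> by (simp add: \<mu>_def)
    have cs: "c\<^sup>2 = 1 - \<delta>" "s\<^sup>2 = \<delta>" using \<delta> by (auto simp: c_def s_def)
    have g0: "g > 0" unfolding g using \<delta> by (simp add: add_pos_nonneg)
    define d where "d = s\<^sup>2 * 1 + c\<^sup>2 * \<mu> powr p"
    define b where "b = c * s * (1 - \<mu> powr p)"
    define R where "R e = ((g / 2) powr (\<alpha> - 2) * (g\<^sup>2 + b\<^sup>2 + e * (b\<^sup>2 + d\<^sup>2)) +
        (2 * (e * (g * d - b\<^sup>2)) / g) powr (\<alpha> - 1) * (g + d)) powr (1 / p)" for e
    have "(1 - \<delta> + K) powr \<alpha> \<le> R e" if e: "e > 0" for e
    proof -
      \<comment> \<open>Here \<open>N = e^(-1/p)\<close>, so that \<open>A^(-p) = diag(1, e)\<close>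
        and letting \<open>N\<close> grow means letting \<open>e\<close> tend to 0.\<close>
      define A where "A = sym2 1 0 (e powr (- 1 / p))"
      define B where "B s' = rot2 c s' 1 \<mu>" for s'
      have pm: "c\<^sup>2 + s'\<^sup>2 = 1" if "s' = s \<or> s' = - s" for s' using that cs by auto
      have Bpsd: "B s' \<in> psd_mats 2" if "s' = s \<or> s' = - s" for s'
        unfolding B_def using pm[OF that] \<mu> by (intro rot2_psd) auto
      have pdA: "two.pd A" unfolding A_def using e by (intro diag2_pd) auto
      note dom = two.pd_dom[OF pdA Bpsd]
      have Ap: "mat_powr A (- p) = sym2 1 0 e"
        unfolding A_def using e p by (simp add: diag2_powr powr_powr)
      have Bp: "mat_powr (B s') p = sym2 g (c * s' * (1 - \<mu> powr p)) d" if "s' = s \<or> s' = - s" for s'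
        unfolding B_def using pm[OF that] \<mu> that
        by (subst rot2_powr) (auto simp: rot2_def g d_def cs \<mu>_def)
      have bound: "Tr_G \<alpha> p A (B s') \<le> R e" if s': "s' = s \<or> s' = - s" for s'
      proof -
        have "(c * s' * (1 - \<mu> powr p))\<^sup>2 = b\<^sup>2" using s' by (auto simp: b_def power_mult_distrib)
        then show ?thesis
          using Tr_G_le_2[OF Bp[OF s'] g0 Bpsd[OF s'] e p _ \<alpha> dom[OF s'] Ap] p2 p unfolding R_def by simp
      qed
      have "convex_comb (1 / 2) (B s) (B (- s)) = sym2 (1 - \<delta> + K) 0 (\<delta> + (1 - \<delta>) * \<mu>)"
        unfolding B_def rot2_def sym2_convex_comb using \<delta> by (simp add: cs \<mu>_def)
      then have "2 * Tr_G \<alpha> p A (sym2 (1 - \<delta> + K) 0 (\<delta> + (1 - \<delta>) * \<mu>)) \<le> R e + R e"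
        using jointly_convex_midpoint2[OF jc dom[of s] dom[of "- s"]] bound[of s] bound[of "- s"] by simp
      moreover have "Tr_G \<alpha> p A (sym2 (1 - \<delta> + K) 0 (\<delta> + (1 - \<delta>) * \<mu>)) \<ge> (1 - \<delta> + K) powr \<alpha>"
        unfolding A_def using e p \<alpha> \<delta> K \<mu> by (subst Tr_G_diag2) auto
      ultimately show ?thesis by simp
    qed
    then have ev: "\<forall>\<^sub>F e in at_right 0. (1 - \<delta> + K) powr \<alpha> \<le> R e"
      using eventually_at_right_less[of "0::real"] by (auto elim: eventually_mono)
    \<comment> \<open>This is the determinant of the \<open>p\<close>-th power of either test
      matrix.\<close>
    have gd: "0 \<le> g * d - b\<^sup>2"
    proof -
      have "g * d - b\<^sup>2 = (c\<^sup>2 + s\<^sup>2)\<^sup>2 * \<mu> powr p"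
        unfolding g d_def b_def \<mu>_def[symmetric] unfolding cs(1)[symmetric] unfolding cs(2)[symmetric]
        by (simp add: power2_eq_square algebra_simps)
      then show ?thesis by simp
    qed
    have "((\<lambda>e. 2 * (e * (g * d - b\<^sup>2)) / g) \<longlongrightarrow> 2 * (0 * (g * d - b\<^sup>2)) / g) (at_right 0)"
      using g0 by (intro tendsto_intros) auto
    then have "((\<lambda>e. (2 * (e * (g * d - b\<^sup>2)) / g) powr (\<alpha> - 1)) \<longlongrightarrow> 0) (at_right 0)"
      using \<alpha> gd g0 eventually_at_right_less[of "0::real"]
      by (intro tendsto_zero_powrI[where b = "\<alpha> - 1"] tendsto_const)
        (auto elim!: eventually_mono)
    then have "((\<lambda>e. (g / 2) powr (\<alpha> - 2) * (g\<^sup>2 + b\<^sup>2 + e * (b\<^sup>2 + d\<^sup>2)) +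
        (2 * (e * (g * d - b\<^sup>2)) / g) powr (\<alpha> - 1) * (g + d)) \<longlongrightarrow>
        (g / 2) powr (\<alpha> - 2) * (g\<^sup>2 + b\<^sup>2 + 0 * (b\<^sup>2 + d\<^sup>2)) + 0 * (g + d)) (at_right 0)"
      by (intro tendsto_intros)
    \<comment> \<open>The upper left entry of the power \<open>2 * p\<close> of a test matrix, read
      off from the square of its \<open>p\<close>-th power.\<close>
    moreover have "g\<^sup>2 + b\<^sup>2 = h"
    proof -
      have "g\<^sup>2 + b\<^sup>2 = (c\<^sup>2 + s\<^sup>2) * (c\<^sup>2 + s\<^sup>2 * (\<mu> powr p * \<mu> powr p))"
        unfolding g b_def \<mu>_def[symmetric] unfolding cs(1)[symmetric] unfolding cs(2)[symmetric]
        by (simp add: power2_eq_square algebra_simps)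
      also have "\<mu> powr p * \<mu> powr p = \<mu> powr (2 * p)" by (simp flip: powr_add)
      finally show ?thesis by (simp add: cs h \<mu>_def)
    qed
    moreover have "h > 0" unfolding h using \<delta> by (simp add: add_pos_nonneg)
    ultimately have "(R \<longlongrightarrow> ((g / 2) powr (\<alpha> - 2) * h) powr (1 / p)) (at_right 0)"
      unfolding R_def using g0 p by (intro tendsto_powr tendsto_const) auto
    then show ?thesis using ev by (intro tendsto_lowerbound) auto
  qed
  \<comment> \<open>As \<delta> tends to 0, both \<open>g\<close> and \<open>h\<close> tend to 1
    because \<open>p\<close> and \<open>2 * p\<close> are below 1: the right-hand side loses its
    dependence on \<open>K\<close>, the left-hand side keeps it.\<close>
  have le2: "(1 + K) powr \<alpha> \<le> ((1/2) powr (\<alpha> - 2)) powr (1 / p)" if K: "K > 0" for K :: real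
  proof -
    have z: "((\<lambda>\<delta>. \<delta> * (K / \<delta>) powr q) \<longlongrightarrow> 0) (at_right 0)" if "0 < q" "q < 1" for q
    proof -
      have "((\<lambda>\<delta>::real. K powr q * \<delta> powr (1 - q)) \<longlongrightarrow> K powr q * 0) (at_right 0)"
        using that eventually_at_right_less[of "0::real"]
        by (intro tendsto_mult_left tendsto_zero_powrI[where b = "1 - q"] tendsto_const tendsto_ident_at)
          (auto elim!: eventually_mono)
      moreover have "\<forall>\<^sub>F \<delta> in at_right 0. K powr q * \<delta> powr (1 - q) = \<delta> * (K / \<delta>) powr q"
        using eventually_at_right_less[of "0::real"]
      proof eventually_elim
        case (elim \<delta>)
        then show ?case using K by (simp add: powr_divide powr_diff)
      qed
      ultimately show ?thesis by (auto elim: Lim_transform_eventually)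
    qed
    define g where "g \<delta> = (1 - \<delta>) + \<delta> * (K / \<delta>) powr p" for \<delta>
    define h where "h \<delta> = (1 - \<delta>) + \<delta> * (K / \<delta>) powr (2 * p)" for \<delta>
    have "(g \<longlongrightarrow> (1 - 0) + 0) (at_right 0)" "(h \<longlongrightarrow> (1 - 0) + 0) (at_right 0)"
      unfolding g_def h_def using p p2 by (intro tendsto_intros z; simp)+
    then have "((\<lambda>\<delta>. ((g \<delta> / 2) powr (\<alpha> - 2) * h \<delta>) powr (1 / p)) \<longlongrightarrow> ((1 / 2) powr (\<alpha> - 2) * 1) powr (1 / p)) (at_right 0)"
      using p by (intro tendsto_intros) auto
    moreover have "((\<lambda>\<delta>. (1 - \<delta> + K) powr \<alpha>) \<longlongrightarrow> (1 - 0 + K) powr \<alpha>) (at_right 0)"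
      using K by (intro tendsto_intros) auto
    moreover have "\<forall>\<^sub>F \<delta> in at_right (0::real). 0 < \<delta> \<and> \<delta> < 1"
      using eventually_at_right_real[of 0 1] by (simp add: greaterThanLessThan_iff)
    then have "\<forall>\<^sub>F \<delta> in at_right 0. (1 - \<delta> + K) powr \<alpha> \<le> ((g \<delta> / 2) powr (\<alpha> - 2) * h \<delta>) powr (1 / p)"
      by eventually_elim (rule le[OF K _ _ g_def h_def], auto)
    ultimately have "(1 - 0 + K) powr \<alpha> \<le> ((1 / 2) powr (\<alpha> - 2) * 1) powr (1 / p)"
      by (intro tendsto_le[OF trivial_limit_at_right_real]) auto
    then show ?thesis by simp
  qed
  \<comment> \<open>Taking \<open>K\<close> equal to the bound itself forces
    \<open>1 + K \<le> K\<close>.\<close>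
  define K where "K = ((1/2::real) powr (\<alpha> - 2)) powr (1 / p)"
  have K: "K > 0" by (simp add: K_def)
  have "1 + K = (1 + K) powr 1" using K by simp
  also have "\<dots> \<le> (1 + K) powr \<alpha>" using K \<alpha> by (intro powr_mono) auto
  also have "\<dots> \<le> K" using le2[OF K] by (simp add: K_def)
  finally show False by simp
qed

theorem proposition5p16:
  fixes \<alpha> p :: real
  assumes "\<alpha> > 1" and "p > 0"
  shows "(Tr_G_jointly_convex \<alpha> p \<longrightarrow> max (1/2) ((\<alpha> - 1) / \<alpha>) \<le> p \<and> p \<le> 1)
    \<and> (Tr_G_jointly_convex 2 p \<longleftrightarrow> 1/2 \<le> p \<and> p \<le> 1)
    \<and> (Tr_G_jointly_convex \<alpha> 1 \<longleftrightarrow> 1 < \<alpha> \<and> \<alpha> \<le> 2)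
    \<and> (1 < \<alpha> \<and> \<alpha> \<le> 2 \<and> 0 < p \<and> p \<le> 1 \<longrightarrow>
        (\<forall>n\<ge>1. \<forall>B\<in>psd_mats n.
          mat_convex_on {A \<in> psd_mats n. loewner_le n (supp_proj B) (supp_proj A)}
            (\<lambda>A. Tr_G \<alpha> p A B)))"
proof (intro conjI)
  have nec: "max (1/2) ((\<alpha> - 1) / \<alpha>) \<le> p \<and> p \<le> 1" if "Tr_G_jointly_convex \<alpha> p" "\<alpha> > 1" for \<alpha>
  proof -
    have "1/2 \<le> p"
    \<comment> \<open>For \<open>\<alpha> > 2\<close> the bound
      \<open>(\<alpha> - 1) / \<alpha>\<close> already exceeds 1/2; the test family for 1/2 relies
      on \<open>\<alpha> - 1 \<le> 1\<close>.\<close>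
    proof (cases "\<alpha> \<le> 2")
      case False
      then have "1/2 \<le> (\<alpha> - 1) / \<alpha>" by (simp add: field_simps)
      then show ?thesis using jointly_convex_p_ge[OF that assms(2)] by linarith
    qed (use jointly_convex_p_ge_half that assms(2) in blast)
    then show ?thesis
      using jointly_convex_p_ge[OF that assms(2)] jointly_convex_p_le_1[OF that assms(2)] by simp
  qed
  then show "Tr_G_jointly_convex \<alpha> p \<longrightarrow> max (1/2) ((\<alpha> - 1) / \<alpha>) \<le> p \<and> p \<le> 1" using assms by blast
  show "Tr_G_jointly_convex 2 p \<longleftrightarrow> 1/2 \<le> p \<and> p \<le> 1"
  proof
    assume "1/2 \<le> p \<and> p \<le> 1"
    then show "Tr_G_jointly_convex 2 p"
      unfolding Tr_G_jointly_convex_def cmat.G_domain_iff by (auto intro: cmat.Tr_G_2_jointly_convex)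
  qed (use nec[of 2] in auto)
  show "Tr_G_jointly_convex \<alpha> 1 \<longleftrightarrow> 1 < \<alpha> \<and> \<alpha> \<le> 2"
  proof
    assume "1 < \<alpha> \<and> \<alpha> \<le> 2"
    then show "Tr_G_jointly_convex \<alpha> 1"
      unfolding Tr_G_jointly_convex_def cmat.G_domain_iff by (auto intro: cmat.Tr_G_1_jointly_convex)
  qed (use jointly_convex_p_1 assms(1) in blast)
  show "1 < \<alpha> \<and> \<alpha> \<le> 2 \<and> 0 < p \<and> p \<le> 1 \<longrightarrow>
        (\<forall>n\<ge>1. \<forall>B\<in>psd_mats n.
          mat_convex_on {A \<in> psd_mats n. loewner_le n (supp_proj B) (supp_proj A)}
            (\<lambda>A. Tr_G \<alpha> p A B))"
  proof (intro impI allI ballI)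
    fix n :: nat and B :: "complex mat" assume a: "1 < \<alpha> \<and> \<alpha> \<le> 2 \<and> 0 < p \<and> p \<le> 1" "B \<in> psd_mats n"
    have "cmat.dom n A B" if "A \<in> {A \<in> psd_mats n. loewner_le n (supp_proj B) (supp_proj A)}" for A
      using that a(2) cmat.loewner_supp_iff[of A n B] by (simp add: cmat.dom_def)
    then show "mat_convex_on {A \<in> psd_mats n. loewner_le n (supp_proj B) (supp_proj A)} (\<lambda>A. Tr_G \<alpha> p A B)"
      unfolding mat_convex_on_def using a(1) by (intro ballI cmat.Tr_G_convex_fst) auto
  qed
qed

end
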